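(* Up to automorphism of $\mathbb{P}^2_{\mathbb{C}}$ there are exactly five homogeneous convex foliations of degree $4$ on $\mathbb{P}^2_{\mathbb{C}}$, namely the foliations $\mathcal{H}_1,\ldots,\mathcal{H}_5$ defined respectively in the affine chart $(x,y)=[x:y:1]$ by the $1$-forms 1. $\omega_1=y^4\,\mathrm{d}x-x^4\,\mathrm{d}y$; 2. $\omega_2=y^3(2x-y)\,\mathrm{d}x+x^3(x-2y)\,\mathrm{d}y$; 3. $\omega_3=y^2(6x^2+4xy+y^2)\,\mathrm{d}x-x^3(x+4y)\,\mathrm{d}y$; 4. $\omega_4=y^3(4x+y)\,\mathrm{d}x+x^3(x+4y)\,\mathrm{d}y$; 5. $\omega_5=y^2(6x^2+4xy+y^2)\,\mathrm{d}x+3x^4\,\mathrm{d}y$. That is, each $\mathcal{H}_i$ is a homogeneous convex foliation of degree $4$, every homogeneous convex foliation of degree $4$ on $\mathbb{P}^2_{\mathbb{C}}$ is conjugate by an element of $\mathrm{Aut}(\mathbb{P}^2_{\mathbb{C}})=\mathrm{PGL}_3(\mathbb{C})$ to one of $\mathcal{H}_1,\ldots,\mathcal{H}_5$, and $\mathcal{H}_1,\ldots,\mathcal{H}_5$ are pairwise non-conjugate under $\mathrm{Aut}(\mathbb{P}^2_{\mathbb{C}})$.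
   Context: A (holomorphic) foliation $\mathcal{F}$ of degree $d$ on $\mathbb{P}^2_{\mathbb{C}}$ is given in homogeneous coordinates $[x:y:z]$, up to a nonzero scalar factor, by a $1$-form $\omega=a\,\mathrm{d}x+b\,\mathrm{d}y+c\,\mathrm{d}z$ with $a,b,c\in\mathbb{C}[x,y,z]$ homogeneous of degree $d+1$ without common factor and $xa+yb+zc=0$. In the affine chart $z=1$ it is described by the restriction of $\omega$; conversely a polynomial $1$-form in $(x,y)$ whose coefficients have no common factor defines a foliation on $\mathbb{P}^2_{\mathbb{C}}$ by homogenization. An irreducible curve is invariant by $\mathcal{F}$ if $\omega$ restricts to zero on it. Inflection divisor: write $\omega=i_{\mathrm{R}}i_{\mathrm{Z}}(\mathrm{d}x\wedge\mathrm{d}y\wedge\mathrm{d}z)$ with $\mathrm{R}=x\partial_x+y\partial_y+z\partial_z$ and $\mathrm{Z}=E\partial_x+F\partial_y+G\partial_z$ a homogeneous vector field of degree $d$ on $\mathbb{C}^3$ (not collinear to $\mathrm{R}$). The inflection divisor $\mathrm{I}_{\mathcal{F}}$ is the divisor of degree $3d$ on $\mathbb{P}^2_{\mathbb{C}}$ defined by $$\det\begin{pmatrix} x & E & \mathrm{Z}(E)\\ y & F & \mathrm{Z}(F)\\ z & G & \mathrm{Z}(G)\end{pmatrix}=0.$$ The foliation $\mathcal{F}$ is convex if $\mathrm{I}_{\mathcal{F}}$ is a product of invariant lines of $\mathcal{F}$ (equivalently, the leaves of $\mathcal{F}$ other than straight lines have no inflection points). A foliation of degree $d$ on $\mathbb{P}^2_{\mathbb{C}}$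 is homogeneous if there is an affine chart $(x,y)$ of $\mathbb{P}^2_{\mathbb{C}}$ in which it is invariant under all homotheties $(x,y)\mapsto\lambda(x,y)$, $\lambda\in\mathbb{C}^*$; it is then defined in that chart by a $1$-form $A(x,y)\,\mathrm{d}x+B(x,y)\,\mathrm{d}y$ with $A,B$ homogeneous polynomials of degree $d$ without common factor. *)

theory Defs
  imports
    "HOL-Analysis.Analysis"
    "HOL-Computational_Algebra.Polynomial_Factorial"
begin

text \<open>
  Polynomials in \<open>x, y, z\<close> are nested univariate polynomials: \<open>z\<close> is the outermost variable and
  \<open>x\<close> the innermost, so \<open>coeff (coeff (coeff p k) j) i\<close> is the coefficient of \<open>x ^ i * y ^ j * z ^ k\<close>.
  Likewise \<open>complex poly poly\<close> is the ring of polynomials in \<open>x, y\<close>, with \<open>x\<close> innermost.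
\<close>

type_synonym poly2 = "complex poly poly"
type_synonym poly3 = "complex poly poly poly"

definition const3 :: "complex \<Rightarrow> poly3" where
  "const3 c = [:[:[:c:]:]:]"

definition vars3 :: "poly3 ^ 3" where
  "vars3 = vector [[:[:[:0, 1:]:]:], [:[:0, 1:]:], [:0, 1:]]"

definition homogeneous_poly :: "nat \<Rightarrow> poly3 \<Rightarrow> bool" where
  "homogeneous_poly n p \<longleftrightarrow>
     (\<forall>i j k. coeff (coeff (coeff p k) j) i \<noteq> 0 \<longrightarrow> i + j + k = n)"

text \<open>
  Substitution of \<open>u $ 1, u $ 2, u $ 3\<close> for \<open>x, y, z\<close>, the coefficients being mapped along a ring
  homomorphism \<open>h\<close>. Evaluation at a point is \<open>h = id\<close>; substitution of polynomials is \<open>h = const3\<close>.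
\<close>

definition subst3 :: "(complex \<Rightarrow> 'a::comm_ring_1) \<Rightarrow> 'a ^ 3 \<Rightarrow> poly3 \<Rightarrow> 'a" where
  "subst3 h u p =
     poly (map_poly (\<lambda>q. poly (map_poly (\<lambda>r. poly (map_poly h r) (u $ 1)) q) (u $ 2)) p) (u $ 3)"

text \<open>
  A homogeneous vector field \<open>E \<partial>\<^sub>x + F \<partial>\<^sub>y + G \<partial>\<^sub>z\<close> and a 1-form \<open>a dx + b dy + c dz\<close> on
  \<open>\<complex>\<^sup>3\<close> are both given by their vector of coefficients.
\<close>

type_synonym vfield = "poly3 ^ 3"
type_synonym form = "poly3 ^ 3"

definition form_at :: "form \<Rightarrow> complex ^ 3 \<Rightarrow> complex ^ 3 \<Rightarrow> complex" where
  "form_at \<omega> v w = (\<Sum>i\<in>UNIV. subst3 id v (\<omega> $ i) * w $ i)"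

definition deriv_along :: "vfield \<Rightarrow> poly3 \<Rightarrow> poly3" where
  "deriv_along Z p =
     Z $ 1 * map_poly (map_poly pderiv) p + Z $ 2 * map_poly pderiv p + Z $ 3 * pderiv p"


subsection \<open>Foliations of the projective plane\<close>

definition foliation_form :: "nat \<Rightarrow> form \<Rightarrow> bool" where
  "foliation_form d \<omega> \<longleftrightarrow>
     (\<forall>i. homogeneous_poly (d + 1) (\<omega> $ i)) \<and>
     (\<forall>q. (\<forall>i. q dvd \<omega> $ i) \<longrightarrow> is_unit q) \<and>
     (\<Sum>i\<in>UNIV. vars3 $ i * \<omega> $ i) = 0"

text \<open>A foliation is the set of all 1-forms defining it, a class modulo nonzero scalars.\<close>

type_synonym foliation = "form set"

definition is_foliation :: "nat \<Rightarrow> foliation \<Rightarrow> bool" where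
  "is_foliation d \<F> \<longleftrightarrow>
     (\<exists>\<omega>. foliation_form d \<omega> \<and> \<F> = {const3 c *s \<omega> | c. c \<noteq> 0})"

definition chart_restriction :: "form \<Rightarrow> poly2 \<times> poly2" where
  "chart_restriction \<omega> = (poly (\<omega> $ 1) 1, poly (\<omega> $ 2) 1)"

text \<open>
  The foliation whose restriction to the chart \<open>z = 1\<close> is given by \<open>A dx + B dy\<close>, where \<open>A\<close> and
  \<open>B\<close> have no common factor.
\<close>

definition affine_foliation :: "poly2 \<times> poly2 \<Rightarrow> foliation" where
  "affine_foliation \<eta> =
     {\<omega>. (\<exists>d. foliation_form d \<omega>) \<and>
         (\<exists>c. c \<noteq> 0 \<and> chart_restriction \<omega> = ([:[:c:]:] * fst \<eta>, [:[:c:]:] * snd \<eta>))}"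


subsection \<open>Automorphisms\<close>

text \<open>The pullback of \<open>\<omega>\<close> under the linear map \<open>v \<mapsto> M v\<close>.\<close>

definition pullback :: "complex ^ 3 ^ 3 \<Rightarrow> form \<Rightarrow> form" where
  "pullback M \<omega> =
     (\<chi> j. \<Sum>i\<in>UNIV.
        subst3 const3 (\<chi> k. \<Sum>l\<in>UNIV. const3 (M $ k $ l) * vars3 $ l) (\<omega> $ i) * const3 (M $ i $ j))"

definition conjugate :: "foliation \<Rightarrow> foliation \<Rightarrow> bool" where
  "conjugate \<F> \<G> \<longleftrightarrow> (\<exists>M. invertible M \<and> pullback M ` \<F> = \<G>)"

definition homothety :: "complex \<Rightarrow> complex ^ 3 ^ 3" where
  "homothety t = vector [vector [t, 0, 0], vector [0, t, 0], vector [0, 0, 1]]"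

text \<open>The matrix \<open>M\<close> chooses an affine chart: it takes the chart \<open>z = 1\<close> to the new one.\<close>

definition homogeneous_foliation :: "nat \<Rightarrow> foliation \<Rightarrow> bool" where
  "homogeneous_foliation d \<F> \<longleftrightarrow>
     is_foliation d \<F> \<and>
     (\<exists>M. invertible M \<and>
        (\<forall>t. t \<noteq> 0 \<longrightarrow> pullback (homothety t) ` pullback M ` \<F> = pullback M ` \<F>))"


subsection \<open>Convexity\<close>

text \<open>The 1-form \<open>i\<^sub>R i\<^sub>Z (dx \<and> dy \<and> dz)\<close>, that is \<open>w \<mapsto> det (Z, R, w)\<close>, for the radial field \<open>R\<close>.\<close>

definition contract_radial :: "vfield \<Rightarrow> form" where
  "contract_radial Z = vector
     [Z $ 2 * vars3 $ 3 - Z $ 3 * vars3 $ 2,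
      Z $ 3 * vars3 $ 1 - Z $ 1 * vars3 $ 3,
      Z $ 1 * vars3 $ 2 - Z $ 2 * vars3 $ 1]"

definition inflection_poly :: "vfield \<Rightarrow> poly3" where
  "inflection_poly Z = det ((\<chi> i. vector [vars3 $ i, Z $ i, deriv_along Z (Z $ i)]) :: poly3 ^ 3 ^ 3)"

definition linear_poly :: "complex ^ 3 \<Rightarrow> poly3" where
  "linear_poly l = (\<Sum>i\<in>UNIV. const3 (l $ i) * vars3 $ i)"

text \<open>The 1-form \<open>\<omega>\<close> restricts to zero on the line with equation \<open>l $ 1 * x + l $ 2 * y + l $ 3 * z = 0\<close>.\<close>

definition invariant_line :: "form \<Rightarrow> complex ^ 3 \<Rightarrow> bool" where
  "invariant_line \<omega> l \<longleftrightarrow>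
     l \<noteq> 0 \<and>
     (\<forall>v w. (\<Sum>i\<in>UNIV. l $ i * v $ i) = 0 \<longrightarrow> (\<Sum>i\<in>UNIV. l $ i * w $ i) = 0 \<longrightarrow>
        form_at \<omega> v w = 0)"

text \<open>
  The field \<open>Z\<close> exists for every foliation and is unique up to adding a multiple of \<open>R\<close>, which
  does not change the inflection polynomial.
\<close>

definition convex_foliation :: "nat \<Rightarrow> foliation \<Rightarrow> bool" where
  "convex_foliation d \<F> \<longleftrightarrow>
     is_foliation d \<F> \<and>
     (\<exists>\<omega>\<in>\<F>. \<exists>Z. (\<forall>i. homogeneous_poly d (Z $ i)) \<and> \<omega> = contract_radial Z \<and>
        (\<exists>c ls. c \<noteq> 0 \<and> (\<forall>l\<in>set ls. invariant_line \<omega> l) \<and>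
           inflection_poly Z = const3 c * prod_list (map linear_poly ls)))"


subsection \<open>The five foliations\<close>

definition X :: poly2 where "X = [:[:0, 1:]:]"
definition Y :: poly2 where "Y = [:0, 1:]"

definition \<H>1 :: foliation where
  "\<H>1 = affine_foliation (Y^4, - (X^4))"

definition \<H>2 :: foliation where
  "\<H>2 = affine_foliation (Y^3 * (2 * X - Y), X^3 * (X - 2 * Y))"

definition \<H>3 :: foliation where
  "\<H>3 = affine_foliation (Y^2 * (6 * X^2 + 4 * X * Y + Y^2), - (X^3 * (X + 4 * Y)))"

definition \<H>4 :: foliation where
  "\<H>4 = affine_foliation (Y^3 * (4 * X + Y), X^3 * (X + 4 * Y))"

definition \<H>5 :: foliation where
  "\<H>5 = affine_foliation (Y^2 * (6 * X^2 + 4 * X * Y + Y^2), 3 * X^4)"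

end

theory Submission
  imports Defs "HOL-Computational_Algebra.Fundamental_Theorem_Algebra"
begin

text \<open>
  Why the theorem holds. In a chart in which it is invariant under homotheties, a homogeneous foliation
  of degree 4 is given by \<open>\<omega> = z (A dx + B dy) - (x A + y B) dz\<close> with binary quartics \<open>A, B\<close> without
  common zero. The same data are a rational map \<open>[x : y] \<mapsto> [- B : A]\<close> of degree 4 of the
  projective line, and linear changes of \<open>x, y\<close> act on it by conjugation. Let \<open>C = x A + y B\<close>, whose
  zeros are the fixed points of the map, and let \<open>J\<close> be the Jacobian of \<open>A, B\<close>, whose zeros are its
  critical points. The inflection polynomial of \<open>\<omega>\<close> is \<open>z C J / 4\<close>, and a line through the origin is
  invariant exactly when its direction is a fixed point. Hence the foliation is convex if and only if
  every critical point of the map is a fixed point.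

  Such a map has six critical points, counted with multiplicity, and none has multiplicity above 3. A
  fixed critical point \<open>r\<close> of multiplicity \<open>k\<close> of the map in an affine coordinate \<open>t\<close> is a zero of
  order \<open>k + 1\<close> of \<open>r A(t, 1) + B(t, 1)\<close> (\<open>contact_order\<close>). There are at most four distinct fixed
  critical points. Indeed, for \<open>a = A(t, 1)\<close> and \<open>b = B(t, 1)\<close>, five of them would be common zeros of
  \<open>t a' + b'\<close>, of degree at most 4, and of \<open>t a + b\<close>; so the former vanishes, which lowers the degree
  of the latter to 4, so that it vanishes too and the map is degenerate. So the multiplicities are one of
  \<open>(3,3)\<close>, \<open>(2,2,2)\<close>, \<open>(3,2,1)\<close>, \<open>(2,2,1,1)\<close>, \<open>(3,1,1,1)\<close>. In coordinates in which two
  of the critical points are \<open>[0 : 1]\<close> and \<open>[1 : 0]\<close>, the contact conditions at the remaining ones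
  determine \<open>A, B\<close> up to scaling of the coordinates; this gives one model for each type
  (\<open>plane_classification\<close>, applied to the normal form of \<open>convex_homogeneous_normal_form\<close>).

  The models are convex because the inflection polynomial of each factors explicitly
  (\<open>convex_foliation_models\<close>). They are pairwise not conjugate: a projective automorphism between two of
  them fixes the origin of the chart and therefore induces a linear equivalence of the pairs \<open>A, B\<close>, and
  such an equivalence preserves the number of fixed critical points and the existence of a point of
  total ramification (\<open>model_foliations_not_conjugate\<close>).

  Polynomials in three variables are compared through their values at all points of \<open>\<complex>\<^sup>3\<close>, which makes
  pullbacks and determinants into matrix computations.
\<close>

section \<open>Evaluation of polynomials in three variables\<close>

definition ring_homomorphism :: "('a::comm_ring_1 \<Rightarrow> 'b::comm_ring_1) \<Rightarrow> bool" where
  "ring_homomorphism h \<longleftrightarrow>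
     h 0 = 0 \<and> h 1 = 1 \<and> (\<forall>a b. h (a + b) = h a + h b) \<and> (\<forall>a b. h (a * b) = h a * h b)"

lemma poly_map_poly_pCons:
  assumes "ring_homomorphism h"
  shows "poly (map_poly h (pCons a p)) x = h a + x * poly (map_poly h p) x"
  using assms by (simp add: ring_homomorphism_def map_poly_pCons)

lemma poly_map_poly_add:
  assumes "ring_homomorphism h"
  shows "poly (map_poly h (p + q)) x = poly (map_poly h p) x + poly (map_poly h q) x"
proof (induction p arbitrary: q)
  case 0
  then show ?case by simp
next
  case (pCons a p)
  obtain b r where q: "q = pCons b r" by (cases q)
  show ?case
    using assms pCons.IH[of r] unfolding q
    by (simp add: poly_map_poly_pCons ring_homomorphism_def algebra_simps)
qed

lemma ring_homomorphism_poly_map_poly: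
  assumes "ring_homomorphism h"
  shows "ring_homomorphism (\<lambda>p. poly (map_poly h p) x)"
proof -
  have h: "h 0 = 0" "h 1 = 1" "\<And>a b. h (a * b) = h a * h b"
    using assms by (auto simp: ring_homomorphism_def)
  have smult: "poly (map_poly h (smult a q)) x = h a * poly (map_poly h q) x" for a q
    by (induction q) (simp_all add: poly_map_poly_pCons[OF assms] h algebra_simps)
  have "poly (map_poly h (p * q)) x = poly (map_poly h p) x * poly (map_poly h q) x" for p q
    by (induction p)
      (simp_all add: poly_map_poly_pCons[OF assms] poly_map_poly_add[OF assms] smult h algebra_simps)
  then show ?thesis
    using h by (auto simp: ring_homomorphism_def poly_map_poly_add[OF assms])
qed

lemma ring_homomorphism_subst3:
  assumes "ring_homomorphism h"
  shows "ring_homomorphism (subst3 h u)"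
  unfolding subst3_def by (intro ring_homomorphism_poly_map_poly assms)

lemma ring_homomorphism_id: "ring_homomorphism id"
  and ring_homomorphism_const3: "ring_homomorphism const3"
  by (simp_all add: ring_homomorphism_def const3_def pCons_one)

lemma vars3_nth:
  "vars3 $ 1 = [:[:[:0, 1:]:]:]" "vars3 $ 2 = [:[:0, 1:]:]" "vars3 $ 3 = [:0, 1:]"
  by (simp_all add: vars3_def)

text \<open>
  Every polynomial arises from constants and variables by sums and products. Statements about
  substitutions and derivations, which are determined by their values on constants and variables, are
  proved by this induction.
\<close>

lemma poly3_induct [case_names const var add mult]:
  assumes const: "\<And>c. P (const3 c)" and var: "\<And>i. P (vars3 $ i)"
    and add: "\<And>p q. P p \<Longrightarrow> P q \<Longrightarrow> P (p + q)" and mult: "\<And>p q. P p \<Longrightarrow> P q \<Longrightarrow> P (p * q)"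
  shows "P (p :: poly3)"
proof -
  have x: "P [:[:r:]:]" for r
  proof (induction r)
    case 0
    show ?case using const[of 0] by (simp add: const3_def)
  next
    case (pCons a r)
    have "[:[:pCons a r:]:] = const3 a + vars3 $ 1 * [:[:r:]:]"
      by (simp add: const3_def vars3_nth)
    then show ?case using const var add mult pCons.IH by metis
  qed
  have y: "P [:q:]" for q
  proof (induction q)
    case 0
    show ?case using x[of 0] by simp
  next
    case (pCons r q)
    have "[:pCons r q:] = [:[:r:]:] + vars3 $ 2 * [:q:]" by (simp add: vars3_nth)
    then show ?case using x var add mult pCons.IH by metis
  qed
  show ?thesis
  proof (induction p)
    case 0
    show ?case using y[of 0] by simp
  next
    case (pCons q p)
    have "pCons q p = [:q:] + vars3 $ 3 * p" by (simp add: vars3_nth)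
    then show ?case using y var add mult pCons.IH by metis
  qed
qed

definition eval3 :: "poly3 \<Rightarrow> complex ^ 3 \<Rightarrow> complex" where
  "eval3 p v = subst3 id v p"

context
  fixes h :: "complex \<Rightarrow> 'a::comm_ring_1" assumes h: "ring_homomorphism h"
begin

lemma subst3_simps_hom:
  "subst3 h u 0 = 0" "subst3 h u 1 = 1"
  "subst3 h u (p + q) = subst3 h u p + subst3 h u q"
  "subst3 h u (p * q) = subst3 h u p * subst3 h u q"
  "subst3 h u (const3 c) = h c"
  "subst3 h u (vars3 $ i) = u $ i"
proof -
  note hom = ring_homomorphism_subst3[OF h, of u, unfolded ring_homomorphism_def]
  show "subst3 h u 0 = 0" "subst3 h u 1 = 1"
    "subst3 h u (p + q) = subst3 h u p + subst3 h u q"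
    "subst3 h u (p * q) = subst3 h u p * subst3 h u q"
    using hom by blast+
  have h0: "h 0 = 0" "h 1 = 1" using h by (auto simp: ring_homomorphism_def)
  show "subst3 h u (const3 c) = h c"
    by (simp add: subst3_def const3_def map_poly_pCons h0)
  show "subst3 h u (vars3 $ i) = u $ i"
    using exhaust_3[of i] by (auto simp: vars3_nth subst3_def map_poly_pCons h0)
qed

lemma subst3_minus_hom: "subst3 h u (- p) = - subst3 h u p"
proof -
  have "subst3 h u p + subst3 h u (- p) = 0"
    using subst3_simps_hom(1,3) by (metis add.right_inverse)
  then show ?thesis by (simp add: eq_neg_iff_add_eq_0 add.commute)
qed

lemma subst3_diff_hom: "subst3 h u (p - q) = subst3 h u p - subst3 h u q"
  by (metis subst3_minus_hom subst3_simps_hom(3) diff_conv_add_uminus)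

lemma subst3_power_hom: "subst3 h u (p ^ n) = subst3 h u p ^ n"
  by (induction n) (simp_all add: subst3_simps_hom)

lemma subst3_sum_hom: "subst3 h u (sum f A) = (\<Sum>a\<in>A. subst3 h u (f a))"
  by (induction A rule: infinite_finite_induct) (simp_all add: subst3_simps_hom)

lemmas subst3_hom = subst3_simps_hom subst3_minus_hom subst3_diff_hom subst3_power_hom
  subst3_sum_hom

end

lemmas eval3_hom [simp] = subst3_hom[OF ring_homomorphism_id, folded eval3_def, unfolded id_apply]
lemmas subst3_const3_hom [simp] = subst3_hom[OF ring_homomorphism_const3]

lemma eval3_prod_list [simp]: "eval3 (prod_list ps) v = prod_list (map (\<lambda>p. eval3 p v) ps)"
  by (induction ps) simp_all

lemma eval3_subst3: "eval3 (subst3 const3 u p) v = eval3 p (\<chi> i. eval3 (u $ i) v)"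
  by (induction p rule: poly3_induct) simp_all

text \<open>
  The coefficients are removed one variable at a time: a univariate polynomial over the infinite field
  \<open>\<complex>\<close> with only zeros vanishes.
\<close>

lemma eval3_eq_0_iff: "(\<forall>v. eval3 p v = 0) \<longleftrightarrow> p = 0"
proof
  assume z: "\<forall>v. eval3 p v = 0"
  have "coeff p k = 0" for k
  proof -
    have "coeff (coeff p k) j = 0" for j
    proof -
      have "poly (coeff (coeff p k) j) x = 0" for x
      proof -
        define f where "f = (\<lambda>r :: complex poly. poly r x)"
        have f0: "f 0 = 0" by (simp add: f_def)
        have g0: "poly (map_poly f 0) y = 0" for y by simp
        have "poly (map_poly f (coeff p k)) y = 0" for y
        proof -
          have "poly (map_poly (\<lambda>q. poly (map_poly f q) y) p) z = 0" for z
            using z[rule_format, of "vector [x, y, z]"] by (simp add: eval3_def subst3_def f_def)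
          then have "map_poly (\<lambda>q. poly (map_poly f q) y) p = 0"
            using poly_all_0_iff_0 by blast
          then show ?thesis by (metis coeff_0 coeff_map_poly g0)
        qed
        then have "map_poly f (coeff p k) = 0" using poly_all_0_iff_0 by blast
        then show ?thesis by (metis coeff_0 coeff_map_poly f0 f_def)
      qed
      then show ?thesis using poly_all_0_iff_0 by blast
    qed
    then show ?thesis by (simp add: poly_eq_iff)
  qed
  then show "p = 0" by (simp add: poly_eq_iff)
qed simp

lemma eval3_eqI: "(\<And>v. eval3 p v = eval3 q v) \<Longrightarrow> p = q"
  using eval3_eq_0_iff[of "p - q"] by simp

lemma form_eqI:
  fixes \<omega> \<eta> :: form
  shows "(\<And>i v. eval3 (\<omega> $ i) v = eval3 (\<eta> $ i) v) \<Longrightarrow> \<omega> = \<eta>"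
  by (simp add: vec_eq_iff eval3_eqI)

section \<open>Derivatives along vector fields\<close>

text \<open>
  A derivation of the coefficient ring extends coefficientwise to a derivation of the polynomial
  ring. Two applications to \<open>pderiv\<close> give the partial derivatives with respect to the inner variables.
\<close>

lemma map_poly_derivation:
  fixes \<delta> :: "'a::comm_ring_1 \<Rightarrow> 'a"
  assumes add: "\<And>a b. \<delta> (a + b) = \<delta> a + \<delta> b"
    and mult: "\<And>a b. \<delta> (a * b) = \<delta> a * b + a * \<delta> b"
  shows "map_poly \<delta> (p + q) = map_poly \<delta> p + map_poly \<delta> q"
    "map_poly \<delta> (p * q) = map_poly \<delta> p * q + p * map_poly \<delta> q"
proof -
  have d0: "\<delta> 0 = 0" using add[of 0 0] by simp
  have "\<delta> (sum f A) = (\<Sum>a\<in>A. \<delta> (f a))" if "finite A" for f and A :: "nat set"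
    using that by induction (simp_all add: d0 add)
  then show "map_poly \<delta> (p + q) = map_poly \<delta> p + map_poly \<delta> q"
    "map_poly \<delta> (p * q) = map_poly \<delta> p * q + p * map_poly \<delta> q"
    by (auto simp: poly_eq_iff coeff_map_poly d0 add mult coeff_mult sum.distrib)
qed

lemma deriv_along_add: "deriv_along Z (p + q) = deriv_along Z p + deriv_along Z q"
  and deriv_along_mult: "deriv_along Z (p * q) = deriv_along Z p * q + p * deriv_along Z q"
proof -
  have 1: "pderiv (a + b) = pderiv a + pderiv b" "pderiv (a * b) = pderiv a * b + a * pderiv b"
    for a b :: "'c::{comm_ring_1,ring_no_zero_divisors} poly"
    by (simp_all add: pderiv_add pderiv_mult)
  note 2 = map_poly_derivation[of pderiv, OF 1]
  note 3 = map_poly_derivation[of "map_poly pderiv", OF 2]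
  show "deriv_along Z (p + q) = deriv_along Z p + deriv_along Z q"
    by (simp add: deriv_along_def 1 2 3 algebra_simps)
  show "deriv_along Z (p * q) = deriv_along Z p * q + p * deriv_along Z q"
    by (simp add: deriv_along_def 1 2 3 algebra_simps)
qed

lemma deriv_along_const [simp]: "deriv_along Z (const3 c) = 0"
  by (simp add: deriv_along_def const3_def map_poly_pCons)

lemma deriv_along_0 [simp]: "deriv_along Z 0 = 0"
  by (simp add: deriv_along_def)

lemma deriv_along_var [simp]: "deriv_along Z (vars3 $ i) = Z $ i"
  using exhaust_3[of i]
  by (auto simp: vars3_nth deriv_along_def map_poly_pCons pderiv_pCons map_poly_1 simp flip: one_pCons)

lemma deriv_along_minus: "deriv_along Z (- p) = - deriv_along Z p"
  using deriv_along_add[of Z p "- p"] by (simp add: eq_neg_iff_add_eq_0 add.commute)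

lemma deriv_along_sum: "deriv_along Z (sum f A) = (\<Sum>a\<in>A. deriv_along Z (f a))"
  by (induction A rule: infinite_finite_induct) (simp_all add: deriv_along_add)

lemma deriv_along_power: "deriv_along Z (p ^ n) = of_nat n * p ^ (n - 1) * deriv_along Z p"
proof (induction n)
  case 0
  show ?case using deriv_along_const[of Z 1] by (simp add: const3_def one_pCons)
next
  case (Suc n)
  then show ?case by (cases n) (simp_all add: deriv_along_mult algebra_simps)
qed

lemma deriv_along_add_field:
  "deriv_along (Z + W) p = deriv_along Z p + deriv_along W p"
  "deriv_along (g *s Z) p = g * deriv_along Z p"
  by (simp_all add: deriv_along_def algebra_simps)

section \<open>Homogeneous polynomials\<close>

lemma homogeneous_poly_0 [simp]: "homogeneous_poly n 0"
  by (simp add: homogeneous_poly_def)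

lemma homogeneous_poly_const3: "homogeneous_poly 0 (const3 c)"
  by (auto simp: homogeneous_poly_def const3_def coeff_pCons split: nat.splits)

lemma homogeneous_poly_vars3: "homogeneous_poly 1 (vars3 $ i)"
  using exhaust_3[of i]
  by (auto simp: vars3_nth homogeneous_poly_def coeff_pCons one_pCons split: nat.splits)

lemma homogeneous_poly_add:
  "homogeneous_poly n p \<Longrightarrow> homogeneous_poly n q \<Longrightarrow> homogeneous_poly n (p + q)"
  unfolding homogeneous_poly_def coeff_add by (metis add.right_neutral)

lemma homogeneous_poly_minus: "homogeneous_poly n p \<Longrightarrow> homogeneous_poly n (- p)"
  by (simp add: homogeneous_poly_def)

lemma homogeneous_poly_sum:
  "(\<And>a. a \<in> A \<Longrightarrow> homogeneous_poly n (f a)) \<Longrightarrow> homogeneous_poly n (sum f A)"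
  by (induction A rule: infinite_finite_induct) (simp_all add: homogeneous_poly_add)

lemma homogeneous_poly_mult:
  assumes "homogeneous_poly m p" "homogeneous_poly n q"
  shows "homogeneous_poly (m + n) (p * q)"
  unfolding homogeneous_poly_def
proof (intro allI impI)
  fix i j k assume nz: "coeff (coeff (coeff (p * q) k) j) i \<noteq> 0"
  have "coeff (coeff (coeff (p * q) k) j) i =
    (\<Sum>k'\<le>k. \<Sum>j'\<le>j. \<Sum>i'\<le>i. coeff (coeff (coeff p k') j') i' *
      coeff (coeff (coeff q (k - k')) (j - j')) (i - i'))"
    by (simp add: coeff_mult coeff_sum)
  then obtain k' j' i' where le: "k' \<le> k" "j' \<le> j" "i' \<le> i"
    and "coeff (coeff (coeff p k') j') i' * coeff (coeff (coeff q (k - k')) (j - j')) (i - i') \<noteq> 0"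
    using nz by (auto elim!: sum.not_neutral_contains_not_neutral)
  then have "coeff (coeff (coeff p k') j') i' \<noteq> 0"
    "coeff (coeff (coeff q (k - k')) (j - j')) (i - i') \<noteq> 0" by auto
  then have "i' + j' + k' = m" "(i - i') + (j - j') + (k - k') = n"
    using assms unfolding homogeneous_poly_def by blast+
  then show "i + j + k = m + n" using le by linarith
qed

lemma homogeneous_poly_power:
  "homogeneous_poly m p \<Longrightarrow> homogeneous_poly (n * m) (p ^ n)"
proof (induction n)
  case 0
  then show ?case using homogeneous_poly_const3[of 1] by (simp add: const3_def one_pCons)
next
  case (Suc n)
  then show ?case using homogeneous_poly_mult by fastforce
qed

text \<open>
  The coefficients are listed by the exponent of \<open>x\<close>, so that for \<open>y = 1\<close> the form becomes the
  univariate polynomial with the same coefficients.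
\<close>

definition binary_form :: "nat \<Rightarrow> (nat \<Rightarrow> complex) \<Rightarrow> poly3" where
  "binary_form m a = (\<Sum>i\<le>m. const3 (a i) * vars3 $ 1 ^ i * vars3 $ 2 ^ (m - i))"

lemma eval3_binary_form:
  "eval3 (binary_form m a) v = (\<Sum>i\<le>m. a i * v $ 1 ^ i * v $ 2 ^ (m - i))"
  by (simp add: binary_form_def)

lemma homogeneous_poly_const3_mult: "homogeneous_poly n p \<Longrightarrow> homogeneous_poly n (const3 c * p)"
  using homogeneous_poly_mult[OF homogeneous_poly_const3] by fastforce

lemma poly_map_poly_sum:
  fixes f :: "'a::zero \<Rightarrow> complex"
  assumes "f 0 = 0" "\<And>k. k > N \<Longrightarrow> coeff p k = 0"
  shows "poly (map_poly f p) z = (\<Sum>k\<le>N. f (coeff p k) * z ^ k)"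
proof -
  have "degree (map_poly f p) \<le> N"
    using assms by (intro degree_le) (simp add: coeff_map_poly)
  then have "poly (map_poly f p) z = (\<Sum>k\<le>N. coeff (map_poly f p) k * z ^ k)"
    by (force intro!: sum.mono_neutral_left le_degree simp: poly_altdef coeff_eq_0)
  then show ?thesis using assms(1) by (simp add: coeff_map_poly)
qed

text \<open>
  Sorting the monomials by powers of \<open>z\<close> leaves binary forms in \<open>x, y\<close> as coefficients. This is
  how homogeneity enters all arguments about homotheties and affine charts.
\<close>

lemma homogeneous_poly_expansion:
  assumes "homogeneous_poly n p"
  obtains c where "p = (\<Sum>k\<le>n. vars3 $ 3 ^ k * binary_form (n - k) (c k))"
proof
  let ?c = "\<lambda>k i. coeff (coeff (coeff p k) (n - k - i)) i"
  have nz: "i + j + k = n" if "coeff (coeff (coeff p k) j) i \<noteq> 0" for i j k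
    using assms that by (auto simp: homogeneous_poly_def)
  show "p = (\<Sum>k\<le>n. vars3 $ 3 ^ k * binary_form (n - k) (?c k))"
  proof (rule eval3_eqI)
    fix v :: "complex ^ 3"
    define f where "f = (\<lambda>r :: complex poly. poly r (v $ 1))"
    define g where "g = (\<lambda>q. poly (map_poly f q) (v $ 2))"
    have inner: "poly (coeff (coeff p k) j) x = ?c k (n - k - j) * x ^ (n - k - j)"
      if "k \<le> n" "j \<le> n - k" for k j x
    proof -
      have "coeff (coeff p k) j = monom (?c k (n - k - j)) (n - k - j)"
        using nz[of k j] that by (auto simp: poly_eq_iff) fastforce
      then show ?thesis by (metis poly_monom)
    qed
    have "coeff p k = 0" if "k > n" for k
    proof -
      have "coeff (coeff (coeff p k) j) i = 0" for i j using nz[of k j i] that by auto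
      then show ?thesis by (simp add: poly_eq_iff)
    qed
    moreover have "g 0 = 0" by (simp add: g_def)
    ultimately have "eval3 p v = (\<Sum>k\<le>n. g (coeff p k) * v $ 3 ^ k)"
      using poly_map_poly_sum[of g n p "v $ 3"] by (simp add: eval3_def subst3_def f_def g_def id_def)
    also have "\<dots> = (\<Sum>k\<le>n. v $ 3 ^ k * (\<Sum>i\<le>n - k. ?c k i * v $ 1 ^ i * v $ 2 ^ (n - k - i)))"
    proof (rule sum.cong, rule refl)
      fix k assume k: "k \<in> {..n}"
      have "coeff (coeff p k) j = 0" if "j > n - k" for j
      proof -
        have "coeff (coeff (coeff p k) j) i = 0" for i using nz[of k j i] that k by fastforce
        then show ?thesis by (simp add: poly_eq_iff)
      qed
      moreover have "f 0 = 0" by (simp add: f_def)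
      ultimately have "g (coeff p k) = (\<Sum>j\<le>n - k. f (coeff (coeff p k) j) * v $ 2 ^ j)"
        unfolding g_def by (simp add: poly_map_poly_sum)
      also have "\<dots> = (\<Sum>j\<le>n - k. ?c k (n - k - j) * v $ 1 ^ (n - k - j) * v $ 2 ^ j)"
        using k by (intro sum.cong) (simp_all add: f_def inner)
      also have "\<dots> = (\<Sum>i\<le>n - k. ?c k i * v $ 1 ^ i * v $ 2 ^ (n - k - i))"
        by (rule sum.reindex_bij_witness[of _ "\<lambda>i. n - k - i" "\<lambda>i. n - k - i"])
          (use k in auto)
      finally show "g (coeff p k) * v $ 3 ^ k =
          v $ 3 ^ k * (\<Sum>i\<le>n - k. ?c k i * v $ 1 ^ i * v $ 2 ^ (n - k - i))"
        by simp
    qed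
    finally show "eval3 p v = eval3 (\<Sum>k\<le>n. vars3 $ 3 ^ k * binary_form (n - k) (?c k)) v"
      by (simp add: eval3_binary_form)
  qed
qed

lemma homogeneous_poly_subst3:
  assumes p: "homogeneous_poly n p" and u: "\<And>i. homogeneous_poly 1 (u $ i)"
  shows "homogeneous_poly n (subst3 const3 u p)"
proof -
  obtain c where "p = (\<Sum>k\<le>n. vars3 $ 3 ^ k * binary_form (n - k) (c k))"
    using homogeneous_poly_expansion[OF p] .
  then have "subst3 const3 u p = (\<Sum>k\<le>n. \<Sum>i\<le>n - k.
      u $ 3 ^ k * (const3 (c k i) * u $ 1 ^ i * u $ 2 ^ (n - k - i)))"
    by (simp add: binary_form_def sum_distrib_left)
  moreover have "homogeneous_poly n (u $ 3 ^ k * (const3 (c k i) * u $ 1 ^ i * u $ 2 ^ (n - k - i)))"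
    if "k \<le> n" "i \<le> n - k" for k i
  proof -
    have "homogeneous_poly (k * 1 + (0 + i * 1 + (n - k - i) * 1))
        (u $ 3 ^ k * (const3 (c k i) * u $ 1 ^ i * u $ 2 ^ (n - k - i)))"
      by (intro homogeneous_poly_mult homogeneous_poly_power homogeneous_poly_const3 u)
    then show ?thesis using that by simp
  qed
  ultimately show ?thesis by (auto intro!: homogeneous_poly_sum)
qed

section \<open>Pullbacks of forms\<close>

definition linear_subst :: "complex ^ 3 ^ 3 \<Rightarrow> poly3 ^ 3" where
  "linear_subst M = (\<chi> k. \<Sum>l\<in>UNIV. const3 (M $ k $ l) * vars3 $ l)"

lemma eval3_linear_subst [simp]: "eval3 (subst3 const3 (linear_subst M) p) v = eval3 p (M *v v)"
  by (simp add: eval3_subst3 linear_subst_def matrix_vector_mult_def)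

lemma pullback_nth:
  "pullback M \<omega> $ j = (\<Sum>i\<in>UNIV. subst3 const3 (linear_subst M) (\<omega> $ i) * const3 (M $ i $ j))"
  by (simp add: pullback_def linear_subst_def)

lemma eval3_pullback [simp]:
  "eval3 (pullback M \<omega> $ j) v = (\<Sum>i\<in>UNIV. eval3 (\<omega> $ i) (M *v v) * M $ i $ j)"
  by (simp add: pullback_nth)

lemma form_at_eval3: "form_at \<omega> v w = (\<Sum>i\<in>UNIV. eval3 (\<omega> $ i) v * w $ i)"
  by (simp add: form_at_def eval3_def)

lemma form_at_pullback: "form_at (pullback M \<omega>) v w = form_at \<omega> (M *v v) (M *v w)"
  by (simp add: form_at_eval3 matrix_vector_mult_def[of M w] sum_3 algebra_simps)

lemma pullback_pullback: "pullback N (pullback M \<omega>) = pullback (M ** N) \<omega>"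
proof (rule form_eqI)
  fix i v
  have "(M ** N) $ j $ i = (\<Sum>k\<in>UNIV. M $ j $ k * N $ k $ i)" for j
    by (simp add: matrix_matrix_mult_def)
  then show "eval3 (pullback N (pullback M \<omega>) $ i) v = eval3 (pullback (M ** N) \<omega> $ i) v"
    by (simp add: matrix_vector_mul_assoc) (simp add: sum_3 algebra_simps)
qed

lemma pullback_mat_1 [simp]: "pullback (mat 1) \<omega> = \<omega>"
proof (rule form_eqI)
  fix i v
  have "(mat 1 :: complex ^ 3 ^ 3) $ j $ i = (if j = i then 1 else 0)" for j by (simp add: mat_def)
  then show "eval3 (pullback (mat 1) \<omega> $ i) v = eval3 (\<omega> $ i) v"
    using exhaust_3[of i] by (auto simp: sum_3)
qed

lemma pullback_scale: "pullback M (const3 c *s \<omega>) = const3 c *s pullback M \<omega>"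
  by (rule form_eqI) (simp add: sum_3 algebra_simps)

lemma form_euler_iff:
  "(\<Sum>i\<in>UNIV. vars3 $ i * \<omega> $ i) = 0 \<longleftrightarrow> (\<forall>v. form_at \<omega> v v = 0)"
  unfolding eval3_eq_0_iff[symmetric]
  by (simp add: form_at_eval3 sum_3 algebra_simps)

lemma homogeneous_poly_linear_subst: "homogeneous_poly 1 (linear_subst M $ i)"
  unfolding linear_subst_def
  using homogeneous_poly_vars3
  by (auto intro!: homogeneous_poly_sum homogeneous_poly_const3_mult)

lemma subst3_inverse:
  assumes "M ** N = mat 1"
  shows "subst3 const3 (linear_subst N) (subst3 const3 (linear_subst M) p) = p"
  by (rule eval3_eqI) (simp add: matrix_vector_mul_assoc assms)

lemma subst3_dvd: "p dvd q \<Longrightarrow> subst3 const3 u p dvd subst3 const3 u q"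
  by (auto simp: dvd_def)

text \<open>
  A common factor of the pulled back coefficients is carried by the inverse substitution to a
  common factor of the original ones.
\<close>

lemma foliation_form_pullback:
  assumes \<omega>: "foliation_form d \<omega>" and "invertible M"
  shows "foliation_form d (pullback M \<omega>)"
proof -
  obtain N where N: "M ** N = mat 1" "N ** M = mat 1"
    using assms(2) by (auto simp: invertible_def)
  have "homogeneous_poly (d + 1) (pullback M \<omega> $ i)" for i
    using \<omega> unfolding pullback_nth foliation_form_def
    by (auto intro!: homogeneous_poly_sum homogeneous_poly_const3_mult homogeneous_poly_subst3
        homogeneous_poly_linear_subst simp: mult.commute[of _ "const3 _"])
  moreover have "is_unit q" if q: "\<forall>i. q dvd pullback M \<omega> $ i" for q
  proof -
    have "subst3 const3 (linear_subst N) q dvd pullback N (pullback M \<omega>) $ i" for i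
      unfolding pullback_nth[of N] using q by (intro dvd_sum dvd_mult2 subst3_dvd) auto
    then have "is_unit (subst3 const3 (linear_subst N) q)"
      using \<omega> by (simp add: pullback_pullback N foliation_form_def)
    then have "is_unit (subst3 const3 (linear_subst M) (subst3 const3 (linear_subst N) q))"
      by (metis subst3_dvd subst3_const3_hom(2))
    then show ?thesis by (simp add: subst3_inverse N)
  qed
  moreover have "(\<Sum>i\<in>UNIV. vars3 $ i * pullback M \<omega> $ i) = 0"
    using \<omega> by (simp add: form_euler_iff form_at_pullback foliation_form_def)
  ultimately show ?thesis by (simp add: foliation_form_def)
qed

section \<open>Pullbacks of vector fields and of the inflection polynomial\<close>

text \<open>
  The factor \<open>det M\<close> compensates the change of the volume form \<open>dx \<and> dy \<and> dz\<close>, so that contraction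
  commutes with pullback (\<open>contract_radial_pullback\<close>).
\<close>

definition pullback_field :: "complex ^ 3 ^ 3 \<Rightarrow> vfield \<Rightarrow> vfield" where
  "pullback_field M Z = (\<chi> i. \<Sum>j\<in>UNIV.
     const3 (det M * matrix_inv M $ i $ j) * subst3 const3 (linear_subst M) (Z $ j))"

lemma matrix_mult_matrix_inv: "invertible M \<Longrightarrow> M ** matrix_inv M = mat 1"
  unfolding invertible_def matrix_inv_def by (rule someI2_ex) auto

lemma matrix_mult_pullback_field:
  assumes "invertible M"
  shows "(\<Sum>j\<in>UNIV. const3 (M $ i $ j) * pullback_field M Z $ j) =
    const3 (det M) * subst3 const3 (linear_subst M) (Z $ i)"
proof (rule eval3_eqI)
  fix v
  have "(\<Sum>j\<in>UNIV. M $ i $ j * matrix_inv M $ j $ k) = (if i = k then 1 else 0)" for k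
    using matrix_mult_matrix_inv[OF assms] by (simp add: vec_eq_iff matrix_matrix_mult_def mat_def)
  note this[of 1, unfolded sum_3] this[of 2, unfolded sum_3] this[of 3, unfolded sum_3]
  note inv = this
  define z where "z = (\<lambda>j. eval3 (Z $ j) (M *v v))"
  have "eval3 (\<Sum>j\<in>UNIV. const3 (M $ i $ j) * pullback_field M Z $ j) v =
     det M * (\<Sum>k\<in>UNIV. (\<Sum>j\<in>UNIV. M $ i $ j * matrix_inv M $ j $ k) * z k)"
    by (simp add: pullback_field_def z_def sum_3 algebra_simps)
  also have "\<dots> = det M * z i"
    unfolding sum_3 inv using exhaust_3[of i] by auto
  finally show "eval3 (\<Sum>j\<in>UNIV. const3 (M $ i $ j) * pullback_field M Z $ j) v =
    eval3 (const3 (det M) * subst3 const3 (linear_subst M) (Z $ i)) v"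
    by (simp add: z_def)
qed

lemma eval3_pullback_field:
  assumes "invertible M"
  shows "(\<Sum>j\<in>UNIV. M $ i $ j * eval3 (pullback_field M Z $ j) v) = det M * eval3 (Z $ i) (M *v v)"
  using arg_cong[OF matrix_mult_pullback_field[OF assms, of i Z], of "\<lambda>p. eval3 p v"] by simp

text \<open>
  The chain rule for \<open>v \<mapsto> M v\<close>; it suffices to check it on constants and variables because both
  sides are derivations.
\<close>

lemma deriv_along_pullback_field:
  assumes "invertible M"
  shows "eval3 (deriv_along (pullback_field M Z) (subst3 const3 (linear_subst M) p)) v =
    det M * eval3 (deriv_along Z p) (M *v v)"
proof (induction p rule: poly3_induct)
  case (var i)
  have "deriv_along (pullback_field M Z) (linear_subst M $ i) =
      (\<Sum>j\<in>UNIV. const3 (M $ i $ j) * pullback_field M Z $ j)"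
    by (simp add: linear_subst_def deriv_along_sum deriv_along_mult deriv_along_var)
  then show ?case
    using eval3_pullback_field[OF assms]
    by (simp add: deriv_along_var)
qed (simp_all add: deriv_along_add deriv_along_mult algebra_simps)

lemma eval3_inflection_poly:
  "eval3 (inflection_poly Z) v = det (\<chi> i. vector [v $ i, eval3 (Z $ i) v,
     eval3 (deriv_along Z (Z $ i)) v] :: complex ^ 3 ^ 3)"
  by (simp add: inflection_poly_def det_3)

lemma det_mult_columns:
  fixes M :: "complex ^ 3 ^ 3"
  assumes "\<And>i. (\<Sum>j\<in>UNIV. M $ i $ j * a j) = a' i" "\<And>i. (\<Sum>j\<in>UNIV. M $ i $ j * b j) = b' i"
    "\<And>i. (\<Sum>j\<in>UNIV. M $ i $ j * c j) = c' i"
  shows "det M * det (\<chi> i. vector [a i, b i, c i] :: complex ^ 3 ^ 3) =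
    det (\<chi> i. vector [a' i, b' i, c' i] :: complex ^ 3 ^ 3)"
proof -
  let ?A = "\<chi> i. vector [a i, b i, c i] :: complex ^ 3 ^ 3"
  let ?B = "\<chi> i. vector [a' i, b' i, c' i] :: complex ^ 3 ^ 3"
  have "(M ** ?A) $ i $ j = ?B $ i $ j" for i j
    using exhaust_3[of j]
    by (elim disjE) (simp_all add: matrix_matrix_mult_def assms)
  then have "M ** ?A = ?B" unfolding vec_eq_iff by blast
  then show ?thesis using det_mul[of M ?A] by simp
qed

text \<open>
  Applying \<open>M\<close> to the three columns \<open>v\<close>, \<open>Z'\<close>, \<open>Z'(Z')\<close> of the determinant gives
  \<open>M v\<close>, \<open>det M\<close> times \<open>Z\<close> and \<open>(det M)\<^sup>2\<close> times \<open>Z(Z)\<close>, so the determinant gains \<open>(det M)\<^sup>3\<close> on one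
  side and \<open>det M\<close> on the other.
\<close>

lemma eval3_inflection_poly_pullback:
  assumes "invertible M"
  shows "eval3 (inflection_poly (pullback_field M Z)) v =
    det M ^ 2 * eval3 (inflection_poly Z) (M *v v)"
proof -
  let ?Z = "pullback_field M Z"
  define \<delta> where "\<delta> = det M"
  have \<delta>: "\<delta> \<noteq> 0" using assms by (simp add: \<delta>_def invertible_det_nz)
  have deriv: "(\<Sum>j\<in>UNIV. M $ i $ j * eval3 (deriv_along ?Z (?Z $ j)) v) =
      \<delta> ^ 2 * eval3 (deriv_along Z (Z $ i)) (M *v v)" for i
  proof -
    have "(\<Sum>j\<in>UNIV. M $ i $ j * eval3 (deriv_along ?Z (?Z $ j)) v) =
        eval3 (deriv_along ?Z (\<Sum>j\<in>UNIV. const3 (M $ i $ j) * ?Z $ j)) v"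
      by (simp add: deriv_along_sum deriv_along_mult)
    also have "\<dots> = \<delta> ^ 2 * eval3 (deriv_along Z (Z $ i)) (M *v v)"
      unfolding matrix_mult_pullback_field[OF assms]
      by (simp add: deriv_along_mult deriv_along_pullback_field[OF assms] power2_eq_square \<delta>_def)
    finally show ?thesis .
  qed
  define T :: "complex ^ 3 ^ 3" where
    "T = (\<chi> i. vector [v $ i, eval3 (?Z $ i) v, eval3 (deriv_along ?Z (?Z $ i)) v])"
  have "\<delta> * det T = det (\<chi> i. vector [(M *v v) $ i, \<delta> * eval3 (Z $ i) (M *v v),
      \<delta> ^ 2 * eval3 (deriv_along Z (Z $ i)) (M *v v)] :: complex ^ 3 ^ 3)"
    unfolding T_def \<delta>_def
    by (rule det_mult_columns)
      (use eval3_pullback_field[OF assms] deriv in \<open>simp_all add: matrix_vector_mult_def \<delta>_def\<close>)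
  also have "\<dots> = \<delta> ^ 3 * eval3 (inflection_poly Z) (M *v v)"
    unfolding eval3_inflection_poly det_3 by (simp add: algebra_simps eval_nat_numeral)
  finally have "\<delta> * det T = \<delta> * (\<delta> ^ 2 * eval3 (inflection_poly Z) (M *v v))"
    by (simp add: algebra_simps eval_nat_numeral)
  then show ?thesis using \<delta> by (simp add: eval3_inflection_poly[of ?Z] T_def \<delta>_def)
qed

text \<open>The first component of \<open>(M z \<times> M v) M = det M (z \<times> v)\<close>, for the rows \<open>a, b, c\<close> of \<open>M\<close>.\<close>

lemma cross_product_matrix_mult_1:
  fixes a1 :: "'a::comm_ring_1"
  shows "((b1 * z1 + b2 * z2 + b3 * z3) * (c1 * v1 + c2 * v2 + c3 * v3)
        - (c1 * z1 + c2 * z2 + c3 * z3) * (b1 * v1 + b2 * v2 + b3 * v3)) * a1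
      + ((c1 * z1 + c2 * z2 + c3 * z3) * (a1 * v1 + a2 * v2 + a3 * v3)
        - (a1 * z1 + a2 * z2 + a3 * z3) * (c1 * v1 + c2 * v2 + c3 * v3)) * b1
      + ((a1 * z1 + a2 * z2 + a3 * z3) * (b1 * v1 + b2 * v2 + b3 * v3)
        - (b1 * z1 + b2 * z2 + b3 * z3) * (a1 * v1 + a2 * v2 + a3 * v3)) * c1 =
    (a1 * b2 * c3 + a2 * b3 * c1 + a3 * b1 * c2 - a1 * b3 * c2 - a2 * b1 * c3 - a3 * b2 * c1) *
      (z2 * v3 - z3 * v2)"
  by (simp add: algebra_simps)

lemma cross_product_matrix_mult:
  fixes M :: "'a::comm_ring_1 ^ 3 ^ 3" and z v :: "'a ^ 3"
  assumes f: "\<And>i x. f i x = M $ i $ 1 * x $ 1 + M $ i $ 2 * x $ 2 + M $ i $ 3 * x $ 3"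
  shows "(f 2 z * f 3 v - f 3 z * f 2 v) * M $ 1 $ k + (f 3 z * f 1 v - f 1 z * f 3 v) * M $ 2 $ k
      + (f 1 z * f 2 v - f 2 z * f 1 v) * M $ 3 $ k =
    det M * vector [z $ 2 * v $ 3 - z $ 3 * v $ 2, z $ 3 * v $ 1 - z $ 1 * v $ 3,
      z $ 1 * v $ 2 - z $ 2 * v $ 1] $ k"
proof -
  have f': "f i x = M $ i $ 2 * x $ 2 + M $ i $ 3 * x $ 3 + M $ i $ 1 * x $ 1"
    "f i x = M $ i $ 3 * x $ 3 + M $ i $ 1 * x $ 1 + M $ i $ 2 * x $ 2" for i x
    unfolding f by (simp_all only: ac_simps)
  consider "k = 1" | "k = 2" | "k = 3" using exhaust_3[of k] by blast
  then show ?thesis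
  proof cases
    case 1
    show ?thesis
      unfolding 1 f vector_3 det_3 cross_product_matrix_mult_1 by (simp only: ac_simps)
  next
    case 2
    show ?thesis
      unfolding 2 f'(1) vector_3 det_3 cross_product_matrix_mult_1 by (simp add: algebra_simps)
  next
    case 3
    show ?thesis
      unfolding 3 f'(2) vector_3 det_3 cross_product_matrix_mult_1 by (simp add: algebra_simps)
  qed
qed

text \<open>
  Both forms are \<open>w \<mapsto> det (M Z', M v, M w) / det M = det (Z', v, w)\<close>.
\<close>

lemma contract_radial_pullback:
  assumes "invertible M"
  shows "contract_radial (pullback_field M Z) = pullback M (contract_radial Z)"
proof (rule form_eqI)
  fix k v
  define \<delta> where "\<delta> = det M"
  have \<delta>: "\<delta> \<noteq> 0" using assms by (simp add: \<delta>_def invertible_det_nz)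
  define z where "z = (\<chi> i. eval3 (pullback_field M Z $ i) v)"
  define w where "w = (\<lambda>i. eval3 (Z $ i) (M *v v))"
  define f where "f = (\<lambda>i (x :: complex ^ 3). M $ i $ 1 * x $ 1 + M $ i $ 2 * x $ 2 + M $ i $ 3 * x $ 3)"
  have zw: "\<delta> * w i = f i z" for i
    using eval3_pullback_field[OF assms, of i Z v] by (simp add: z_def w_def \<delta>_def f_def sum_3)
  have Mv: "(M *v v) $ i = f i v" for i
    by (simp add: matrix_vector_mult_def f_def sum_3)
  let ?l = "eval3 (contract_radial (pullback_field M Z) $ k) v"
  let ?r = "eval3 (pullback M (contract_radial Z) $ k) v"
  have "\<delta> * ?r = (\<delta> * w 2 * f 3 v - \<delta> * w 3 * f 2 v) * M $ 1 $ k +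
      (\<delta> * w 3 * f 1 v - \<delta> * w 1 * f 3 v) * M $ 2 $ k +
      (\<delta> * w 1 * f 2 v - \<delta> * w 2 * f 1 v) * M $ 3 $ k"
    by (simp add: contract_radial_def sum_3 w_def Mv) (simp add: algebra_simps)
  also have "\<dots> = \<delta> * vector [z $ 2 * v $ 3 - z $ 3 * v $ 2, z $ 3 * v $ 1 - z $ 1 * v $ 3,
      z $ 1 * v $ 2 - z $ 2 * v $ 1] $ k"
    unfolding zw by (subst cross_product_matrix_mult) (simp_all add: f_def \<delta>_def)
  also have "\<dots> = \<delta> * ?l"
    using exhaust_3[of k] by (auto simp: contract_radial_def z_def)
  finally show "?l = ?r" using \<delta> by simp
qed

lemma sum_vector_matrix_mult:
  "(\<Sum>i\<in>UNIV. (l v* M) $ i * v $ i) = (\<Sum>i\<in>UNIV. l $ i * (M *v v) $ i)"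
  for M :: "complex ^ 3 ^ 3"
  by (simp add: matrix_vector_mult_def vector_matrix_mult_def sum_3 algebra_simps)

lemma invariant_line_pullback:
  assumes "invariant_line \<omega> l" "invertible M"
  shows "invariant_line (pullback M \<omega>) (l v* M)"
proof -
  have "l v* M \<noteq> 0"
  proof
    assume "l v* M = 0"
    then have "transpose M *v l = 0" by simp
    moreover have "invertible (transpose M)"
      using assms(2) by (simp add: invertible_det_nz det_transpose)
    then obtain N where "N ** transpose M = mat 1" by (auto simp: invertible_def)
    ultimately have "mat 1 *v l = 0" by (metis matrix_vector_mul_assoc matrix_vector_mult_0_right)
    then have "l = 0" by simp
    then show False using assms(1) by (simp add: invariant_line_def)
  qed
  then show ?thesis
    using assms(1) unfolding invariant_line_def sum_vector_matrix_mult form_at_pullback by blast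
qed

section \<open>Normal form of homogeneous foliations\<close>

text \<open>
  A binary quartic is encoded by the univariate polynomial that it becomes for \<open>y = 1\<close>.
\<close>

definition quartic :: "complex poly \<Rightarrow> complex \<Rightarrow> complex \<Rightarrow> complex" where
  "quartic a x y = (\<Sum>i\<le>4. coeff a i * x ^ i * y ^ (4 - i))"

text \<open>
  The form \<open>z (A dx + B dy) - (x A + y B) dz\<close>, the homogenization of \<open>A dx + B dy\<close>.
\<close>

definition homogeneous_form :: "complex poly \<Rightarrow> complex poly \<Rightarrow> form" where
  "homogeneous_form a b = (let A = binary_form 4 (coeff a); B = binary_form 4 (coeff b) in
     vector [vars3 $ 3 * A, vars3 $ 3 * B, - (vars3 $ 1 * A + vars3 $ 2 * B)])"

lemma eval3_binary_form_4 [simp]: "eval3 (binary_form 4 (coeff a)) v = quartic a (v $ 1) (v $ 2)"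
  by (simp add: eval3_binary_form quartic_def)

lemma eval3_homogeneous_form [simp]:
  "eval3 (homogeneous_form a b $ 1) v = v $ 3 * quartic a (v $ 1) (v $ 2)"
  "eval3 (homogeneous_form a b $ 2) v = v $ 3 * quartic b (v $ 1) (v $ 2)"
  "eval3 (homogeneous_form a b $ 3) v =
    - (v $ 1 * quartic a (v $ 1) (v $ 2) + v $ 2 * quartic b (v $ 1) (v $ 2))"
  by (simp_all add: homogeneous_form_def Let_def)

lemma form_at_homogeneous_form:
  "form_at (homogeneous_form a b) v w =
    quartic a (v $ 1) (v $ 2) * (v $ 3 * w $ 1 - v $ 1 * w $ 3) +
    quartic b (v $ 1) (v $ 2) * (v $ 3 * w $ 2 - v $ 2 * w $ 3)"
  by (simp add: form_at_eval3 sum_3 algebra_simps)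

lemma quartic_expand:
  "quartic a x y = coeff a 0 * y ^ 4 + coeff a 1 * x * y ^ 3 + coeff a 2 * x ^ 2 * y ^ 2
     + coeff a 3 * x ^ 3 * y + coeff a 4 * x ^ 4"
  by (simp add: quartic_def eval_nat_numeral)

lemma quartic_scale: "quartic a (s * x) (s * y) = s ^ 4 * quartic a x y"
  by (simp add: quartic_expand power_mult_distrib algebra_simps eval_nat_numeral)

lemma quartic_add_smult: "quartic (smult c a + smult d b) x y = c * quartic a x y + d * quartic b x y"
  by (simp add: quartic_expand algebra_simps)

lemma quartic_1: "degree a \<le> 4 \<Longrightarrow> quartic a t 1 = poly a t"
  using poly_map_poly_sum[of id 4 a t] by (simp add: quartic_def coeff_eq_0)

text \<open>
  A coefficient of \<open>z\<close> that vanishes as a function vanishes as a polynomial.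
\<close>

lemma vars3_3_dvd_iff: "vars3 $ 3 dvd p \<longleftrightarrow> (\<forall>v. v $ 3 = 0 \<longrightarrow> eval3 p v = 0)"
proof
  assume z: "\<forall>v. v $ 3 = 0 \<longrightarrow> eval3 p v = 0"
  obtain q p' where p: "p = pCons q p'" by (cases p)
  then have p: "p = [:q:] + vars3 $ 3 * p'" by (simp add: vars3_nth)
  have q: "eval3 [:q:] v = eval3 [:q:] (vector [v $ 1, v $ 2, 0])" for v
    by (simp add: eval3_def subst3_def map_poly_pCons)
  have "eval3 [:q:] v = 0" for v
    using z[rule_format, of "vector [v $ 1, v $ 2, 0]"] q by (simp add: p)
  then have "[:q:] = 0" using eval3_eq_0_iff by blast
  then show "vars3 $ 3 dvd p" by (simp add: p)
qed auto

lemma not_is_unit_vars3: "\<not> is_unit (vars3 $ i)"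
proof
  assume "is_unit (vars3 $ i)"
  then obtain q where "1 = vars3 $ i * q" by (auto simp: dvd_def)
  from arg_cong[OF this, of "\<lambda>p. eval3 p 0"] show False by simp
qed

lemma homothety_mult [simp]: "homothety t *v v = vector [t * v $ 1, t * v $ 2, v $ 3]"
  by (simp add: homothety_def matrix_vector_mult_def vec_eq_iff forall_3 sum_3)

lemma homothety_nth [simp]: "homothety t $ 1 = vector [t, 0, 0]" "homothety t $ 2 = vector [0, t, 0]"
  "homothety t $ 3 = vector [0, 0, 1]"
  by (simp_all add: homothety_def)

text \<open>
  If \<open>a x + b y = 0\<close> then \<open>a = y g\<close> and \<open>b = - x g\<close>, so \<open>g\<close> is a common factor of the
  coefficients, hence constant, which contradicts the degree of \<open>a\<close>.
\<close>

lemma foliation_form_third_nonzero: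
  assumes \<omega>: "foliation_form d \<omega>" and "d > 0"
  shows "\<omega> $ 3 \<noteq> 0"
proof
  assume "\<omega> $ 3 = 0"
  then have euler: "vars3 $ 1 * \<omega> $ 1 = - (vars3 $ 2 * \<omega> $ 2)"
    using \<omega> by (simp add: foliation_form_def sum_3 eq_neg_iff_add_eq_0)
  have "[:0, 1:] dvd coeff (\<omega> $ 1) k" for k
  proof -
    have "[:[:0, 1:]:] * coeff (\<omega> $ 1) k = - ([:0, 1:] * coeff (\<omega> $ 2) k)"
      using arg_cong[OF euler, of "\<lambda>p. coeff p k"] by (simp add: vars3_nth)
    from arg_cong[OF this, of "\<lambda>p. coeff p 0"] have "coeff (coeff (\<omega> $ 1) k) 0 = 0" by simp
    then show ?thesis by (cases "coeff (\<omega> $ 1) k") (auto simp: dvd_def)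
  qed
  then have "vars3 $ 2 dvd \<omega> $ 1" by (simp add: vars3_nth const_poly_dvd_iff)
  then obtain g where g: "\<omega> $ 1 = vars3 $ 2 * g" by (auto simp: dvd_def)
  then have "vars3 $ 2 * (\<omega> $ 2 + vars3 $ 1 * g) = 0" using euler by (simp add: algebra_simps)
  then have "\<omega> $ 2 + vars3 $ 1 * g = 0" by (simp add: vars3_nth)
  then have "\<omega> $ 2 = - (vars3 $ 1 * g)" by (simp add: eq_neg_iff_add_eq_0)
  then have "\<forall>i. g dvd \<omega> $ i" using g \<open>\<omega> $ 3 = 0\<close> by (simp add: forall_3)
  then have "is_unit g" using \<omega> by (simp add: foliation_form_def)
  then obtain c where c: "g = [:[:[:c:]:]:]" "c dvd 1" by (auto simp: is_unit_poly_iff)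
  from c(2) have "c \<noteq> 0" by (metis dvd_0_left_iff zero_neq_one)
  then have "coeff (coeff (coeff (\<omega> $ 1) 0) 1) 0 \<noteq> 0" by (simp add: g c(1) vars3_nth)
  moreover have "homogeneous_poly (d + 1) (\<omega> $ 1)" using \<omega> by (simp add: foliation_form_def)
  ultimately have "0 + 1 + 0 = d + 1" unfolding homogeneous_poly_def by blast
  then show False using \<open>d > 0\<close> by simp
qed

lemma eval3_binary_form_scale:
  "(\<Sum>i\<le>m. c i * (t * x) ^ i * (t * y) ^ (m - i)) = t ^ m * (\<Sum>i\<le>m. c i * x ^ i * y ^ (m - i))"
  for t :: complex
proof -
  have "c i * (t * x) ^ i * (t * y) ^ (m - i) = t ^ m * (c i * x ^ i * y ^ (m - i))" if "i \<le> m" for i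
  proof -
    have "t ^ m = t ^ i * t ^ (m - i)" using that by (simp flip: power_add)
    then show ?thesis by (simp add: power_mult_distrib)
  qed
  then show ?thesis unfolding sum_distrib_left by (intro sum.cong) auto
qed

text \<open>
  The homothety with factor 2 multiplies the summand of \<open>z\<^sup>k\<close> in the coefficients of \<open>dx\<close> and \<open>dy\<close> by
  \<open>2\<^bsup>6 - k\<^esup>\<close> and in the coefficient of \<open>dz\<close> by \<open>2\<^bsup>5 - k\<^esup>\<close>. Invariance leaves a single weight. It must
  occur among the summands without \<open>z\<close>, since \<open>z\<close> is not a common factor, and it cannot kill the
  coefficient of \<open>dz\<close>; so the weight is 32.
\<close>

lemma foliation_form_homothety_invariant:
  assumes \<omega>: "foliation_form 4 \<omega>" and inv: "pullback (homothety 2) \<omega> = const3 \<mu> *s \<omega>"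
  obtains a b where "degree a \<le> 4" "degree b \<le> 4" "\<omega> = homogeneous_form a b"
proof -
  have "\<exists>c. \<omega> $ i = (\<Sum>k\<le>5. vars3 $ 3 ^ k * binary_form (5 - k) (c k))" for i
  proof -
    have "homogeneous_poly 5 (\<omega> $ i)" using \<omega> by (simp add: foliation_form_def)
    from homogeneous_poly_expansion[OF this] show ?thesis by metis
  qed
  then obtain c where c: "\<And>i. \<omega> $ i = (\<Sum>k\<le>5. vars3 $ 3 ^ k * binary_form (5 - k) (c i k))"
    by metis
  define f where "f = (\<lambda>i k x y. \<Sum>j\<le>5 - k. c i k j * x ^ j * y ^ (5 - k - j))"
  have ev: "eval3 (\<omega> $ i) v = (\<Sum>k\<le>5. f i k (v $ 1) (v $ 2) * v $ 3 ^ k)" for i v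
    by (simp add: c f_def eval3_binary_form algebra_simps)
  define e where "e = (\<lambda>i :: 3. if i = 3 then 0 else 1 :: nat)"
  have weight: "(2 ^ (5 - k) * 2 ^ e i - \<mu>) * f i k x y = 0" if "k \<le> 5" for i k x y
  proof -
    have "\<forall>z. (\<Sum>k\<le>5. (2 ^ (5 - k) * 2 ^ e i * f i k x y) * z ^ k) = (\<Sum>k\<le>5. (\<mu> * f i k x y) * z ^ k)"
    proof
      fix z
      have "eval3 (\<omega> $ i) (vector [2 * x, 2 * y, z]) * 2 ^ e i = \<mu> * eval3 (\<omega> $ i) (vector [x, y, z])"
        using arg_cong[OF inv, of "\<lambda>\<eta>. eval3 (\<eta> $ i) (vector [x, y, z])"] exhaust_3[of i]
        by (auto simp: e_def sum_3)
      moreover have "f i k (2 * x) (2 * y) = 2 ^ (5 - k) * f i k x y" for k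
        unfolding f_def by (rule eval3_binary_form_scale)
      ultimately show "(\<Sum>k\<le>5. (2 ^ (5 - k) * 2 ^ e i * f i k x y) * z ^ k) = (\<Sum>k\<le>5. (\<mu> * f i k x y) * z ^ k)"
        by (simp add: ev sum_distrib_left sum_distrib_right algebra_simps)
    qed
    then have "\<forall>k\<le>5. 2 ^ (5 - k) * 2 ^ e i * f i k x y = \<mu> * f i k x y"
      by (simp only: polyfun_eq_coeffs)
    then show ?thesis using that by (simp add: algebra_simps)
  qed
  have at0: "eval3 (\<omega> $ i) v = f i 0 (v $ 1) (v $ 2)" if "v $ 3 = 0" for i v
    by (simp add: ev that eval_nat_numeral)
  \<comment> \<open>The summands without \<open>z\<close> do not all vanish, since \<open>z\<close> is not a common factor.\<close>
  have "\<exists>i x y. f i 0 x y \<noteq> 0"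
  proof (rule ccontr)
    assume "\<not> ?thesis"
    then have "\<forall>i. vars3 $ 3 dvd \<omega> $ i" using at0 by (simp add: vars3_3_dvd_iff)
    then show False using \<omega> not_is_unit_vars3 by (auto simp: foliation_form_def)
  qed
  then obtain i x y where nz: "f i 0 x y \<noteq> 0" by blast
  then have \<mu>: "\<mu> = 2 ^ 5 * 2 ^ e i" using weight[of 0 i x y] by simp
  have i: "i = 3"
  proof (rule ccontr)
    assume "i \<noteq> 3"
    then have "\<mu> = 64" by (simp add: \<mu> e_def)
    have "f 3 k x y = 0" if "k \<le> 5" for k x y
    proof -
      have "k \<in> {0,1,2,3,4,5}" using that by auto
      then show ?thesis using weight[of k 3 x y] by (auto simp: \<open>\<mu> = 64\<close> e_def)
    qed
    then have "\<omega> $ 3 = 0" by (simp add: ev flip: eval3_eq_0_iff)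
    then show False using foliation_form_third_nonzero[OF \<omega>] by simp
  qed
  have \<mu>: "\<mu> = 32" by (simp add: \<mu> i e_def)
  have f12: "f i k x y = 0" if "i \<noteq> 3" "k \<noteq> 1" "k \<le> 5" for i k x y
  proof -
    have "k \<in> {0,2,3,4,5}" using that by auto
    then show ?thesis using weight[of k i x y] that(1) by (auto simp: \<mu> e_def)
  qed
  have f3: "f 3 k x y = 0" if "k \<noteq> 0" "k \<le> 5" for k x y
  proof -
    have "k \<in> {1,2,3,4,5}" using that by auto
    then show ?thesis using weight[of k 3 x y] that(1) by (auto simp: \<mu> e_def)
  qed
  define p where "p = (\<lambda>i. \<Sum>j\<le>4. monom (c i 1 j) j)"
  have p: "degree (p i) \<le> 4" for i
    unfolding p_def by (intro degree_sum_le) (auto intro: order_trans[OF degree_monom_le])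
  have q: "quartic (p i) x y = f i 1 x y" for i x y
    by (auto simp: quartic_def f_def p_def coeff_sum coeff_monom intro!: sum.cong)
  have 12: "eval3 (\<omega> $ i) v = v $ 3 * quartic (p i) (v $ 1) (v $ 2)" if "i \<noteq> 3" for i v
  proof -
    have "eval3 (\<omega> $ i) v = (\<Sum>k\<in>{1}. f i k (v $ 1) (v $ 2) * v $ 3 ^ k)"
      unfolding ev using f12[OF that] by (intro sum.mono_neutral_right) auto
    then show ?thesis by (simp add: q)
  qed
  have 3: "eval3 (\<omega> $ 3) v = f 3 0 (v $ 1) (v $ 2)" for v
  proof -
    have "eval3 (\<omega> $ 3) v = (\<Sum>k\<in>{0}. f 3 k (v $ 1) (v $ 2) * v $ 3 ^ k)"
      unfolding ev using f3 by (intro sum.mono_neutral_right) auto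
    then show ?thesis by simp
  qed
  have f30: "f 3 0 x y = - (x * quartic (p 1) x y + y * quartic (p 2) x y)" for x y
  proof -
    have "form_at \<omega> (vector [x, y, 1]) (vector [x, y, 1]) = 0"
      using \<omega> by (simp add: foliation_form_def form_euler_iff)
    then show ?thesis
      by (simp add: form_at_eval3 sum_3 12 3 eq_neg_iff_add_eq_0 algebra_simps)
  qed
  have "\<omega> = homogeneous_form (p 1) (p 2)"
  proof (rule form_eqI)
    show "eval3 (\<omega> $ i) v = eval3 (homogeneous_form (p 1) (p 2) $ i) v" for i v
      using exhaust_3[of i] by (auto simp: 12 3 f30)
  qed
  then show ?thesis using that p by blast
qed

text \<open>
  A linear change of the affine coordinates \<open>x, y\<close>.
\<close>

definition plane_matrix :: "complex \<Rightarrow> complex \<Rightarrow> complex \<Rightarrow> complex \<Rightarrow> complex ^ 3 ^ 3" where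
  "plane_matrix p q r s = vector [vector [p, q, 0], vector [r, s, 0], vector [0, 0, 1]]"

lemma plane_matrix_mult [simp]:
  "plane_matrix p q r s *v v = vector [p * v $ 1 + q * v $ 2, r * v $ 1 + s * v $ 2, v $ 3]"
  by (simp add: plane_matrix_def matrix_vector_mult_def vec_eq_iff forall_3 sum_3)

lemma plane_matrix_nth [simp]: "plane_matrix p q r s $ 1 = vector [p, q, 0]"
  "plane_matrix p q r s $ 2 = vector [r, s, 0]" "plane_matrix p q r s $ 3 = vector [0, 0, 1]"
  by (simp_all add: plane_matrix_def)

lemma invertible_plane_matrix: "p * s - q * r \<noteq> 0 \<Longrightarrow> invertible (plane_matrix p q r s)"
  by (simp add: invertible_det_nz det_3)

lemma homothety_plane_matrix_commute:
  "homothety t ** plane_matrix p q r s = plane_matrix p q r s ** homothety t"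
  by (simp add: vec_eq_iff forall_3 matrix_matrix_mult_def sum_3)

lemma pullback_homothety_homogeneous_form:
  "pullback (homothety t) (homogeneous_form a b) = const3 (t ^ 5) *s homogeneous_form a b"
proof (rule form_eqI)
  show "eval3 (pullback (homothety t) (homogeneous_form a b) $ i) v =
    eval3 ((const3 (t ^ 5) *s homogeneous_form a b) $ i) v" for i v
    using exhaust_3[of i]
    by (auto simp: sum_3 quartic_scale algebra_simps eval_nat_numeral)
qed

lemma pullback_plane_matrix:
  assumes "\<And>x y. p * quartic a (p * x + q * y) (r * x + s * y) + r * quartic b (p * x + q * y) (r * x + s * y)
      = l * quartic a' x y"
    "\<And>x y. q * quartic a (p * x + q * y) (r * x + s * y) + s * quartic b (p * x + q * y) (r * x + s * y)
      = l * quartic b' x y"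
  shows "pullback (plane_matrix p q r s) (homogeneous_form a b) = const3 l *s homogeneous_form a' b'"
proof (rule form_eqI)
  fix i :: 3 and v :: "complex ^ 3"
  let ?x = "p * v $ 1 + q * v $ 2" and ?y = "r * v $ 1 + s * v $ 2"
  define A B where "A = quartic a ?x ?y" and "B = quartic b ?x ?y"
  define A' B' where "A' = quartic a' (v $ 1) (v $ 2)" and "B' = quartic b' (v $ 1) (v $ 2)"
  have A': "p * A + r * B = l * A'" and B': "q * A + s * B = l * B'"
    using assms[of "v $ 1" "v $ 2"] by (simp_all add: A_def B_def A'_def B'_def)
  have "v $ 3 * A * p + v $ 3 * B * r = l * (v $ 3 * A')"
    "v $ 3 * A * q + v $ 3 * B * s = l * (v $ 3 * B')"
    "- (?x * A) - ?y * B = l * (- (v $ 1 * A') - v $ 2 * B')"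
    using A' B' by algebra+
  then show "eval3 (pullback (plane_matrix p q r s) (homogeneous_form a b) $ i) v =
      eval3 ((const3 l *s homogeneous_form a' b') $ i) v"
    using exhaust_3[of i] by (auto simp: sum_3 A_def B_def A'_def B'_def)
qed

section \<open>The inflection polynomial of a homogeneous foliation\<close>

text \<open>
  The partial derivatives of \<open>quartic a\<close>, as explicit cubic forms.
\<close>

definition quartic_dx :: "complex poly \<Rightarrow> complex \<Rightarrow> complex \<Rightarrow> complex" where
  "quartic_dx a x y = coeff a 1 * y ^ 3 + 2 * coeff a 2 * x * y ^ 2 + 3 * coeff a 3 * x ^ 2 * y
     + 4 * coeff a 4 * x ^ 3"

definition quartic_dy :: "complex poly \<Rightarrow> complex \<Rightarrow> complex \<Rightarrow> complex" where
  "quartic_dy a x y = 4 * coeff a 0 * y ^ 3 + 3 * coeff a 1 * x * y ^ 2 + 2 * coeff a 2 * x ^ 2 * y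
     + coeff a 3 * x ^ 3"

lemma quartic_euler: "x * quartic_dx a x y + y * quartic_dy a x y = 4 * quartic a x y"
  by (simp add: quartic_dx_def quartic_dy_def quartic_expand algebra_simps eval_nat_numeral)

lemma eval3_deriv_along_binary_form:
  "eval3 (deriv_along Z (binary_form 4 (coeff a))) v =
     eval3 (Z $ 1) v * quartic_dx a (v $ 1) (v $ 2) + eval3 (Z $ 2) v * quartic_dy a (v $ 1) (v $ 2)"
proof -
  have "binary_form 4 (coeff a) = const3 (coeff a 0) * vars3 $ 2 ^ 4
      + const3 (coeff a 1) * vars3 $ 1 * vars3 $ 2 ^ 3 + const3 (coeff a 2) * vars3 $ 1 ^ 2 * vars3 $ 2 ^ 2
      + const3 (coeff a 3) * vars3 $ 1 ^ 3 * vars3 $ 2 + const3 (coeff a 4) * vars3 $ 1 ^ 4"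
    by (simp add: binary_form_def eval_nat_numeral)
  moreover have "eval3 (of_nat n) v = of_nat n" for n by (induction n) simp_all
  then have "eval3 (numeral k) v = numeral k" for k by (metis of_nat_numeral)
  ultimately show ?thesis
    by (simp add: deriv_along_add deriv_along_mult deriv_along_power quartic_dx_def quartic_dy_def
        algebra_simps)
qed

text \<open>
  The field \<open>- B \<partial>\<^sub>x + A \<partial>\<^sub>y\<close>, which induces the rational map \<open>[- B : A]\<close> on the line at infinity.
\<close>

definition homogeneous_field :: "complex poly \<Rightarrow> complex poly \<Rightarrow> vfield" where
  "homogeneous_field a b = vector [- binary_form 4 (coeff b), binary_form 4 (coeff a), 0]"

lemma homogeneous_field_nth [simp]:
  "homogeneous_field a b $ 1 = - binary_form 4 (coeff b)"
  "homogeneous_field a b $ 2 = binary_form 4 (coeff a)" "homogeneous_field a b $ 3 = 0"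
  by (simp_all add: homogeneous_field_def)

lemma contract_radial_homogeneous_field:
  "contract_radial (homogeneous_field a b) = homogeneous_form a b"
  by (simp add: contract_radial_def homogeneous_form_def Let_def vec_eq_iff forall_3 algebra_simps)

definition jacobian :: "complex poly \<Rightarrow> complex poly \<Rightarrow> complex \<Rightarrow> complex \<Rightarrow> complex" where
  "jacobian a b x y = quartic_dx a x y * quartic_dy b x y - quartic_dy a x y * quartic_dx b x y"

text \<open>
  Expanding along the row \<open>(z, 0, 0)\<close> leaves \<open>A Z(B) - B Z(A)\<close>. By Euler's relations for \<open>A\<close> and
  \<open>B\<close> this is a quarter of the product of \<open>x A + y B\<close> and the Jacobian.
\<close>

lemma inflection_homogeneous_field:
  "4 * eval3 (inflection_poly (homogeneous_field a b)) v = v $ 3 *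
    (v $ 1 * quartic a (v $ 1) (v $ 2) + v $ 2 * quartic b (v $ 1) (v $ 2)) *
    jacobian a b (v $ 1) (v $ 2)"
proof -
  let ?x = "v $ 1" and ?y = "v $ 2"
  define A Ax Ay B Bx By where defs: "A = quartic a ?x ?y" "Ax = quartic_dx a ?x ?y"
    "Ay = quartic_dy a ?x ?y" "B = quartic b ?x ?y" "Bx = quartic_dx b ?x ?y" "By = quartic_dy b ?x ?y"
  have "eval3 (inflection_poly (homogeneous_field a b)) v =
      v $ 3 * (B * (B * Ax - A * Bx) + A * (A * By - B * Ay))"
    unfolding eval3_inflection_poly det_3
    by (simp add: eval3_deriv_along_binary_form deriv_along_minus)
      (simp add: algebra_simps flip: defs)
  moreover have "?x * Ax + ?y * Ay = 4 * A" "?x * Bx + ?y * By = 4 * B"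
    unfolding defs by (rule quartic_euler)+
  then have "4 * (B * (B * Ax - A * Bx) + A * (A * By - B * Ay)) =
      (?x * A + ?y * B) * (Ax * By - Ay * Bx)" by algebra
  ultimately show ?thesis by (simp add: jacobian_def defs)
qed

text \<open>
  The difference \<open>D\<close> of the fields is collinear to the radial field: \<open>z D\<^sub>2 = y D\<^sub>3\<close> forces \<open>z\<close> to divide
  \<open>D\<^sub>3\<close>, and the quotient is the factor.
\<close>

lemma contract_radial_eqD:
  assumes "contract_radial Z' = contract_radial Z"
  obtains p where "Z' = Z + p *s vars3"
proof -
  define D where "D = Z' - Z"
  have "contract_radial Z' $ i = contract_radial Z $ i" for i using assms by simp
  from this[of 1] this[of 2]
  have D: "D $ 2 * vars3 $ 3 = D $ 3 * vars3 $ 2" "D $ 3 * vars3 $ 1 = D $ 1 * vars3 $ 3"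
    unfolding contract_radial_def D_def by (simp_all add: algebra_simps)
  obtain q p where p: "D $ 3 = pCons q p" by (cases "D $ 3")
  have "q * [:0, 1:] = 0"
    using arg_cong[OF D(1), of "\<lambda>p. coeff p 0"] by (simp add: p vars3_nth coeff_mult)
  then have "q = 0" by simp
  then have p: "D $ 3 = p * vars3 $ 3" using p by (simp add: vars3_nth)
  have "vars3 $ 3 * (D $ 2 - p * vars3 $ 2) = 0" "vars3 $ 3 * (D $ 1 - p * vars3 $ 1) = 0"
    using D unfolding p by algebra+
  moreover have "vars3 $ 3 \<noteq> 0" by (simp add: vars3_nth)
  ultimately have "D $ 2 = p * vars3 $ 2" "D $ 1 = p * vars3 $ 1" by simp_all
  then have "D = p *s vars3" using p by (simp add: vec_eq_iff forall_3)
  then have "Z' = Z + p *s vars3" by (simp add: D_def algebra_simps)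
  then show ?thesis by (rule that)
qed

text \<open>
  Adding \<open>p R\<close> to a field that satisfies Euler's relation adds to the second and third
  column of the determinant only combinations of the preceding columns.
\<close>

lemma inflection_poly_eq_homogeneous_field:
  assumes "contract_radial Z = homogeneous_form a b"
  shows "inflection_poly Z = inflection_poly (homogeneous_field a b)"
proof -
  let ?H = "homogeneous_field a b"
  obtain p where p: "Z = ?H + p *s vars3"
    using contract_radial_eqD[of Z ?H] assms contract_radial_homogeneous_field[of a b] by auto
  have euler: "deriv_along vars3 (?H $ i) = const3 4 * ?H $ i" for i
  proof (rule eval3_eqI)
    show "eval3 (deriv_along vars3 (?H $ i)) v = eval3 (const3 4 * ?H $ i) v" for v
      using exhaust_3[of i] quartic_euler[of "v $ 1" _ "v $ 2"]
      by (auto simp: eval3_deriv_along_binary_form deriv_along_minus)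
  qed
  have W: "deriv_along Z (Z $ i) = deriv_along ?H (?H $ i) + (p * const3 4 + p) * ?H $ i
      + (deriv_along Z p + p * p) * vars3 $ i" for i
    unfolding p by (simp add: deriv_along_add deriv_along_mult deriv_along_add_field euler algebra_simps)
  have Zi: "Z $ i = ?H $ i + p * vars3 $ i" for i by (simp add: p)
  define V E W1 k m where "V = (\<lambda>i. vars3 $ i)" and "E = (\<lambda>i. ?H $ i)"
    and "W1 = (\<lambda>i. deriv_along ?H (?H $ i))" and "k = p * const3 4 + p" and "m = deriv_along Z p + p * p"
  have "inflection_poly Z = det (\<chi> i. vector [V i, E i + p * V i, W1 i + k * E i + m * V i] :: poly3 ^ 3 ^ 3)"
    unfolding inflection_poly_def W by (simp add: Zi V_def E_def W1_def k_def m_def)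
  also have "\<dots> = det (\<chi> i. vector [V i, E i, W1 i] :: poly3 ^ 3 ^ 3)"
    unfolding det_3 by (simp add: algebra_simps)
  also have "\<dots> = inflection_poly ?H" by (simp add: inflection_poly_def V_def E_def W1_def)
  finally show ?thesis .
qed

lemma eval3_linear_poly [simp]: "eval3 (linear_poly l) v = (\<Sum>i\<in>UNIV. l $ i * v $ i)"
  by (simp add: linear_poly_def)

lemma linear_poly_nonzero:
  assumes "l \<noteq> 0"
  shows "linear_poly l \<noteq> 0"
proof
  assume "linear_poly l = 0"
  then have "(\<Sum>i\<in>UNIV. l $ i * v $ i) = 0" for v using eval3_linear_poly[of l v] by simp
  from this[of "vector [1, 0, 0]"] this[of "vector [0, 1, 0]"] this[of "vector [0, 0, 1]"]
  have "l = 0" by (simp add: sum_3 vec_eq_iff forall_3)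
  then show False using assms by simp
qed

text \<open>
  A factorization of the inflection polynomial into invariant lines is carried to the normal form
  by a projective change of coordinates.
\<close>

lemma inflection_product_pullback:
  assumes M: "invertible M" and ls: "\<forall>l\<in>set ls. invariant_line (contract_radial Z) l"
    and infl: "inflection_poly Z = const3 c * prod_list (map linear_poly ls)" and "c \<noteq> 0"
    and eq: "pullback M (contract_radial Z) = homogeneous_form a b"
  obtains c' ls' where "c' \<noteq> 0" "\<forall>l\<in>set ls'. invariant_line (homogeneous_form a b) l"
    "inflection_poly (homogeneous_field a b) = const3 c' * prod_list (map linear_poly ls')"
proof
  show "det M ^ 2 * c \<noteq> 0" using M \<open>c \<noteq> 0\<close> by (simp add: invertible_det_nz)
  show "\<forall>l\<in>set (map (\<lambda>l. l v* M) ls). invariant_line (homogeneous_form a b) l"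
    using ls invariant_line_pullback[OF _ M] by (auto simp flip: eq)
  have "inflection_poly (homogeneous_field a b) = inflection_poly (pullback_field M Z)"
    using inflection_poly_eq_homogeneous_field contract_radial_pullback[OF M] eq by metis
  then show "inflection_poly (homogeneous_field a b) =
      const3 (det M ^ 2 * c) * prod_list (map linear_poly (map (\<lambda>l. l v* M) ls))"
    by (intro eval3_eqI)
      (simp add: eval3_inflection_poly_pullback[OF M] infl comp_def sum_vector_matrix_mult)
qed

text \<open>
  Up to the factor 4, the Jacobian of the two quartics on the line \<open>y = 1\<close> (\<open>jacobian_1\<close>).
\<close>

definition wronskian :: "complex poly \<Rightarrow> complex poly \<Rightarrow> complex poly" where
  "wronskian a b = pderiv a * b - a * pderiv b"

lemma poly_4_expand:
  fixes a :: "'a::zero poly"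
  assumes "degree a \<le> 4"
  shows "a = [:coeff a 0, coeff a 1, coeff a 2, coeff a 3, coeff a 4:]"
proof (rule poly_eqI)
  fix n :: nat
  consider "n = 0" | "n = 1" | "n = 2" | "n = 3" | "n = 4" | "n > 4" by linarith
  then show "coeff a n = coeff [:coeff a 0, coeff a 1, coeff a 2, coeff a 3, coeff a 4:] n"
    using assms by cases (simp_all add: coeff_pCons coeff_eq_0 eval_nat_numeral split: nat.split)
qed

lemma poly_pderiv_quartic:
  assumes "degree a \<le> 4"
  shows "poly (pderiv a) t = quartic_dx a t 1"
proof -
  have "poly (pderiv [:p, q, r, s, u:]) t = q + 2 * r * t + 3 * s * t ^ 2 + 4 * u * t ^ 3"
    for p q r s u :: complex
    by (simp add: pderiv_pCons algebra_simps eval_nat_numeral)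
  from this[of "coeff a 0" "coeff a 1" "coeff a 2" "coeff a 3" "coeff a 4"] show ?thesis
    unfolding poly_4_expand[OF assms, symmetric] by (simp add: quartic_dx_def)
qed

lemma jacobian_1:
  assumes "degree a \<le> 4" "degree b \<le> 4"
  shows "jacobian a b t 1 = 4 * poly (wronskian a b) t"
proof -
  have dy: "quartic_dy a t 1 = 4 * poly a t - t * poly (pderiv a) t" if "degree a \<le> 4" for a
    using quartic_euler[of t a 1]
    by (simp add: poly_pderiv_quartic that eq_diff_eq add.commute flip: quartic_1)
  show ?thesis
    unfolding jacobian_def wronskian_def dy[OF assms(1)] dy[OF assms(2)]
      poly_pderiv_quartic[OF assms(1), symmetric] poly_pderiv_quartic[OF assms(2), symmetric]
    by (simp add: algebra_simps)
qed

text \<open>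
  Over a zero \<open>[x : y]\<close> of the Jacobian, each of the infinitely many points \<open>(x, y, z)\<close> lies on one
  of finitely many invariant lines. A line that does not pass through the origin contains only one of
  these points, so some line through the origin occurs, and its invariance means \<open>x A + y B = 0\<close>.
\<close>

lemma convex_critical_fixed:
  assumes ls: "\<forall>l\<in>set ls. invariant_line (homogeneous_form a b) l"
    and infl: "inflection_poly (homogeneous_field a b) = const3 c * prod_list (map linear_poly ls)"
    and crit: "jacobian a b x y = 0" and xy: "c \<noteq> 0"
  shows "x * quartic a x y + y * quartic b x y = 0"
proof (rule ccontr)
  assume nz: "x * quartic a x y + y * quartic b x y \<noteq> 0"
  have "z \<in> (\<lambda>l. - (l $ 1 * x + l $ 2 * y) / l $ 3) ` set ls" for z
  proof -
    have "eval3 (inflection_poly (homogeneous_field a b)) (vector [x, y, z]) = 0"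
      using inflection_homogeneous_field[of a b "vector [x, y, z]"] crit by simp
    then have "prod_list (map (\<lambda>l. eval3 (linear_poly l) (vector [x, y, z])) ls) = 0"
      using \<open>c \<noteq> 0\<close> by (simp add: infl comp_def)
    then obtain l where l: "l \<in> set ls" and on: "l $ 1 * x + l $ 2 * y + l $ 3 * z = 0"
      by (auto simp: prod_list_zero_iff sum_3)
    have "l $ 3 \<noteq> 0"
    proof
      assume "l $ 3 = 0"
      then have "form_at (homogeneous_form a b) (vector [x, y, z]) (vector [0, 0, 1]) = 0"
        using ls l on unfolding invariant_line_def by (auto simp: sum_3)
      then have "- (x * quartic a x y + y * quartic b x y) = 0"
        by (simp add: form_at_homogeneous_form algebra_simps)
      then show False using nz unfolding neg_equal_0_iff_equal by contradiction
    qed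
    then have "z = - (l $ 1 * x + l $ 2 * y) / l $ 3"
      using on by (simp add: eq_divide_eq eq_neg_iff_add_eq_0 algebra_simps)
    then show ?thesis using l by blast
  qed
  then have "(UNIV :: complex set) \<subseteq> (\<lambda>l. - (l $ 1 * x + l $ 2 * y) / l $ 3) ` set ls" by blast
  then have "finite (UNIV :: complex set)" by (rule finite_subset) simp
  then show False by (simp add: infinite_UNIV_char_0)
qed

text \<open>
  The factor theorem for a binary form, from \<open>x - r y\<close> dividing every \<open>x\<^sup>i - (r y)\<^sup>i\<close>.
\<close>

lemma linear_dvd_binary_form:
  assumes "degree a \<le> 4" "poly a r = 0"
  shows "vars3 $ 1 - const3 r * vars3 $ 2 dvd binary_form 4 (coeff a)"
proof -
  let ?x = "vars3 $ 1" and ?y = "vars3 $ 2"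
  have "(\<Sum>i\<le>4. const3 (coeff a i) * const3 r ^ i) = const3 (poly a r)"
    using assms(1) by (intro eval3_eqI) (simp add: quartic_def flip: quartic_1)
  then have "(\<Sum>i\<le>4. const3 (coeff a i) * const3 r ^ i) = 0"
    using assms(2) by (simp add: const3_def)
  then have "(\<Sum>i\<le>4. const3 (coeff a i) * const3 r ^ i) * ?y ^ 4 = 0" by simp
  moreover have "(\<Sum>i\<le>4. const3 (coeff a i) * const3 r ^ i) * ?y ^ 4 =
      (\<Sum>i\<le>4. const3 (coeff a i) * (const3 r * ?y) ^ i * ?y ^ (4 - i))"
    unfolding sum_distrib_right
  proof (rule sum.cong)
    fix i :: nat assume "i \<in> {..4}"
    then have "?y ^ 4 = ?y ^ i * ?y ^ (4 - i)" by (simp flip: power_add)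
    then show "const3 (coeff a i) * const3 r ^ i * ?y ^ 4 =
        const3 (coeff a i) * (const3 r * ?y) ^ i * ?y ^ (4 - i)"
      by (simp add: power_mult_distrib)
  qed simp
  ultimately have "binary_form 4 (coeff a) =
      (\<Sum>i\<le>4. const3 (coeff a i) * (?x ^ i - (const3 r * ?y) ^ i) * ?y ^ (4 - i))"
    unfolding binary_form_def right_diff_distrib left_diff_distrib sum_subtractf by simp
  moreover have "?x - const3 r * ?y dvd ?x ^ i - (const3 r * ?y) ^ i" for i
    by (simp add: power_diff_sumr2)
  ultimately show ?thesis by (auto intro!: dvd_sum intro: dvd_mult2 dvd_mult)
qed

text \<open>
  A common zero of \<open>A\<close> and \<open>B\<close> gives a common linear factor of all coefficients of the form.
\<close>

lemma foliation_form_no_common_root: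
  assumes \<omega>: "foliation_form 4 (homogeneous_form a b)" and deg: "degree a \<le> 4" "degree b \<le> 4"
  shows "poly a r \<noteq> 0 \<or> poly b r \<noteq> 0"
proof (rule ccontr)
  assume "\<not> ?thesis"
  then have "vars3 $ 1 - const3 r * vars3 $ 2 dvd homogeneous_form a b $ i" for i
    using linear_dvd_binary_form[OF deg(1), of r] linear_dvd_binary_form[OF deg(2), of r] exhaust_3[of i]
    by (auto simp: homogeneous_form_def Let_def intro!: dvd_add dvd_diff)
  then have "is_unit (vars3 $ 1 - const3 r * vars3 $ 2)"
    using \<omega> by (simp add: foliation_form_def)
  then obtain q where "1 = (vars3 $ 1 - const3 r * vars3 $ 2) * q" by (auto simp: dvd_def)
  from arg_cong[OF this, of "\<lambda>p. eval3 p 0"] show False by simp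
qed

lemma const3_mult: "const3 p * const3 q = const3 (p * q)"
  by (rule eval3_eqI) simp

lemma const3_1: "const3 1 = 1"
  by (rule eval3_eqI) simp

lemma foliation_form_scale:
  assumes \<omega>: "foliation_form d \<omega>" and "c \<noteq> 0"
  shows "foliation_form d (const3 c *s \<omega>)"
proof -
  have "is_unit q" if q: "\<forall>i. q dvd (const3 c *s \<omega>) $ i" for q
  proof -
    have "q dvd const3 (1 / c) * (const3 c * \<omega> $ i)" for i
      using q by (metis dvd_mult vector_smult_component)
    moreover have "const3 (1 / c) * (const3 c * \<omega> $ i) = \<omega> $ i" for i
      using \<open>c \<noteq> 0\<close> by (simp add: const3_mult const3_1 flip: mult.assoc)
    ultimately show ?thesis using \<omega> by (simp add: foliation_form_def)
  qed
  moreover have "form_at (const3 c *s \<omega>) v v = c * form_at \<omega> v v" for v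
    by (simp add: form_at_eval3 sum_3 algebra_simps)
  ultimately show ?thesis
    using \<omega> unfolding foliation_form_def form_euler_iff by (simp add: homogeneous_poly_const3_mult)
qed

text \<open>
  After a linear change of the affine coordinates the point \<open>[1 : 0]\<close> is not critical, so that all
  critical points of the map are roots of the wronskian. The inequality of coefficients says that the
  wronskian has its full degree 6.
\<close>

theorem convex_homogeneous_normal_form:
  assumes "homogeneous_foliation 4 \<F>" "convex_foliation 4 \<F>"
  obtains \<omega> M a b where "\<F> = {const3 c *s \<omega> | c. c \<noteq> 0}" "invertible M"
    "pullback M \<omega> = homogeneous_form a b" "degree a \<le> 4" "degree b \<le> 4"
    "\<And>r. poly a r \<noteq> 0 \<or> poly b r \<noteq> 0"
    "\<And>r. poly (wronskian a b) r = 0 \<Longrightarrow> r * poly a r + poly b r = 0"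
    "coeff a 4 * coeff b 3 \<noteq> coeff a 3 * coeff b 4"
proof -
  obtain \<omega>0 where \<omega>0: "foliation_form 4 \<omega>0" "\<F> = {const3 c *s \<omega>0 | c. c \<noteq> 0}"
    using assms(2) by (auto simp: convex_foliation_def is_foliation_def)
  obtain \<omega> Z c ls where "\<omega> \<in> \<F>" and Z: "\<omega> = contract_radial Z" and c: "c \<noteq> 0"
    and ls: "\<forall>l\<in>set ls. invariant_line \<omega> l"
    and infl: "inflection_poly Z = const3 c * prod_list (map linear_poly ls)"
    using assms(2) unfolding convex_foliation_def by blast
  obtain e where e: "\<omega> = const3 e *s \<omega>0" "e \<noteq> 0" using \<open>\<omega> \<in> \<F>\<close> \<omega>0 by auto
  have \<omega>: "foliation_form 4 \<omega>"
    using foliation_form_scale[OF \<omega>0(1) e(2)] by (simp add: e(1))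
  have \<F>: "\<F> = {const3 c *s \<omega> | c. c \<noteq> 0}"
  proof -
    have "const3 c *s \<omega>0 = const3 (c / e) *s \<omega>" for c using e by (simp add: const3_mult)
    moreover have "const3 c *s \<omega> = const3 (c * e) *s \<omega>0" for c by (simp add: e const3_mult)
    ultimately show ?thesis unfolding \<omega>0(2) using e(2)
      by (metis (no_types, opaque_lifting) divide_eq_0_iff mult_eq_0_iff)
  qed
  obtain M0 where M0: "invertible M0" and inv:
    "\<And>t. t \<noteq> 0 \<Longrightarrow> pullback (homothety t) ` pullback M0 ` \<F> = pullback M0 ` \<F>"
    using assms(1) by (auto simp: homogeneous_foliation_def)
  have "pullback (homothety 2) (pullback M0 \<omega>) \<in> pullback M0 ` \<F>"
    using inv[of 2] \<open>\<omega> \<in> \<F>\<close> by auto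
  then obtain \<mu> where "pullback (homothety 2) (pullback M0 \<omega>) = const3 \<mu> *s pullback M0 \<omega>"
    by (auto simp: \<F> pullback_scale)
  then obtain a0 b0 where ab0: "pullback M0 \<omega> = homogeneous_form a0 b0"
    using foliation_form_homothety_invariant[OF foliation_form_pullback[OF \<omega> M0]] by metis
  obtain c0 ls0 where 0: "c0 \<noteq> 0" "\<forall>l\<in>set ls0. invariant_line (homogeneous_form a0 b0) l"
    "inflection_poly (homogeneous_field a0 b0) = const3 c0 * prod_list (map linear_poly ls0)"
    using inflection_product_pullback[OF M0 ls[unfolded Z] infl c ab0[unfolded Z]] by blast
  have "const3 c0 \<noteq> 0" using 0 by (simp add: const3_def)
  moreover have "linear_poly l \<noteq> 0" if "l \<in> set ls0" for l
    using 0(2) that linear_poly_nonzero by (auto simp: invariant_line_def)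
  ultimately have "inflection_poly (homogeneous_field a0 b0) \<noteq> 0"
    by (auto simp: 0(3) prod_list_zero_iff)
  then obtain v where v: "eval3 (inflection_poly (homogeneous_field a0 b0)) v \<noteq> 0"
    using eval3_eq_0_iff by blast
  then have "v $ 1 \<noteq> 0 \<or> v $ 2 \<noteq> 0" using inflection_homogeneous_field[of a0 b0 v] by auto
  \<comment> \<open>The new coordinate point \<open>[1 : 0]\<close> is the direction of a point where the inflection polynomial does not vanish.\<close>
  then obtain q s where qs: "v $ 1 * s - q * v $ 2 \<noteq> 0"
    using that[of 1 0] that[of 0 1] by auto
  define P where "P = plane_matrix (v $ 1) q (v $ 2) s"
  have P: "invertible P" using qs unfolding P_def by (rule invertible_plane_matrix)
  have M: "invertible (M0 ** P)" using M0 P by (rule invertible_mult)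
  have "pullback (homothety 2) (pullback P (homogeneous_form a0 b0)) =
      pullback P (pullback (homothety 2) (homogeneous_form a0 b0))"
    by (simp add: pullback_pullback P_def homothety_plane_matrix_commute)
  also have "\<dots> = const3 (2 ^ 5) *s pullback P (homogeneous_form a0 b0)"
    by (simp only: pullback_homothety_homogeneous_form pullback_scale)
  finally have "pullback (homothety 2) (pullback P (homogeneous_form a0 b0)) =
      const3 (2 ^ 5) *s pullback P (homogeneous_form a0 b0)" .
  then obtain a b where ab: "degree a \<le> 4" "degree b \<le> 4"
      "pullback P (homogeneous_form a0 b0) = homogeneous_form a b"
    using foliation_form_homothety_invariant
      foliation_form_pullback[OF foliation_form_pullback[OF \<omega> M0] P] ab0 by metis
  then have eq: "pullback (M0 ** P) \<omega> = homogeneous_form a b"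
    by (simp add: ab0 flip: pullback_pullback)
  obtain c1 ls1 where 1: "c1 \<noteq> 0" "\<forall>l\<in>set ls1. invariant_line (homogeneous_form a b) l"
    "inflection_poly (homogeneous_field a b) = const3 c1 * prod_list (map linear_poly ls1)"
    using inflection_product_pullback[OF M ls[unfolded Z] infl c eq[unfolded Z]] by blast
  have fixed: "r * poly a r + poly b r = 0" if "poly (wronskian a b) r = 0" for r
    using convex_critical_fixed[OF 1(2,3) _ 1(1), of r 1] that
    by (simp add: jacobian_1 ab quartic_1)
  have "inflection_poly (homogeneous_field a b) = inflection_poly (pullback_field P (homogeneous_field a0 b0))"
    by (rule inflection_poly_eq_homogeneous_field[symmetric])
      (simp add: contract_radial_pullback[OF P] contract_radial_homogeneous_field ab)
  then have "eval3 (inflection_poly (homogeneous_field a b)) (vector [1, 0, v $ 3]) =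
      det P ^ 2 * eval3 (inflection_poly (homogeneous_field a0 b0)) (vector [v $ 1, v $ 2, v $ 3])"
    using eval3_inflection_poly_pullback[OF P] by (simp add: P_def)
  moreover have "vector [v $ 1, v $ 2, v $ 3] = v" by (simp add: vec_eq_iff forall_3)
  ultimately have "eval3 (inflection_poly (homogeneous_field a b)) (vector [1, 0, v $ 3]) \<noteq> 0"
    using v P by (simp add: invertible_det_nz)
  then have "jacobian a b 1 0 \<noteq> 0"
    using inflection_homogeneous_field[of a b "vector [1, 0, v $ 3]"] by auto
  then have lead: "coeff a 4 * coeff b 3 \<noteq> coeff a 3 * coeff b 4"
    by (auto simp: jacobian_def quartic_dx_def quartic_dy_def)
  have "poly a r \<noteq> 0 \<or> poly b r \<noteq> 0" for r
    using foliation_form_no_common_root foliation_form_pullback[OF \<omega> M] eq ab by metis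
  then show ?thesis using that[OF \<F> M eq ab(1,2) _ fixed lead] by blast
qed

section \<open>Linear equivalence of pairs of binary quartics\<close>

text \<open>
  The pullback of \<open>A dx + B dy\<close> under the linear map with rows \<open>(p, q)\<close> and \<open>(r, s)\<close> is
  \<open>l (A' dx + B' dy)\<close>.
\<close>

definition plane_transform :: "complex \<Rightarrow> complex \<Rightarrow> complex \<Rightarrow> complex \<Rightarrow> complex \<Rightarrow>
    complex poly \<Rightarrow> complex poly \<Rightarrow> complex poly \<Rightarrow> complex poly \<Rightarrow> bool" where
  "plane_transform p q r s l a b a' b' \<longleftrightarrow> p * s - q * r \<noteq> 0 \<and> l \<noteq> 0 \<and>
     (\<forall>x y. p * quartic a (p * x + q * y) (r * x + s * y) + r * quartic b (p * x + q * y) (r * x + s * y)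
        = l * quartic a' x y) \<and>
     (\<forall>x y. q * quartic a (p * x + q * y) (r * x + s * y) + s * quartic b (p * x + q * y) (r * x + s * y)
        = l * quartic b' x y)"

definition plane_conjugate :: "complex poly \<times> complex poly \<Rightarrow> complex poly \<times> complex poly \<Rightarrow> bool" where
  "plane_conjugate ab ab' \<longleftrightarrow>
     (\<exists>p q r s l. plane_transform p q r s l (fst ab) (snd ab) (fst ab') (snd ab'))"

lemma plane_conjugateI: "plane_transform p q r s l a b a' b' \<Longrightarrow> plane_conjugate (a, b) (a', b')"
  unfolding plane_conjugate_def fst_conv snd_conv by blast

lemma plane_transform_compose:
  assumes "plane_transform p q r s l a b a' b'" "plane_transform p' q' r' s' l' a' b' a'' b''"
  shows "plane_transform (p * p' + q * r') (p * q' + q * s') (r * p' + s * r') (r * q' + s * s')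
    (l * l') a b a'' b''"
proof -
  have "(p * p' + q * r') * (r * q' + s * s') - (p * q' + q * s') * (r * p' + s * r') =
      (p * s - q * r) * (p' * s' - q' * r')" by algebra
  then have det: "(p * p' + q * r') * (r * q' + s * s') - (p * q' + q * s') * (r * p' + s * r') \<noteq> 0"
    "l * l' \<noteq> 0"
    using assms by (auto simp: plane_transform_def)
  have arg: "(p * p' + q * r') * x + (p * q' + q * s') * y = p * (p' * x + q' * y) + q * (r' * x + s' * y)"
    "(r * p' + s * r') * x + (r * q' + s * s') * y = r * (p' * x + q' * y) + s * (r' * x + s' * y)" for x y
    by algebra+
  show ?thesis unfolding plane_transform_def arg
  proof (intro conjI allI det)
    fix x y
    let ?x = "p' * x + q' * y" and ?y = "r' * x + s' * y"
    let ?A = "quartic a (p * ?x + q * ?y) (r * ?x + s * ?y)"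
    let ?B = "quartic b (p * ?x + q * ?y) (r * ?x + s * ?y)"
    have 1: "p * ?A + r * ?B = l * quartic a' ?x ?y" "q * ?A + s * ?B = l * quartic b' ?x ?y"
      using assms(1) by (auto simp: plane_transform_def)
    have 2: "p' * quartic a' ?x ?y + r' * quartic b' ?x ?y = l' * quartic a'' x y"
      "q' * quartic a' ?x ?y + s' * quartic b' ?x ?y = l' * quartic b'' x y"
      using assms(2) by (auto simp: plane_transform_def)
    show "(p * p' + q * r') * ?A + (r * p' + s * r') * ?B = l * l' * quartic a'' x y"
      using 1 2(1) by algebra
    show "(p * q' + q * s') * ?A + (r * q' + s * s') * ?B = l * l' * quartic b'' x y"
      using 1 2(2) by algebra
  qed
qed

lemma plane_transform_inverse:
  assumes tr: "plane_transform p q r s l a b a' b'" and e: "e * (p * s - q * r) = 1" and m: "m * l = 1"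
  shows "plane_transform (s * e) (- (q * e)) (- (r * e)) (p * e) m a' b' a b"
  unfolding plane_transform_def
proof (intro conjI allI)
  have "s * e * (p * e) - - (q * e) * (- (r * e)) = e" using e by algebra
  then show "s * e * (p * e) - - (q * e) * (- (r * e)) \<noteq> 0" using e by auto
  show "m \<noteq> 0" using m by auto
  fix x y
  define x' y' where xy': "x' = s * e * x + - (q * e) * y" "y' = - (r * e) * x + p * e * y"
  have xy: "p * x' + q * y' = x" "r * x' + s * y' = y" unfolding xy' using e by algebra+
  have 1: "p * quartic a x y + r * quartic b x y = l * quartic a' x' y'"
    "q * quartic a x y + s * quartic b x y = l * quartic b' x' y'"
    using tr unfolding plane_transform_def by (metis xy)+
  show "s * e * quartic a' (s * e * x + - (q * e) * y) (- (r * e) * x + p * e * y) +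
      - (r * e) * quartic b' (s * e * x + - (q * e) * y) (- (r * e) * x + p * e * y) = m * quartic a x y"
    unfolding xy'[symmetric] using 1 e m by algebra
  show "- (q * e) * quartic a' (s * e * x + - (q * e) * y) (- (r * e) * x + p * e * y) +
      p * e * quartic b' (s * e * x + - (q * e) * y) (- (r * e) * x + p * e * y) = m * quartic b x y"
    unfolding xy'[symmetric] using 1 e m by algebra
qed

lemma plane_conjugate_trans:
  "plane_conjugate ab ab' \<Longrightarrow> plane_conjugate ab' ab'' \<Longrightarrow> plane_conjugate ab ab''"
  unfolding plane_conjugate_def by (blast intro: plane_transform_compose)

lemma plane_conjugate_sym: "plane_conjugate ab ab' \<Longrightarrow> plane_conjugate ab' ab"
proof -
  assume "plane_conjugate ab ab'"
  then obtain p q r s l where tr: "plane_transform p q r s l (fst ab) (snd ab) (fst ab') (snd ab')"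
    unfolding plane_conjugate_def by blast
  then have "1 / (p * s - q * r) * (p * s - q * r) = 1" "1 / l * l = 1"
    by (simp_all add: plane_transform_def)
  from plane_transform_inverse[OF tr this] show ?thesis unfolding plane_conjugate_def by blast
qed

section \<open>Fixed critical points\<close>

text \<open>
  For fixed \<open>x, y\<close> these are the partial derivatives at \<open>(x, y)\<close> of the quartic
  \<open>(u, v) \<mapsto> x A(u, v) + y B(u, v)\<close>. They vanish together exactly when this quartic has a multiple zero
  at \<open>[x : y]\<close>. For \<open>A, B\<close> without common zero, a simple zero means that the point is fixed by \<open>[- B : A]\<close>, a multiple one that it is
  also critical.
\<close>

definition fixed_critical_point :: "complex poly \<Rightarrow> complex poly \<Rightarrow> complex \<Rightarrow> complex \<Rightarrow> bool" where
  "fixed_critical_point a b x y \<longleftrightarrow> x * quartic_dx a x y + y * quartic_dx b x y = 0 \<and>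
     x * quartic_dy a x y + y * quartic_dy b x y = 0"

lemma quartic_deriv_line:
  "((\<lambda>t. quartic a (x + t * v) (y + t * w)) has_field_derivative
     v * quartic_dx a x y + w * quartic_dy a x y) (at 0)"
  unfolding quartic_expand quartic_dx_def quartic_dy_def
  by (rule derivative_eq_intros refl | simp)+ (simp add: algebra_simps eval_nat_numeral)

text \<open>
  A linear equivalence maps the quartic \<open>x A' + y B'\<close> attached to a point to a multiple of the one
  attached to the image point; comparing derivatives along lines through the point gives the claim.
\<close>

lemma fixed_critical_point_transform:
  assumes tr: "plane_transform p q r s l a b a' b'"
    and crit: "fixed_critical_point a b (p * x + q * y) (r * x + s * y)"
  shows "fixed_critical_point a' b' x y"
proof -
  let ?x = "p * x + q * y" and ?y = "r * x + s * y"
  have key: "v * (x * quartic_dx a' x y + y * quartic_dx b' x y) +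
      w * (x * quartic_dy a' x y + y * quartic_dy b' x y) = 0" for v w
  proof -
    let ?v = "p * v + q * w" and ?w = "r * v + s * w"
    have "l * (x * quartic a' (x + t * v) (y + t * w) + y * quartic b' (x + t * v) (y + t * w)) =
        ?x * quartic a (?x + t * ?v) (?y + t * ?w) + ?y * quartic b (?x + t * ?v) (?y + t * ?w)" for t
    proof -
      let ?X = "p * (x + t * v) + q * (y + t * w)" and ?Y = "r * (x + t * v) + s * (y + t * w)"
      have "p * quartic a ?X ?Y + r * quartic b ?X ?Y = l * quartic a' (x + t * v) (y + t * w)"
        "q * quartic a ?X ?Y + s * quartic b ?X ?Y = l * quartic b' (x + t * v) (y + t * w)"
        using tr by (auto simp: plane_transform_def)
      moreover have "?X = ?x + t * ?v" "?Y = ?y + t * ?w" by algebra+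
      ultimately show ?thesis by algebra
    qed
    moreover have "((\<lambda>t. l * (x * quartic a' (x + t * v) (y + t * w) + y * quartic b' (x + t * v) (y + t * w)))
        has_field_derivative l * (x * (v * quartic_dx a' x y + w * quartic_dy a' x y) +
          y * (v * quartic_dx b' x y + w * quartic_dy b' x y))) (at 0)"
      by (intro DERIV_cmult DERIV_add quartic_deriv_line)
    moreover have "((\<lambda>t. ?x * quartic a (?x + t * ?v) (?y + t * ?w) + ?y * quartic b (?x + t * ?v) (?y + t * ?w))
        has_field_derivative ?x * (?v * quartic_dx a ?x ?y + ?w * quartic_dy a ?x ?y) +
          ?y * (?v * quartic_dx b ?x ?y + ?w * quartic_dy b ?x ?y)) (at 0)"
      by (intro DERIV_cmult DERIV_add quartic_deriv_line)
    ultimately have "l * (x * (v * quartic_dx a' x y + w * quartic_dy a' x y) +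
          y * (v * quartic_dx b' x y + w * quartic_dy b' x y)) =
        ?x * (?v * quartic_dx a ?x ?y + ?w * quartic_dy a ?x ?y) +
          ?y * (?v * quartic_dx b ?x ?y + ?w * quartic_dy b ?x ?y)"
      by (simp only:) (rule DERIV_unique)
    also have "\<dots> = ?v * (?x * quartic_dx a ?x ?y + ?y * quartic_dx b ?x ?y) +
        ?w * (?x * quartic_dy a ?x ?y + ?y * quartic_dy b ?x ?y)" by algebra
    also have "\<dots> = 0" using crit by (simp add: fixed_critical_point_def)
    finally have "x * (v * quartic_dx a' x y + w * quartic_dy a' x y) +
          y * (v * quartic_dx b' x y + w * quartic_dy b' x y) = 0"
      using tr by (simp add: plane_transform_def)
    then show ?thesis by algebra
  qed
  from key[of 1 0] key[of 0 1] show ?thesis by (simp add: fixed_critical_point_def)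
qed

section \<open>Contact at fixed critical points\<close>

lemma wronskian_contact: "wronskian a (smult r a + b) = wronskian a b"
  by (simp add: wronskian_def pderiv_add pderiv_smult algebra_simps)

text \<open>
  Let \<open>L = t - r\<close> and \<open>g = r a + b\<close>. If \<open>g = L\<^bsup>k\<^esup> h\<close> then \<open>a' g - a g'\<close>, which is the
  wronskian, is \<open>L\<^bsup>k - 1\<^esup>\<close> times a polynomial with value \<open>- k a(r) h(r)\<close> at \<open>r\<close>; so each further
  factor \<open>L\<close> of the wronskian forces \<open>h(r) = 0\<close>.
\<close>

lemma contact_order:
  assumes "[:-r, 1:] ^ k dvd wronskian a b" "r * poly a r + poly b r = 0" "poly a r \<noteq> 0"
  shows "[:-r, 1:] ^ Suc k dvd smult r a + b"
proof -
  define L where "L = [:-r, 1:]"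
  have root: "L dvd p \<longleftrightarrow> poly p r = 0" for p by (simp add: L_def poly_eq_0_iff_dvd)
  have "L ^ k dvd wronskian a b \<Longrightarrow> L ^ Suc k dvd smult r a + b"
  proof (induction k)
    case 0
    then show ?case using assms(2) by (simp add: root)
  next
    case (Suc k)
    have "L ^ k dvd wronskian a b" using Suc.prems by (meson dvd_trans le_imp_power_dvd le_SucI order_refl)
    then obtain h where h: "smult r a + b = L * (L ^ k * h)" using Suc.IH by (auto simp: dvd_def mult.assoc)
    define c :: complex where "c = of_nat (Suc k)"
    have "c \<noteq> 0" by (simp add: c_def del: of_nat_Suc)
    have "pderiv (L ^ Suc k) = smult c (L ^ k)"
      unfolding pderiv_power_Suc c_def by (simp add: L_def pderiv_pCons)
    then have "pderiv (L * (L ^ k * h)) = smult c (L ^ k) * h + L * L ^ k * pderiv h"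
      by (simp flip: mult.assoc) (simp add: pderiv_mult mult.commute)
    moreover have "wronskian a b = wronskian a (L * (L ^ k * h))"
      unfolding h[symmetric] by (rule wronskian_contact[symmetric])
    ultimately have "wronskian a b = L ^ k * (L * (pderiv a * h - a * pderiv h) - smult c (a * h))"
      by (simp add: wronskian_def algebra_simps)
    moreover have "L ^ k \<noteq> 0" "L \<noteq> 0" by (simp_all add: L_def)
    ultimately have "L dvd L * (pderiv a * h - a * pderiv h) - smult c (a * h)"
      using Suc.prems by (simp add: power_Suc2)
    then have "poly h r = 0" using assms(3) \<open>c \<noteq> 0\<close> by (simp add: root) (simp add: L_def)
    then have "L dvd h" by (simp only: root)
    then show ?case unfolding h by (simp add: mult_dvd_mono mult.commute)
  qed
  then show ?thesis using assms(1) unfolding L_def .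
qed

lemma contact_quotient:
  assumes "[:-r, 1 :: complex:] ^ k dvd g" "degree g \<le> 4" "k \<le> 4"
  obtains h where "g = [:-r, 1:] ^ k * h" "degree h \<le> 4 - k"
proof -
  obtain h where h: "g = [:-r, 1:] ^ k * h" using assms(1) by (auto simp: dvd_def)
  show ?thesis
  proof (cases "h = 0")
    case False
    then have "degree g = k + degree h" unfolding h
      by (subst degree_mult_eq) (simp_all add: degree_linear_power)
    then show ?thesis using that h assms(2) by simp
  qed (use that h in simp)
qed

lemma quartic_contact_4:
  assumes "[:-r, 1:] ^ 4 dvd g" "degree g \<le> 4"
  obtains e where "\<And>x y. quartic g x y = e * (x - r * y) ^ 4"
proof -
  obtain h where h: "g = [:-r, 1:] ^ 4 * h" "degree h \<le> 0" using contact_quotient[OF assms] by auto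
  then obtain e where "h = [:e:]" by (metis degree_eq_zeroE le_zero_eq)
  then have "g = [:r ^ 4 * e, - 4 * r ^ 3 * e, 6 * r ^ 2 * e, - 4 * r * e, e:]"
    by (simp add: h eval_nat_numeral algebra_simps)
  then have "quartic g x y = e * (x - r * y) ^ 4" for x y
    by (simp add: quartic_expand eval_nat_numeral algebra_simps)
  then show ?thesis by (rule that)
qed

lemma quartic_contact_3:
  assumes "[:-r, 1:] ^ 3 dvd g" "degree g \<le> 4"
  obtains e0 e1 where "\<And>x y. quartic g x y = (x - r * y) ^ 3 * (e1 * x + e0 * y)"
proof -
  obtain h where h: "g = [:-r, 1:] ^ 3 * h" "degree h \<le> 1" using contact_quotient[OF assms] by auto
  have "h = [:coeff h 0, coeff h 1:]"
    using h(2) by (auto simp: poly_eq_iff coeff_pCons coeff_eq_0 split: nat.splits)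
  then obtain e0 e1 where "h = [:e0, e1:]" by blast
  then have "g = [:- (r ^ 3 * e0), 3 * r ^ 2 * e0 - r ^ 3 * e1, 3 * r ^ 2 * e1 - 3 * r * e0, e0 - 3 * r * e1, e1:]"
    by (simp add: h eval_nat_numeral algebra_simps)
  then have "quartic g x y = (x - r * y) ^ 3 * (e1 * x + e0 * y)" for x y
    by (simp add: quartic_expand eval_nat_numeral algebra_simps)
  then show ?thesis by (rule that)
qed

lemma quartic_contact_2:
  assumes "[:-r, 1:] ^ 2 dvd g" "degree g \<le> 4"
  obtains e0 e1 e2 where "\<And>x y. quartic g x y = (x - r * y) ^ 2 * (e2 * x ^ 2 + e1 * x * y + e0 * y ^ 2)"
proof -
  obtain h where h: "g = [:-r, 1:] ^ 2 * h" "degree h \<le> 2" using contact_quotient[OF assms] by auto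
  have "h = [:coeff h 0, coeff h 1, coeff h 2:]"
    using h(2) by (auto simp: poly_eq_iff coeff_pCons coeff_eq_0 numeral_2_eq_2 split: nat.splits)
  then obtain e0 e1 e2 where "h = [:e0, e1, e2:]" by blast
  then have "g = [:r ^ 2 * e0, r ^ 2 * e1 - 2 * r * e0, r ^ 2 * e2 - 2 * r * e1 + e0, e1 - 2 * r * e2, e2:]"
    by (simp add: h eval_nat_numeral algebra_simps)
  then have "quartic g x y = (x - r * y) ^ 2 * (e2 * x ^ 2 + e1 * x * y + e0 * y ^ 2)" for x y
    by (simp add: quartic_expand eval_nat_numeral algebra_simps)
  then show ?thesis by (rule that)
qed

lemma fixed_critical_point_contact:
  assumes "[:-r, 1:] ^ 2 dvd smult r a + b" "degree a \<le> 4" "degree b \<le> 4"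
  shows "fixed_critical_point a b r 1"
proof -
  obtain h where "smult r a + b = [:-r, 1:] ^ 2 * h"
    using assms(1) unfolding dvd_def by blast
  then have h: "smult r a + b = [:-r, 1:] * ([:-r, 1:] * h)"
    by (simp only: power2_eq_square mult.assoc)
  have 0: "poly (smult r a + b) r = 0" "poly (pderiv (smult r a + b)) r = 0"
    unfolding h by (simp_all only: pderiv_mult poly_mult poly_add) simp_all
  then have "r * quartic_dx a r 1 + 1 * quartic_dx b r 1 = 0"
    using assms by (simp add: pderiv_add pderiv_smult poly_pderiv_quartic)
  moreover have "r * quartic a r 1 + quartic b r 1 = 0"
    using 0(1) assms by (simp add: quartic_1)
  then have "r * quartic_dy a r 1 + 1 * quartic_dy b r 1 = 0"
    using quartic_euler[of r a 1] quartic_euler[of r b 1] calculation by algebra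
  ultimately show ?thesis by (simp add: fixed_critical_point_def)
qed

text \<open>
  In the coordinates \<open>u = (x - r y) / k\<close> and \<open>v = (x - s y) / m\<close>, which place the points \<open>r\<close> and \<open>s\<close>
  at \<open>[0 : 1]\<close> and \<open>[1 : 0]\<close>, the coefficients of \<open>du\<close> and \<open>dv\<close> are the contact quartics
  \<open>s A + B\<close> and \<open>r A + B\<close>, up to constants.
\<close>

lemma two_point_transform:
  assumes "r \<noteq> s" "k \<noteq> 0" "m \<noteq> 0" "l \<noteq> 0"
    and A: "\<And>x y. k * (s * quartic a x y + quartic b x y) = l * quartic a' ((x - r * y) / k) ((x - s * y) / m)"
    and B: "\<And>x y. - m * (r * quartic a x y + quartic b x y) = l * quartic b' ((x - r * y) / k) ((x - s * y) / m)"
  shows "plane_transform (s * k / (s - r)) (- (r * m) / (s - r)) (k / (s - r)) (- m / (s - r)) (l / (s - r))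
    a b a' b'"
proof -
  define e where "e = 1 / (s - r)"
  have e: "e * (s - r) = 1" "e \<noteq> 0" using assms by (auto simp: e_def)
  have div: "z / (s - r) = z * e" for z by (simp add: e_def)
  have "s * k * e * (- m * e) - - (r * m) * e * (k * e) = - (k * m * e) * (e * (s - r))" by algebra
  then have det: "s * k * e * (- m * e) - - (r * m) * e * (k * e) \<noteq> 0" "l * e \<noteq> 0"
    using assms e by auto
  show ?thesis unfolding plane_transform_def div
  proof (intro conjI allI det)
    fix u v
    define x y where xy: "x = s * k * e * u + - (r * m) * e * v" "y = k * e * u + - m * e * v"
    have "x - r * y = k * u * (e * (s - r))" "x - s * y = m * v * (e * (s - r))"
      unfolding xy by algebra+
    then have uv: "(x - r * y) / k = u" "(x - s * y) / m = v" using assms e by auto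
    have "s * k * e * quartic a x y + k * e * quartic b x y = e * (k * (s * quartic a x y + quartic b x y))"
      by algebra
    then show "s * k * e * quartic a (s * k * e * u + - (r * m) * e * v) (k * e * u + - m * e * v) +
        k * e * quartic b (s * k * e * u + - (r * m) * e * v) (k * e * u + - m * e * v) = l * e * quartic a' u v"
      unfolding xy[symmetric] A uv by simp
    have "- (r * m) * e * quartic a x y + - m * e * quartic b x y = e * (- m * (r * quartic a x y + quartic b x y))"
      by algebra
    then show "- (r * m) * e * quartic a (s * k * e * u + - (r * m) * e * v) (k * e * u + - m * e * v) +
        - m * e * quartic b (s * k * e * u + - (r * m) * e * v) (k * e * u + - m * e * v) = l * e * quartic b' u v"
      unfolding xy[symmetric] B uv by simp
  qed
qed

section \<open>Multiplicities of the critical points\<close>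

text \<open>
  The terms of degree 7 cancel.
\<close>

lemma wronskian_expand:
  assumes "degree a \<le> 4" "degree b \<le> 4"
  shows "wronskian a b = [:
    coeff a 1 * coeff b 0 - coeff a 0 * coeff b 1,
    2 * coeff a 2 * coeff b 0 - 2 * coeff a 0 * coeff b 2,
    3 * coeff a 3 * coeff b 0 + coeff a 2 * coeff b 1 - coeff a 1 * coeff b 2 - 3 * coeff a 0 * coeff b 3,
    4 * coeff a 4 * coeff b 0 + 2 * coeff a 3 * coeff b 1 - 2 * coeff a 1 * coeff b 3 - 4 * coeff a 0 * coeff b 4,
    3 * coeff a 4 * coeff b 1 + coeff a 3 * coeff b 2 - coeff a 2 * coeff b 3 - 3 * coeff a 1 * coeff b 4,
    2 * coeff a 4 * coeff b 2 - 2 * coeff a 2 * coeff b 4,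
    coeff a 4 * coeff b 3 - coeff a 3 * coeff b 4:]"
proof -
  have "wronskian [:a0, a1, a2, a3, a4:] [:b0, b1, b2, b3, b4:] = [:a1 * b0 - a0 * b1,
    2 * a2 * b0 - 2 * a0 * b2, 3 * a3 * b0 + a2 * b1 - a1 * b2 - 3 * a0 * b3,
    4 * a4 * b0 + 2 * a3 * b1 - 2 * a1 * b3 - 4 * a0 * b4,
    3 * a4 * b1 + a3 * b2 - a2 * b3 - 3 * a1 * b4, 2 * a4 * b2 - 2 * a2 * b4, a4 * b3 - a3 * b4:]"
    for a0 a1 a2 a3 a4 b0 b1 b2 b3 b4 :: complex
    by (simp add: wronskian_def pderiv_pCons algebra_simps)
  from this[of "coeff a 0" "coeff a 1" "coeff a 2" "coeff a 3" "coeff a 4"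
      "coeff b 0" "coeff b 1" "coeff b 2" "coeff b 3" "coeff b 4"]
  show ?thesis
    unfolding poly_4_expand[OF assms(1), symmetric] poly_4_expand[OF assms(2), symmetric] .
qed

text \<open>
  The partitions of 6 into at most four parts of size at most 3.
\<close>

lemma multiset_size_6_types:
  fixes R :: "'a multiset"
  assumes size: "size R = 6" and mult: "\<And>r. count R r \<le> 3" and few: "card (set_mset R) \<le> 4"
  obtains
    (33) r s where "r \<noteq> s" "count R r \<ge> 3" "count R s \<ge> 3"
  | (222) r s t where "distinct [r, s, t]" "count R r \<ge> 2" "count R s \<ge> 2" "count R t \<ge> 2"
  | (321) r s t where "distinct [r, s, t]" "count R r \<ge> 3" "count R s \<ge> 2" "count R t \<ge> 1"
  | (2211) r s t u where "distinct [r, s, t, u]" "count R r \<ge> 2" "count R s \<ge> 2" "count R t \<ge> 1" "count R u \<ge> 1"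
  | (3111) r s t u where "distinct [r, s, t, u]" "count R r \<ge> 3" "count R s \<ge> 1" "count R t \<ge> 1" "count R u \<ge> 1"
proof -
  obtain ys where ys: "set ys = set_mset R" "distinct ys" using finite_distinct_list[OF finite_set_mset[of R]] by blast
  define xs where "xs = rev (sort_key (count R) ys)"
  have "sorted_wrt (\<lambda>x y. count R x \<le> count R y) (sort_key (count R) ys)"
    using sorted_sort_key[of "count R" ys] unfolding sorted_map .
  then have xs: "set xs = set_mset R" "distinct xs" "sorted_wrt (\<lambda>x y. count R y \<le> count R x) xs"
    using ys unfolding xs_def by (simp_all only: set_rev set_sort distinct_rev distinct_sort sorted_wrt_rev)
  have len: "length xs \<le> 4" using few distinct_card[OF xs(2)] unfolding xs(1) by linarith
  have sum: "sum_list (map (count R) xs) = 6"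
  proof -
    have "sum_list (map (count R) xs) = sum (count R) (set xs)"
      by (rule sum.distinct_set_conv_list[OF xs(2), symmetric])
    also have "\<dots> = size R" unfolding xs(1) by (rule size_multiset_overloaded_eq[symmetric])
    finally show ?thesis using size by simp
  qed
  have pos: "count R x \<ge> 1" if "x \<in> set xs" for x
    using that unfolding xs(1) count_greater_eq_one_iff .
  consider "xs = []" | r where "xs = [r]" | r s where "xs = [r, s]" | r s t where "xs = [r, s, t]"
    | r s t u where "xs = [r, s, t, u]"
  proof (cases xs)
    case (Cons r as)
    note 1 = this
    show ?thesis
    proof (cases as)
      case (Cons s bs)
      note 2 = this
      show ?thesis
      proof (cases bs)
        case (Cons t cs)
        note 3 = this
        show ?thesis
        proof (cases cs)
          case (Cons u ds)
          then have "ds = []" using len 1 2 3 by simp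
          then show ?thesis using that(5) 1 2 3 Cons by blast
        qed (use that(4) 1 2 3 in blast)
      qed (use that(3) 1 2 in blast)
    qed (use that(2) 1 in blast)
  qed (use that(1) in blast)
  then show ?thesis
  proof cases
    case 1
    then show ?thesis using sum by simp
  next
    case (2 r)
    then show ?thesis using sum mult[of r] by simp
  next
    case (3 r s)
    then have "count R r \<ge> 3" "count R s \<ge> 3" "r \<noteq> s"
      using sum mult[of r] mult[of s] xs(2) by auto
    then show ?thesis using that(1) by blast
  next
    case (4 r s t)
    have *: "count R t \<le> count R s" "count R s \<le> count R r" "count R r + count R s + count R t = 6"
      "count R t \<ge> 1" and d: "distinct [r, s, t]"
      using 4 xs(2,3) sum pos[of t] by auto
    have "count R r \<ge> 3 \<and> count R s \<ge> 2 \<and> count R t \<ge> 1 \<or>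
        count R r \<ge> 2 \<and> count R s \<ge> 2 \<and> count R t \<ge> 2"
      using * mult[of r] by linarith
    then show ?thesis using that(2)[OF d] that(3)[OF d] by blast
  next
    case (5 r s t u)
    have *: "count R u \<le> count R t" "count R t \<le> count R s" "count R s \<le> count R r"
      "count R r + count R s + count R t + count R u = 6"
      "count R s \<ge> 1" "count R t \<ge> 1" "count R u \<ge> 1" and d: "distinct [r, s, t, u]"
      using 5 xs(2,3) sum pos[of u] pos[of t] pos[of s] by auto
    have "count R r \<ge> 3 \<or> count R r \<ge> 2 \<and> count R s \<ge> 2" using * by linarith
    then show ?thesis using that(4)[OF d] that(5)[OF d] * by blast
  qed
qed

section \<open>Classification of the pairs of binary quartics\<close>

text \<open>
  The five pairs \<open>A, B\<close> of the theorem, for \<open>y = 1\<close>.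
\<close>

definition models :: "(complex poly \<times> complex poly) list" where
  "models = [([:1:], [:0, 0, 0, 0, -1:]), ([:-1, 2:], [:0, 0, 0, -2, 1:]),
     ([:1, 4, 6:], [:0, 0, 0, -4, -1:]), ([:1, 4:], [:0, 0, 0, 4, 1:]),
     ([:1, 4, 6:], [:0, 0, 0, 0, 3:])]"

lemma models_nth:
  "models ! 0 = ([:1:], [:0, 0, 0, 0, -1:])" "models ! 1 = ([:-1, 2:], [:0, 0, 0, -2, 1:])"
  "models ! 2 = ([:1, 4, 6:], [:0, 0, 0, -4, -1:])" "models ! 3 = ([:1, 4:], [:0, 0, 0, 4, 1:])"
  "models ! 4 = ([:1, 4, 6:], [:0, 0, 0, 0, 3:])"
  by (simp_all add: models_def)

lemma quartic_pCons [simp]: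
  "quartic [:e0:] x y = e0 * y ^ 4"
  "quartic [:e0, e1:] x y = e0 * y ^ 4 + e1 * x * y ^ 3"
  "quartic [:e0, e1, e2:] x y = e0 * y ^ 4 + e1 * x * y ^ 3 + e2 * x ^ 2 * y ^ 2"
  "quartic [:e0, e1, e2, e3, e4:] x y =
     e0 * y ^ 4 + e1 * x * y ^ 3 + e2 * x ^ 2 * y ^ 2 + e3 * x ^ 3 * y + e4 * x ^ 4"
  by (simp_all add: quartic_expand eval_nat_numeral)

lemma quartic_deriv_pCons [simp]:
  "quartic_dx [:e0:] x y = 0" "quartic_dy [:e0:] x y = 4 * e0 * y ^ 3"
  "quartic_dx [:e0, e1:] x y = e1 * y ^ 3"
  "quartic_dy [:e0, e1:] x y = 4 * e0 * y ^ 3 + 3 * e1 * x * y ^ 2"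
  "quartic_dx [:e0, e1, e2:] x y = e1 * y ^ 3 + 2 * e2 * x * y ^ 2"
  "quartic_dy [:e0, e1, e2:] x y = 4 * e0 * y ^ 3 + 3 * e1 * x * y ^ 2 + 2 * e2 * x ^ 2 * y"
  "quartic_dx [:e0, e1, e2, e3, e4:] x y =
     e1 * y ^ 3 + 2 * e2 * x * y ^ 2 + 3 * e3 * x ^ 2 * y + 4 * e4 * x ^ 3"
  "quartic_dy [:e0, e1, e2, e3, e4:] x y =
     4 * e0 * y ^ 3 + 3 * e1 * x * y ^ 2 + 2 * e2 * x ^ 2 * y + e3 * x ^ 3"
  by (simp_all add: quartic_dx_def quartic_dy_def eval_nat_numeral)

lemma linear_in_two_points:
  fixes r s :: complex
  assumes "r \<noteq> s"
  obtains c d where "\<And>x y. e1 * x + e0 * y = c * (x - r * y) + d * (x - s * y)"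
proof
  fix x y
  define e where "e = 1 / (s - r)"
  have e: "e * (s - r) = 1" using assms by (simp add: e_def)
  show "e1 * x + e0 * y = (e1 * s + e0) * e * (x - r * y) + (- (e1 * r + e0) * e) * (x - s * y)"
    using e by algebra
qed

lemma quadratic_in_two_points:
  fixes r s :: complex
  assumes "r \<noteq> s"
  obtains c d e where "\<And>x y. e2 * x ^ 2 + e1 * x * y + e0 * y ^ 2 =
    c * (x - r * y) ^ 2 + d * (x - r * y) * (x - s * y) + e * (x - s * y) ^ 2"
proof
  fix x y
  define f where "f = 1 / (s - r)"
  have f: "f * (s - r) = 1" using assms by (simp add: f_def)
  show "e2 * x ^ 2 + e1 * x * y + e0 * y ^ 2 =
    (e2 * s ^ 2 + e1 * s + e0) * f ^ 2 * (x - r * y) ^ 2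
    + (- (2 * e2 * s * r + e1 * (s + r) + 2 * e0) * f ^ 2) * (x - r * y) * (x - s * y)
    + (e2 * r ^ 2 + e1 * r + e0) * f ^ 2 * (x - s * y) ^ 2"
    using f by algebra
qed

text \<open>
  The contact quartic at a third point \<open>t\<close> is a combination of those at \<open>r\<close> and \<open>s\<close>. With
  \<open>three_point_linear\<close> this expresses the contact condition at \<open>t\<close> in the coordinates given by \<open>r\<close> and
  \<open>s\<close>.
\<close>

lemma three_point_identity:
  "(t - r) * (s * A + B) - (t - s) * (r * A + B) = (s - r) * (t * A + B)" for A B r s t :: complex
  by algebra

lemma three_point_linear:
  "(r - s) * (x - t * y) = (t - s) * (x - r * y) - (t - r) * (x - s * y)" for r s t x y :: complex
  by algebra

lemma point_in_coordinates:
  fixes r s :: complex assumes "r \<noteq> s"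
  obtains x y where "x - r * y = u" "x - s * y = v"
proof
  define e where "e = 1 / (s - r)"
  have e: "e * (s - r) = 1" using assms by (simp add: e_def)
  show "(s * u - r * v) * e - r * ((u - v) * e) = u" "(s * u - r * v) * e - s * ((u - v) * e) = v"
    using e by algebra+
qed

text \<open>
  The form is \<open>\<beta> v\<^sup>4 du - \<alpha> u\<^sup>4 dv\<close>; rescaling by a cube root of \<open>\<alpha> / \<beta>\<close> makes the constants equal.
  The digits in the names of this lemma and its companions list the multiplicities of the critical
  points.
\<close>

lemma conjugate_33:
  assumes "r \<noteq> s" and r: "\<And>x y. r * quartic a x y + quartic b x y = \<alpha> * (x - r * y) ^ 4"
    and s: "\<And>x y. s * quartic a x y + quartic b x y = \<beta> * (x - s * y) ^ 4" and nz: "\<alpha> \<noteq> 0" "\<beta> \<noteq> 0"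
  shows "plane_conjugate (a, b) (models ! 0)"
proof -
  have "card {z. z ^ 3 = \<alpha> / \<beta>} = 3" using nz by (intro card_nth_roots) auto
  then have "{z. z ^ 3 = \<alpha> / \<beta>} \<noteq> {}" by (metis card.empty zero_neq_numeral)
  then obtain m where m: "m ^ 3 = \<alpha> / \<beta>" by blast
  have "m \<noteq> 0" using m nz by auto
  have "\<beta> * m ^ 3 = \<alpha>" using m nz by simp
  have "plane_transform (s * 1 / (s - r)) (- (r * m) / (s - r)) (1 / (s - r)) (- m / (s - r)) (\<alpha> * m / (s - r))
    a b [:1:] [:0, 0, 0, 0, -1:]"
  proof (rule two_point_transform)
    fix x y
    show "1 * (s * quartic a x y + quartic b x y) = \<alpha> * m * quartic [:1:] ((x - r * y) / 1) ((x - s * y) / m)"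
      unfolding s \<open>\<beta> * m ^ 3 = \<alpha>\<close>[symmetric] using \<open>m \<noteq> 0\<close>
      by (simp add: power_divide eval_nat_numeral)
    show "- m * (r * quartic a x y + quartic b x y) =
        \<alpha> * m * quartic [:0, 0, 0, 0, -1:] ((x - r * y) / 1) ((x - s * y) / m)"
      unfolding r by simp
  qed (use assms nz \<open>m \<noteq> 0\<close> in auto)
  then show ?thesis by (simp add: models_def plane_conjugateI)
qed

lemma quartic_zero:
  fixes d0 :: complex
  assumes "\<And>u v. d4 * u ^ 4 + d3 * u ^ 3 * v + d2 * u ^ 2 * v ^ 2 + d1 * u * v ^ 3 + d0 * v ^ 4 = 0"
  shows "d0 = 0" "d1 = 0" "d2 = 0" "d3 = 0" "d4 = 0"
proof -
  note a = assms[of 1 0] assms[of 0 1] assms[of 1 1] assms[of 1 "-1"] assms[of 2 1]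
  show "d4 = 0" "d0 = 0" using a by simp_all
  with a have "d3 + d2 + d1 = 0" "d2 - d3 - d1 = 0" "8 * d3 + 4 * d2 + 2 * d1 = 0"
    by (simp_all add: algebra_simps)
  then show "d1 = 0" "d2 = 0" "d3 = 0" by algebra+
qed

text \<open>
  With the third point at \<open>u = v\<close>, the form is \<open>v\<^sup>3 (p u + q v) du + u\<^sup>3 (c u + d v) dv\<close> and
  \<open>(u - v)\<^sup>3\<close> divides the sum of its coefficients, in which \<open>u\<^sup>2 v\<^sup>2\<close> does not occur. This
  determines the cofactor \<open>u + v\<close>, and with it \<open>p, q, c, d\<close>, up to a common factor.
\<close>

lemma conjugate_222:
  assumes neq: "r \<noteq> s" "t \<noteq> r" "t \<noteq> s"
    and r: "\<And>x y. r * quartic a x y + quartic b x y = (x - r * y) ^ 3 * (c * (x - r * y) + d * (x - s * y))"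
    and s: "\<And>x y. s * quartic a x y + quartic b x y = (x - s * y) ^ 3 * (p * (x - r * y) + q * (x - s * y))"
    and t: "\<And>x y. t * quartic a x y + quartic b x y = (x - t * y) ^ 3 * (f * (x - r * y) + g * (x - s * y))"
    and nz: "c \<noteq> 0 \<or> d \<noteq> 0"
  shows "plane_conjugate (a, b) (models ! 1)"
proof -
  \<comment> \<open>The scaling by \<open>k\<close> and \<open>m\<close> moves the third point to \<open>u = v\<close>.\<close>
  define k m e where "k = t - r" and "m = t - s" and "e = 1 / (r - s)"
  have km: "k \<noteq> 0" "m \<noteq> 0" using neq by (auto simp: k_def m_def)
  have e: "e * (r - s) = 1" using neq by (simp add: e_def)
  define F G where "F = - (k ^ 4 * m ^ 3 * f * e ^ 2)" and "G = - (k ^ 3 * m ^ 4 * g * e ^ 2)"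
  have id: "k * m ^ 3 * v ^ 3 * (p * k * u + q * m * v) - m * k ^ 3 * u ^ 3 * (c * k * u + d * m * v) =
      (u - v) ^ 3 * (F * u + G * v)" for u v
  proof -
    obtain x y where xy: "x - r * y = k * u" "x - s * y = m * v"
      using point_in_coordinates[OF neq(1)] by metis
    have "(r - s) * (x - t * y) = k * m * (u - v)"
      unfolding three_point_linear xy k_def[symmetric] m_def[symmetric] by algebra
    then have w: "x - t * y = e * k * m * (u - v)" using e by algebra
    have "k * (s * quartic a x y + quartic b x y) - m * (r * quartic a x y + quartic b x y) =
        (s - r) * (t * quartic a x y + quartic b x y)"
      unfolding k_def m_def by (rule three_point_identity)
    then have "k * ((m * v) ^ 3 * (p * (k * u) + q * (m * v))) - m * ((k * u) ^ 3 * (c * (k * u) + d * (m * v))) =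
        (s - r) * ((e * k * m * (u - v)) ^ 3 * (f * (k * u) + g * (m * v)))"
      unfolding r s t xy w .
    also have "\<dots> = (u - v) ^ 3 * (F * u + G * v)" unfolding F_def G_def using e by algebra
    finally show ?thesis by algebra
  qed
  have "(- (k ^ 4 * m * c) - F) * u ^ 4 + (- (k ^ 3 * m ^ 2 * d) + 3 * F - G) * u ^ 3 * v
      + (3 * G - 3 * F) * u ^ 2 * v ^ 2 + (k ^ 2 * m ^ 3 * p + F - 3 * G) * u * v ^ 3
      + (k * m ^ 4 * q + G) * v ^ 4 = 0" for u v
    using id[of v u] by algebra
  note coeffs = quartic_zero[OF this]
  have F: "G = F" "k ^ 4 * m * c = - F" "k ^ 3 * m ^ 2 * d = 2 * F" "k ^ 2 * m ^ 3 * p = 2 * F"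
    "k * m ^ 4 * q = - F"
    using coeffs by algebra+
  have "F \<noteq> 0" using F km nz by auto
  have "plane_transform (s * k / (s - r)) (- (r * m) / (s - r)) (k / (s - r)) (- m / (s - r)) (F / (s - r))
    a b [:-1, 2:] [:0, 0, 0, -2, 1:]"
  proof (rule two_point_transform)
    fix x y
    define u v where "u = (x - r * y) / k" and "v = (x - s * y) / m"
    have uv: "x - r * y = k * u" "x - s * y = m * v" using km by (simp_all add: u_def v_def)
    have "k * ((m * v) ^ 3 * (p * (k * u) + q * (m * v))) =
        k * m ^ 4 * q * v ^ 4 + k ^ 2 * m ^ 3 * p * u * v ^ 3" by algebra
    also have "\<dots> = F * (- 1 * v ^ 4 + 2 * u * v ^ 3)"
      unfolding F by (simp add: algebra_simps)
    finally have "k * ((m * v) ^ 3 * (p * (k * u) + q * (m * v))) = F * (- 1 * v ^ 4 + 2 * u * v ^ 3)" .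
    then show "k * (s * quartic a x y + quartic b x y) = F * quartic [:-1, 2:] ((x - r * y) / k) ((x - s * y) / m)"
      unfolding s uv by (simp add: km)
    have "- m * ((k * u) ^ 3 * (c * (k * u) + d * (m * v))) =
        - (k ^ 4 * m * c) * u ^ 4 - k ^ 3 * m ^ 2 * d * u ^ 3 * v" by algebra
    also have "\<dots> = F * (0 * v ^ 4 + 0 * u * v ^ 3 + 0 * u ^ 2 * v ^ 2 + - 2 * u ^ 3 * v + 1 * u ^ 4)"
      unfolding F by (simp add: algebra_simps)
    finally have "- m * ((k * u) ^ 3 * (c * (k * u) + d * (m * v))) =
        F * (0 * v ^ 4 + 0 * u * v ^ 3 + 0 * u ^ 2 * v ^ 2 + - 2 * u ^ 3 * v + 1 * u ^ 4)" .
    then show "- m * (r * quartic a x y + quartic b x y) =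
        F * quartic [:0, 0, 0, -2, 1:] ((x - r * y) / k) ((x - s * y) / m)"
      unfolding r uv by (simp add: km)
  qed (use neq km \<open>F \<noteq> 0\<close> in auto)
  then show ?thesis by (simp add: models_def plane_conjugateI)
qed

text \<open>
  Place the point of multiplicity 2 at \<open>u = 0\<close>, the point of multiplicity 1 at \<open>v = 0\<close> and the
  point of multiplicity 3 at \<open>u = - v\<close>. The difference of the coefficients of \<open>du\<close> and \<open>dv\<close> is then a
  multiple of \<open>(u + v)\<^sup>4\<close>, and the divisibility of the coefficients by \<open>v\<^sup>2\<close> and \<open>u\<^sup>3\<close> says which of its
  terms belongs to which coefficient.
\<close>

lemma conjugate_321:
  assumes neq: "r \<noteq> s" "t \<noteq> r" "t \<noteq> s"
    and r: "\<And>x y. r * quartic a x y + quartic b x y = (x - r * y) ^ 3 * (c * (x - r * y) + d * (x - s * y))"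
    and s: "\<And>x y. s * quartic a x y + quartic b x y =
        (x - s * y) ^ 2 * (l * (x - r * y) ^ 2 + m * (x - r * y) * (x - s * y) + n * (x - s * y) ^ 2)"
    and t: "\<And>x y. t * quartic a x y + quartic b x y = \<kappa> * (x - t * y) ^ 4"
    and nz: "\<kappa> \<noteq> 0"
  shows "plane_conjugate (a, b) (models ! 2)"
proof -
  \<comment> \<open>The scaling by \<open>k\<close> and \<open>j\<close> moves the third point to \<open>u = - v\<close>.\<close>
  define k j e where "k = t - r" and "j = - (t - s)" and "e = 1 / (r - s)"
  have kj: "k \<noteq> 0" "j \<noteq> 0" using neq by (auto simp: k_def j_def)
  have e: "e * (r - s) = 1" "e \<noteq> 0" using neq by (simp_all add: e_def)
  define K where "K = - (k ^ 4 * j ^ 4 * \<kappa> * e ^ 3)"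
  have "K \<noteq> 0" using kj e nz by (simp add: K_def)
  have id: "k * j ^ 2 * v ^ 2 * (l * k ^ 2 * u ^ 2 + m * k * j * u * v + n * j ^ 2 * v ^ 2)
      + j * k ^ 3 * u ^ 3 * (c * k * u + d * j * v) = K * (u + v) ^ 4" for u v
  proof -
    obtain x y where xy: "x - r * y = k * u" "x - s * y = j * v"
      using point_in_coordinates[OF neq(1)] by metis
    have "(r - s) * (x - t * y) = - (k * j * (u + v))"
      unfolding three_point_linear xy k_def[symmetric] using j_def by algebra
    then have w: "x - t * y = - (e * k * j * (u + v))" using e by algebra
    have "k * (s * quartic a x y + quartic b x y) + j * (r * quartic a x y + quartic b x y) =
        (s - r) * (t * quartic a x y + quartic b x y)"
      unfolding k_def j_def by (simp add: algebra_simps)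
    then have "k * ((j * v) ^ 2 * (l * (k * u) ^ 2 + m * (k * u) * (j * v) + n * (j * v) ^ 2))
        + j * ((k * u) ^ 3 * (c * (k * u) + d * (j * v))) =
        (s - r) * (\<kappa> * (- (e * k * j * (u + v))) ^ 4)"
      unfolding r s t xy w .
    also have "\<dots> = K * (u + v) ^ 4" unfolding K_def using e by algebra
    finally show ?thesis by algebra
  qed
  have "(k ^ 4 * j * c - K) * u ^ 4 + (k ^ 3 * j ^ 2 * d - 4 * K) * u ^ 3 * v
      + (k ^ 3 * j ^ 2 * l - 6 * K) * u ^ 2 * v ^ 2 + (k ^ 2 * j ^ 3 * m - 4 * K) * u * v ^ 3
      + (k * j ^ 4 * n - K) * v ^ 4 = 0" for u v
    using id[of v u] by algebra
  note coeffs = quartic_zero[OF this]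
  have K: "k ^ 4 * j * c = K" "k ^ 3 * j ^ 2 * d = 4 * K" "k ^ 3 * j ^ 2 * l = 6 * K"
    "k ^ 2 * j ^ 3 * m = 4 * K" "k * j ^ 4 * n = K"
    using coeffs by algebra+
  have "plane_transform (s * k / (s - r)) (- (r * j) / (s - r)) (k / (s - r)) (- j / (s - r)) (K / (s - r))
    a b [:1, 4, 6:] [:0, 0, 0, -4, -1:]"
  proof (rule two_point_transform)
    fix x y
    define u v where "u = (x - r * y) / k" and "v = (x - s * y) / j"
    have uv: "x - r * y = k * u" "x - s * y = j * v" using kj by (simp_all add: u_def v_def)
    have "k * ((j * v) ^ 2 * (l * (k * u) ^ 2 + m * (k * u) * (j * v) + n * (j * v) ^ 2)) =
        k * j ^ 4 * n * v ^ 4 + k ^ 2 * j ^ 3 * m * u * v ^ 3 + k ^ 3 * j ^ 2 * l * u ^ 2 * v ^ 2"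
      by algebra
    also have "\<dots> = K * (1 * v ^ 4 + 4 * u * v ^ 3 + 6 * u ^ 2 * v ^ 2)"
      unfolding K by (simp add: algebra_simps)
    finally have "k * ((j * v) ^ 2 * (l * (k * u) ^ 2 + m * (k * u) * (j * v) + n * (j * v) ^ 2)) =
        K * (1 * v ^ 4 + 4 * u * v ^ 3 + 6 * u ^ 2 * v ^ 2)" .
    then show "k * (s * quartic a x y + quartic b x y) = K * quartic [:1, 4, 6:] ((x - r * y) / k) ((x - s * y) / j)"
      unfolding s uv by (simp add: kj)
    have "- j * ((k * u) ^ 3 * (c * (k * u) + d * (j * v))) =
        - (k ^ 4 * j * c) * u ^ 4 - k ^ 3 * j ^ 2 * d * u ^ 3 * v" by algebra
    also have "\<dots> = K * (0 * v ^ 4 + 0 * u * v ^ 3 + 0 * u ^ 2 * v ^ 2 + - 4 * u ^ 3 * v + - 1 * u ^ 4)"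
      unfolding K by (simp add: algebra_simps)
    finally have "- j * ((k * u) ^ 3 * (c * (k * u) + d * (j * v))) =
        K * (0 * v ^ 4 + 0 * u * v ^ 3 + 0 * u ^ 2 * v ^ 2 + - 4 * u ^ 3 * v + - 1 * u ^ 4)" .
    then show "- j * (r * quartic a x y + quartic b x y) =
        K * quartic [:0, 0, 0, -4, -1:] ((x - r * y) / k) ((x - s * y) / j)"
      unfolding r uv by (simp add: kj)
  qed (use neq kj \<open>K \<noteq> 0\<close> in auto)
  then show ?thesis by (simp add: models_def plane_conjugateI)
qed

lemma two_root_quadratic:
  fixes z w :: complex
  assumes "z \<noteq> w" "c + b * z + a * z ^ 2 = 0" "c + b * w + a * w ^ 2 = 0"
  shows "b = - a * (z + w)" "c = a * z * w"
proof -
  have "(z - w) * (b + a * (z + w)) = 0" using assms(2,3) by algebra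
  then have "b + a * (z + w) = 0" using assms(1) by simp
  then show b: "b = - a * (z + w)" by algebra
  show "c = a * z * w" using assms(2) unfolding b by algebra
qed

text \<open>
  The values \<open>z, w\<close> of \<open>u / v\<close> at the two simple critical points are the two roots of each of the
  quadratics in the assumptions. Comparing the sum and the product of these roots expresses \<open>d, p, q\<close> by
  \<open>c\<close> and the scaling factor \<open>k\<close> that leads to the model.
\<close>

lemma critical_2211:
  fixes c d p q z w :: complex
  assumes "z \<noteq> w" "c \<noteq> 0"
    and p: "p = 3 * d * z + 4 * c * z ^ 2" "p = 3 * d * w + 4 * c * w ^ 2"
    and q: "4 * q + 3 * p * z = d * z ^ 2" "4 * q + 3 * p * w = d * w ^ 2"
  defines "k \<equiv> - (z + w) / 3"
  shows "d = 4 * c * k" "p = - 4 * c * k ^ 2" "q = - c * k ^ 3" "k ^ 2 = z * w"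
proof -
  have "3 * d = - (4 * c) * (z + w)" "- p = 4 * c * z * w"
    using two_root_quadratic[of z w "- p" "3 * d" "4 * c"] assms(1) p by (simp_all add: algebra_simps)
  then have d: "d = 4 * c * k" and p': "p = - 4 * c * z * w"
    by (simp_all add: k_def field_simps) (metis add.inverse_inverse)
  show "d = 4 * c * k" by (rule d)
  have q': "3 * p = d * (z + w)" "4 * q = - d * z * w"
    using two_root_quadratic[of z w "4 * q" "3 * p" "- d"] assms(1) q by (simp_all add: algebra_simps)
  have zw: "z + w = - 3 * k" by (simp add: k_def)
  have "12 * c * (k ^ 2 - z * w) = 0" using q'(1) unfolding d p' zw by algebra
  then show k: "k ^ 2 = z * w" using assms(2) by simp
  show "p = - 4 * c * k ^ 2" using p' k by algebra
  have "4 * q = 4 * (- c * k ^ 3)" using q'(2) d k by algebra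
  then show "q = - c * k ^ 3" by simp
qed

text \<open>
  The same comparison as in \<open>critical_2211\<close>. For the sum \<open>g\<close> and the product \<open>\<pi>\<close> of the roots it
  gives \<open>g\<^sup>2 = 3 \<pi>\<close>, so that \<open>g\<close> is nonzero and \<open>e = - 1 / g\<close> is the scaling factor that leads to
  the model.
\<close>

lemma critical_3111:
  fixes k l m n z w :: complex
  assumes "z \<noteq> w" "k \<noteq> 0" "z \<noteq> 0" "w \<noteq> 0"
    and 1: "m + 2 * l * z + 4 * k * z ^ 2 = 0" "m + 2 * l * w + 4 * k * w ^ 2 = 0"
    and 2: "4 * n + 3 * m * z + 2 * l * z ^ 2 = 0" "4 * n + 3 * m * w + 2 * l * w ^ 2 = 0"
  obtains e where "e \<noteq> 0" "3 * n * e ^ 3 = k" "3 * m * e ^ 2 = 4 * k" "l * e = 2 * k"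
proof -
  define g where "g = z + w"
  have m: "2 * l = - 4 * k * g" "m = 4 * k * z * w"
    using two_root_quadratic[OF assms(1) 1] by (simp_all add: g_def)
  have n: "3 * m = - 2 * l * g" "4 * n = 2 * l * z * w"
    using two_root_quadratic[OF assms(1) 2] by (simp_all add: g_def)
  have "4 * k * (g ^ 2 - 3 * z * w) = 0" using n(1) m by algebra
  then have g2: "g ^ 2 = 3 * z * w" using assms(2) by simp
  then have "g \<noteq> 0" using assms by auto
  define e where "e = - 1 / g"
  have e: "e * g = - 1" using \<open>g \<noteq> 0\<close> by (simp add: e_def)
  have zw: "3 * z * w * e ^ 2 = 1" using e g2 by algebra
  have l: "l * e = 2 * k" using m(1) e by algebra
  have "3 * m * e ^ 2 = 4 * k * (3 * z * w * e ^ 2)" using m(2) by algebra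
  then have m': "3 * m * e ^ 2 = 4 * k" by (simp add: zw)
  have "2 * (3 * n * e ^ 3) = (l * e) * (3 * z * w * e ^ 2)" using n(2) by algebra
  then have "3 * n * e ^ 3 = k" unfolding zw l by (simp add: mult.assoc)
  moreover have "e \<noteq> 0" using e by auto
  ultimately show ?thesis using that m' l by blast
qed

text \<open>
  The coordinates of \<open>two_point_transform\<close> without scaling; the point \<open>t\<close> has coordinates
  \<open>(t - r, t - s)\<close> in them.
\<close>

lemma two_point_critical:
  assumes "r \<noteq> s"
    and A: "\<And>x y. s * quartic a x y + quartic b x y = quartic a' (x - r * y) (x - s * y)"
    and B: "\<And>x y. - (r * quartic a x y + quartic b x y) = quartic b' (x - r * y) (x - s * y)"
  shows "plane_conjugate (a, b) (a', b')"
    "fixed_critical_point a b t 1 \<Longrightarrow> fixed_critical_point a' b' (t - r) (t - s)"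
proof -
  have tr: "plane_transform (s * 1 / (s - r)) (- (r * 1) / (s - r)) (1 / (s - r)) (- 1 / (s - r)) (1 / (s - r))
    a b a' b'"
    by (rule two_point_transform) (use assms in simp_all)
  then show "plane_conjugate (a, b) (a', b')" by (rule plane_conjugateI)
  assume "fixed_critical_point a b t 1"
  moreover have "s * 1 / (s - r) * (t - r) + - (r * 1) / (s - r) * (t - s) = t"
    "1 / (s - r) * (t - r) + - 1 / (s - r) * (t - s) = 1"
    using \<open>r \<noteq> s\<close> by (simp_all add: divide_simps) (simp_all add: algebra_simps)
  ultimately show "fixed_critical_point a' b' (t - r) (t - s)"
    by (intro fixed_critical_point_transform[OF tr]) simp
qed

lemma ratio_neq:
  fixes r s t w :: complex
  assumes "r \<noteq> s" "t \<noteq> w" "t \<noteq> s" "w \<noteq> s"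
  shows "(t - r) / (t - s) \<noteq> (w - r) / (w - s)"
proof
  assume "(t - r) / (t - s) = (w - r) / (w - s)"
  then have "(t - r) * (w - s) = (w - r) * (t - s)" using assms by (simp add: frac_eq_eq)
  then have "(t - w) * (r - s) = 0" by algebra
  then show False using assms by simp
qed

text \<open>
  With the double points at \<open>u = 0\<close> and \<open>v = 0\<close>, the conditions at the two simple points are those of
  \<open>critical_2211\<close>, and a scaling of \<open>u\<close> leads to the model.
\<close>

lemma conjugate_2211:
  assumes neq: "distinct [r, s, t, w]"
    and r: "\<And>x y. r * quartic a x y + quartic b x y = (x - r * y) ^ 3 * (c * (x - r * y) + d * (x - s * y))"
    and s: "\<And>x y. s * quartic a x y + quartic b x y = (x - s * y) ^ 3 * (p * (x - r * y) + q * (x - s * y))"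
    and crit: "fixed_critical_point a b t 1" "fixed_critical_point a b w 1"
    and nz: "c \<noteq> 0 \<or> d \<noteq> 0"
  shows "plane_conjugate (a, b) (models ! 3)"
proof -
  let ?a = "[:q, p:]" and ?b = "[:0, 0, 0, - d, - c:]"
  have A: "s * quartic a x y + quartic b x y = quartic ?a (x - r * y) (x - s * y)" for x y
    unfolding s quartic_pCons by algebra
  have B: "- (r * quartic a x y + quartic b x y) = quartic ?b (x - r * y) (x - s * y)" for x y
    unfolding r quartic_pCons by algebra
  have "r \<noteq> s" using neq by simp
  note tp = two_point_critical[OF this A B]
  have eqs: "p = 3 * d * ((e - r) / (e - s)) + 4 * c * ((e - r) / (e - s)) ^ 2 \<and>
      4 * q + 3 * p * ((e - r) / (e - s)) = d * ((e - r) / (e - s)) ^ 2"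
    if e: "fixed_critical_point a b e 1" "e \<noteq> r" "e \<noteq> s" for e
  proof -
    define u v z where "u = e - r" and "v = e - s" and "z = u / v"
    have nz: "u \<noteq> 0" "v \<noteq> 0" and uz: "u = z * v" using e by (auto simp: u_def v_def z_def)
    have "fixed_critical_point ?a ?b u v" unfolding u_def v_def by (rule tp(2)[OF e(1)])
    then have "u * (p * v ^ 3) + v * (3 * (- d) * u ^ 2 * v + 4 * (- c) * u ^ 3) = 0"
      "u * (4 * q * v ^ 3 + 3 * p * u * v ^ 2) + v * ((- d) * u ^ 3) = 0"
      by (simp_all add: fixed_critical_point_def)
    then have "u * v ^ 3 * (p - 3 * d * z - 4 * c * z ^ 2) = 0"
      "u * v ^ 3 * (4 * q + 3 * p * z - d * z ^ 2) = 0"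
      unfolding uz by algebra+
    then have "p - 3 * d * z - 4 * c * z ^ 2 = 0" "4 * q + 3 * p * z - d * z ^ 2 = 0"
      using nz by simp_all
    then show ?thesis unfolding u_def[symmetric] v_def[symmetric] z_def[symmetric]
      by (simp add: algebra_simps)
  qed
  have ts: "t \<noteq> r" "t \<noteq> s" "w \<noteq> r" "w \<noteq> s" using neq by auto
  define z z' where "z = (t - r) / (t - s)" and "z' = (w - r) / (w - s)"
  have "z \<noteq> z'" unfolding z_def z'_def using neq by (intro ratio_neq) auto
  have zz: "z \<noteq> 0" "z' \<noteq> 0" using neq by (auto simp: z_def z'_def)
  have pq: "p = 3 * d * z + 4 * c * z ^ 2" "p = 3 * d * z' + 4 * c * z' ^ 2"
     "4 * q + 3 * p * z = d * z ^ 2" "4 * q + 3 * p * z' = d * z' ^ 2"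
    using eqs[OF crit(1) ts(1,2)] eqs[OF crit(2) ts(3,4)] unfolding z_def z'_def by blast+
  have "c \<noteq> 0"
  proof
    assume "c = 0"
    then have "3 * d * (z - z') = 0" using pq(1,2) by algebra
    then show False using \<open>z \<noteq> z'\<close> \<open>c = 0\<close> nz by simp
  qed
  define k where "k = - (z + z') / 3"
  have k: "d = 4 * c * k" "p = - 4 * c * k ^ 2" "q = - c * k ^ 3" "k ^ 2 = z * z'"
    unfolding k_def by (rule critical_2211[OF \<open>z \<noteq> z'\<close> \<open>c \<noteq> 0\<close> pq])+
  have "k \<noteq> 0" using k(4) zz by auto
  have "plane_transform k 0 0 1 (- c * k ^ 4) ?a ?b [:1, 4:] [:0, 0, 0, 4, 1:]"
    unfolding plane_transform_def quartic_pCons k(1-3)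
  proof (intro conjI allI)
    show "k * 1 - 0 * 0 \<noteq> 0" "- c * k ^ 4 \<noteq> 0" using \<open>k \<noteq> 0\<close> \<open>c \<noteq> 0\<close> by simp_all
  qed algebra+
  then have "plane_conjugate (?a, ?b) (models ! 3)" by (simp add: models_def plane_conjugateI)
  with tp(1) show ?thesis by (rule plane_conjugate_trans)
qed

text \<open>
  With the triple point at \<open>u = 0\<close> and one of the simple points at \<open>v = 0\<close>, the conditions at the
  other two are those of \<open>critical_3111\<close>, and a scaling of \<open>v\<close> leads to the model.
\<close>

lemma conjugate_3111:
  assumes neq: "distinct [r, s, t, w]"
    and r: "\<And>x y. r * quartic a x y + quartic b x y = \<alpha> * (x - r * y) ^ 4"
    and s: "\<And>x y. s * quartic a x y + quartic b x y =
        (x - s * y) ^ 2 * (l * (x - r * y) ^ 2 + m * (x - r * y) * (x - s * y) + n * (x - s * y) ^ 2)"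
    and crit: "fixed_critical_point a b t 1" "fixed_critical_point a b w 1"
    and nz: "\<alpha> \<noteq> 0"
  shows "plane_conjugate (a, b) (models ! 4)"
proof -
  let ?a = "[:n, m, l:]" and ?b = "[:0, 0, 0, 0, - \<alpha>:]"
  have A: "s * quartic a x y + quartic b x y = quartic ?a (x - r * y) (x - s * y)" for x y
    unfolding s quartic_pCons by algebra
  have B: "- (r * quartic a x y + quartic b x y) = quartic ?b (x - r * y) (x - s * y)" for x y
    unfolding r quartic_pCons by algebra
  have "r \<noteq> s" using neq by simp
  note tp = two_point_critical[OF this A B]
  have eqs: "m + 2 * l * ((e - r) / (e - s)) + 4 * (- \<alpha>) * ((e - r) / (e - s)) ^ 2 = 0 \<and>
      4 * n + 3 * m * ((e - r) / (e - s)) + 2 * l * ((e - r) / (e - s)) ^ 2 = 0"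
    if e: "fixed_critical_point a b e 1" "e \<noteq> r" "e \<noteq> s" for e
  proof -
    define u v z where "u = e - r" and "v = e - s" and "z = u / v"
    have nz: "u \<noteq> 0" "v \<noteq> 0" and uz: "u = z * v" using e by (auto simp: u_def v_def z_def)
    have "fixed_critical_point ?a ?b u v" unfolding u_def v_def by (rule tp(2)[OF e(1)])
    then have "u * (m * v ^ 3 + 2 * l * u * v ^ 2) + v * (4 * (- \<alpha>) * u ^ 3) = 0"
      "u * (4 * n * v ^ 3 + 3 * m * u * v ^ 2 + 2 * l * u ^ 2 * v) = 0"
      unfolding fixed_critical_point_def quartic_deriv_pCons by algebra+
    then have "u * v ^ 3 * (m + 2 * l * z + 4 * (- \<alpha>) * z ^ 2) = 0"
      "u * v ^ 3 * (4 * n + 3 * m * z + 2 * l * z ^ 2) = 0"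
      unfolding uz by algebra+
    then show ?thesis unfolding u_def[symmetric] v_def[symmetric] z_def[symmetric]
      using nz by simp
  qed
  have ts: "t \<noteq> r" "t \<noteq> s" "w \<noteq> r" "w \<noteq> s" using neq by auto
  define z z' where "z = (t - r) / (t - s)" and "z' = (w - r) / (w - s)"
  have "z \<noteq> z'" unfolding z_def z'_def using neq by (intro ratio_neq) auto
  have zz: "z \<noteq> 0" "z' \<noteq> 0" using neq by (auto simp: z_def z'_def)
  have lmn: "m + 2 * l * z + 4 * (- \<alpha>) * z ^ 2 = 0" "m + 2 * l * z' + 4 * (- \<alpha>) * z' ^ 2 = 0"
     "4 * n + 3 * m * z + 2 * l * z ^ 2 = 0" "4 * n + 3 * m * z' + 2 * l * z' ^ 2 = 0"
    using eqs[OF crit(1) ts(1,2)] eqs[OF crit(2) ts(3,4)] unfolding z_def z'_def by blast+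
  have "- \<alpha> \<noteq> 0" using nz by simp
  obtain e where e: "e \<noteq> 0" "3 * n * e ^ 3 = - \<alpha>" "3 * m * e ^ 2 = 4 * (- \<alpha>)" "l * e = 2 * (- \<alpha>)"
    using critical_3111[OF \<open>z \<noteq> z'\<close> \<open>- \<alpha> \<noteq> 0\<close> zz lmn] by blast
  have "n \<noteq> 0" using e(2) nz by auto
  have me: "m * e ^ 2 = 4 * n * e ^ 3" "l * e = 6 * n * e ^ 3" "- \<alpha> = 3 * n * e ^ 3"
    using e(2-4) by algebra+
  have a: "quartic ?a x (e * y) = n * e ^ 4 * y ^ 4 + (m * e ^ 2) * e * x * y ^ 3 + (l * e) * e * x ^ 2 * y ^ 2" for x y
    unfolding quartic_pCons by algebra
  have "quartic ?a x (e * y) = n * e ^ 4 * quartic [:1, 4, 6:] x y" for x y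
    unfolding a me unfolding quartic_pCons by algebra
  moreover have "e * quartic ?b x (e * y) = n * e ^ 4 * quartic [:0, 0, 0, 0, 3:] x y" for x y
    unfolding me quartic_pCons by algebra
  ultimately have "plane_transform 1 0 0 e (n * e ^ 4) ?a ?b [:1, 4, 6:] [:0, 0, 0, 0, 3:]"
    using \<open>n \<noteq> 0\<close> \<open>e \<noteq> 0\<close> by (simp add: plane_transform_def del: quartic_pCons)
  then have "plane_conjugate (?a, ?b) (models ! 4)" by (simp add: models_def plane_conjugateI)
  with tp(1) show ?thesis by (rule plane_conjugate_trans)
qed

theorem plane_classification:
  assumes deg: "degree a \<le> 4" "degree b \<le> 4"
    and no_root: "\<And>r. poly a r \<noteq> 0 \<or> poly b r \<noteq> 0"
    and fixed: "\<And>r. poly (wronskian a b) r = 0 \<Longrightarrow> r * poly a r + poly b r = 0"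
    and lead: "coeff a 4 * coeff b 3 \<noteq> coeff a 3 * coeff b 4"
  obtains i where "i < 5" "plane_conjugate (a, b) (models ! i)"
proof -
  define W where "W = wronskian a b"
  have "degree W = 6" using lead unfolding W_def wronskian_expand[OF deg] by simp
  then have "W \<noteq> 0" by auto
  define R where "R = proots W"
  have size: "size R = 6" using \<open>degree W = 6\<close> by (simp add: R_def size_proots_complex)
  have root: "poly W r = 0" if "r \<in># R" for r using that \<open>W \<noteq> 0\<close> by (simp add: R_def)
  have degg: "degree (smult r a + b) \<le> 4" for r using deg by (intro degree_add_le) simp_all
  have contact: "[:-r, 1:] ^ Suc k dvd smult r a + b" if "count R r \<ge> k" "r \<in># R" for r k
  proof (rule contact_order)
    have "[:-r, 1:] ^ order r W dvd W" by (rule order_1)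
    then show "[:-r, 1:] ^ k dvd wronskian a b"
      using that \<open>W \<noteq> 0\<close> by (simp add: R_def W_def) (meson dvd_trans le_imp_power_dvd)
    show eq: "r * poly a r + poly b r = 0" using fixed root[OF that(2)] by (simp add: W_def)
    then show "poly a r \<noteq> 0" using no_root[of r] by auto
  qed
  have nz: "smult r a + b \<noteq> 0" for r
  proof
    assume "smult r a + b = 0"
    then have "wronskian a b = wronskian a 0" by (metis wronskian_contact)
    then show False using \<open>W \<noteq> 0\<close> by (simp add: W_def wronskian_def)
  qed
  have count: "count R r \<le> 3" for r
  proof (rule ccontr)
    assume "\<not> ?thesis"
    then have "count R r \<ge> 4" by simp
    then have "[:-r, 1:] ^ Suc 4 dvd smult r a + b"
      by (intro contact) (auto simp flip: count_greater_zero_iff)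
    then have "5 \<le> degree (smult r a + b)"
      using dvd_imp_degree_le[OF _ nz[of r]] degree_linear_power[of "- r" 5] by fastforce
    then show False using degg[of r] by simp
  qed
  have few: "card (set_mset R) \<le> 4"
  proof (rule ccontr)
    assume many: "\<not> ?thesis"
    have zero: "p = 0" if "degree p \<le> 4" "\<And>r. r \<in># R \<Longrightarrow> poly p r = 0" for p :: "complex poly"
    proof (rule ccontr)
      assume "p \<noteq> 0"
      have "card (set_mset R) \<le> card {r. poly p r = 0}"
        using that(2) by (intro card_mono poly_roots_finite[OF \<open>p \<noteq> 0\<close>]) auto
      also have "\<dots> \<le> degree p" by (rule card_poly_roots_bound[OF \<open>p \<noteq> 0\<close>])
      finally show False using many that(1) by simp
    qed
    \<comment> \<open>At a fixed critical point \<open>r\<close>, the polynomial \<open>r a + b\<close> has a double root, so \<open>u\<close> vanishes there; \<open>c\<close> vanishes at all fixed points.\<close>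
    define u c where "u = [:0, 1:] * pderiv a + pderiv b" and "c = [:0, 1:] * a + b"
    have "u = 0"
    proof (rule zero)
      have "degree (pderiv a) \<le> 3" "degree (pderiv b) \<le> 3" using deg by (simp_all add: degree_pderiv)
      then show "degree u \<le> 4" unfolding u_def
        by (intro degree_add_le) (auto intro: order_trans[OF degree_mult_le])
      fix r assume r: "r \<in># R"
      have "[:-r, 1:] ^ Suc 1 dvd smult r a + b" using r by (intro contact) (simp_all add: count_greater_eq_one_iff)
      then obtain h where "smult r a + b = [:-r, 1:] ^ Suc 1 * h" unfolding dvd_def by blast
      then have h: "smult r a + b = [:-r, 1:] * ([:-r, 1:] * h)"
        by (simp only: power_Suc power_0 mult.assoc One_nat_def mult_1)
      have "poly (pderiv (smult r a + b)) r = 0"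
        unfolding h by (simp_all only: pderiv_mult poly_mult poly_add) simp_all
      then show "poly u r = 0" by (simp add: u_def pderiv_add pderiv_smult)
    qed
    have u: "4 * coeff a 4 = 0" "3 * coeff a 3 + 4 * coeff b 4 = 0"
    proof -
      have "coeff u 4 = 4 * coeff a 4 + 5 * coeff b 5" "coeff u 3 = 3 * coeff a 3 + 4 * coeff b 4"
        by (simp_all add: u_def coeff_pderiv coeff_pCons eval_nat_numeral split: nat.split)
      then show "4 * coeff a 4 = 0" "3 * coeff a 3 + 4 * coeff b 4 = 0"
        using \<open>u = 0\<close> deg(2) by (simp_all add: coeff_eq_0)
    qed
    have "c = 0"
    proof (rule zero)
      have "degree a \<le> 3"
      proof (rule degree_le, intro allI impI)
        fix i :: nat assume "3 < i"
        then have "i = 4 \<or> 4 < i" by linarith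
        then show "coeff a i = 0" using u(1) deg(1) by (auto simp: coeff_eq_0)
      qed
      then show "degree c \<le> 4" unfolding c_def
        using deg(2) by (intro degree_add_le) (auto intro: order_trans[OF degree_mult_le])
      fix r assume "r \<in># R"
      then show "poly c r = 0" using fixed root by (simp add: c_def W_def)
    qed
    then have "coeff c 4 = 0" by simp
    then have "coeff a 3 + coeff b 4 = 0" by (simp add: c_def coeff_pCons eval_nat_numeral split: nat.splits)
    then have "coeff b 4 = 0" using u(2) by algebra
    then show False using lead u(1) by simp
  qed
  have quartic_g: "quartic (smult r a + b) x y = r * quartic a x y + quartic b x y" for r x y
    using quartic_add_smult[of r a 1 b x y] by simp
  have g4: "\<exists>e. (\<forall>x y. r * quartic a x y + quartic b x y = e * (x - r * y) ^ 4) \<and> e \<noteq> 0"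
    if "count R r \<ge> 3" for r
  proof -
    have "[:-r, 1:] ^ Suc 3 dvd smult r a + b"
      using that by (intro contact) (auto simp flip: count_greater_zero_iff)
    then obtain e where e: "\<And>x y. quartic (smult r a + b) x y = e * (x - r * y) ^ 4"
      using quartic_contact_4[of r, OF _ degg] by auto
    have "e \<noteq> 0"
    proof
      assume "e = 0"
      then have "poly (smult r a + b) t = 0" for t using e[of t 1] quartic_1[OF degg, of r t] by simp
      then show False using nz[of r] poly_all_0_iff_0 by blast
    qed
    then show ?thesis using e by (auto simp: quartic_g)
  qed
  have g3: "\<exists>c d. (\<forall>x y. r * quartic a x y + quartic b x y =
      (x - r * y) ^ 3 * (c * (x - u * y) + d * (x - v * y))) \<and> (c \<noteq> 0 \<or> d \<noteq> 0)"
    if "count R r \<ge> 2" and uv: "u \<noteq> v" for r u v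
  proof -
    have "[:-r, 1:] ^ Suc 2 dvd smult r a + b"
      using that by (intro contact) (auto simp flip: count_greater_zero_iff)
    then have "[:-r, 1:] ^ 3 dvd smult r a + b" by (simp only: eval_nat_numeral)
    then obtain e0 e1 where e: "\<And>x y. quartic (smult r a + b) x y = (x - r * y) ^ 3 * (e1 * x + e0 * y)"
      using quartic_contact_3[of r, OF _ degg] by metis
    obtain c d where cd: "\<And>x y. e1 * x + e0 * y = c * (x - u * y) + d * (x - v * y)"
      using linear_in_two_points[OF uv] by metis
    have "c \<noteq> 0 \<or> d \<noteq> 0"
    proof (rule ccontr)
      assume "\<not> ?thesis"
      then have "poly (smult r a + b) t = 0" for t using e[of t 1] cd[of t 1] quartic_1[OF degg, of r t] by simp
      then show False using nz[of r] poly_all_0_iff_0 by blast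
    qed
    then show ?thesis using e cd by (auto simp: quartic_g)
  qed
  have g2: "\<exists>l m n. \<forall>x y. r * quartic a x y + quartic b x y =
      (x - r * y) ^ 2 * (l * (x - u * y) ^ 2 + m * (x - u * y) * (x - r * y) + n * (x - r * y) ^ 2)"
    if "count R r \<ge> 1" and ur: "u \<noteq> r" for r u
  proof -
    have "[:-r, 1:] ^ Suc 1 dvd smult r a + b"
      using that by (intro contact) (auto simp flip: count_greater_zero_iff)
    then have "[:-r, 1:] ^ 2 dvd smult r a + b" by (simp only: Suc_1)
    then obtain e0 e1 e2 where e: "\<And>x y. quartic (smult r a + b) x y =
        (x - r * y) ^ 2 * (e2 * x ^ 2 + e1 * x * y + e0 * y ^ 2)"
      using quartic_contact_2[of r, OF _ degg] by metis
    obtain l m n where "\<And>x y. e2 * x ^ 2 + e1 * x * y + e0 * y ^ 2 =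
        l * (x - u * y) ^ 2 + m * (x - u * y) * (x - r * y) + n * (x - r * y) ^ 2"
      using quadratic_in_two_points[OF ur] by metis
    then show ?thesis using e by (auto simp: quartic_g)
  qed
  have crit: "fixed_critical_point a b r 1" if "count R r \<ge> 1" for r
  proof (rule fixed_critical_point_contact[OF _ deg])
    have "[:-r, 1:] ^ Suc 1 dvd smult r a + b"
      using that by (intro contact) (auto simp flip: count_greater_zero_iff)
    then show "[:-r, 1:] ^ 2 dvd smult r a + b" by (simp only: Suc_1)
  qed
  show ?thesis
  proof (rule multiset_size_6_types[OF size count few])
    fix r s assume *: "r \<noteq> s" "count R r \<ge> 3" "count R s \<ge> 3"
    obtain \<alpha> \<beta> where "\<forall>x y. r * quartic a x y + quartic b x y = \<alpha> * (x - r * y) ^ 4" "\<alpha> \<noteq> 0"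
      "\<forall>x y. s * quartic a x y + quartic b x y = \<beta> * (x - s * y) ^ 4" "\<beta> \<noteq> 0"
      using g4[OF *(2)] g4[OF *(3)] by blast
    then have "plane_conjugate (a, b) (models ! 0)" using conjugate_33[OF *(1)] by blast
    then show ?thesis by (intro that[of 0]) simp_all
  next
    fix r s t assume *: "distinct [r, s, t]" "count R r \<ge> 2" "count R s \<ge> 2" "count R t \<ge> 2"
    then have rs: "r \<noteq> s" "t \<noteq> r" "t \<noteq> s" by auto
    obtain c d p q f g where "\<forall>x y. r * quartic a x y + quartic b x y =
        (x - r * y) ^ 3 * (c * (x - r * y) + d * (x - s * y))" "c \<noteq> 0 \<or> d \<noteq> 0"
      "\<forall>x y. s * quartic a x y + quartic b x y =
        (x - s * y) ^ 3 * (p * (x - r * y) + q * (x - s * y))"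
      "\<forall>x y. t * quartic a x y + quartic b x y =
        (x - t * y) ^ 3 * (f * (x - r * y) + g * (x - s * y))"
      using g3[OF *(2) rs(1)] g3[OF *(3) rs(1)] g3[OF *(4) rs(1)] by blast
    then have "plane_conjugate (a, b) (models ! 1)" using conjugate_222[OF rs] by blast
    then show ?thesis by (intro that[of 1]) simp_all
  next
    fix t r s assume *: "distinct [t, r, s]" "count R t \<ge> 3" "count R r \<ge> 2" "count R s \<ge> 1"
    then have rs: "r \<noteq> s" "t \<noteq> r" "t \<noteq> s" by auto
    obtain c d l m n \<kappa> where "\<forall>x y. r * quartic a x y + quartic b x y =
        (x - r * y) ^ 3 * (c * (x - r * y) + d * (x - s * y))"
      "\<forall>x y. s * quartic a x y + quartic b x y =
        (x - s * y) ^ 2 * (l * (x - r * y) ^ 2 + m * (x - r * y) * (x - s * y) + n * (x - s * y) ^ 2)"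
      "\<forall>x y. t * quartic a x y + quartic b x y = \<kappa> * (x - t * y) ^ 4" "\<kappa> \<noteq> 0"
      using g3[OF *(3) rs(1)] g2[OF *(4) rs(1)] g4[OF *(2)] by blast
    then have "plane_conjugate (a, b) (models ! 2)" using conjugate_321[OF rs] by blast
    then show ?thesis by (intro that[of 2]) simp_all
  next
    fix r s t w assume *: "distinct [r, s, t, w]" "count R r \<ge> 2" "count R s \<ge> 2"
      "count R t \<ge> 1" "count R w \<ge> 1"
    then have rs: "r \<noteq> s" by auto
    obtain c d p q where "\<forall>x y. r * quartic a x y + quartic b x y =
        (x - r * y) ^ 3 * (c * (x - r * y) + d * (x - s * y))" "c \<noteq> 0 \<or> d \<noteq> 0"
      "\<forall>x y. s * quartic a x y + quartic b x y =
        (x - s * y) ^ 3 * (p * (x - r * y) + q * (x - s * y))"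
      using g3[OF *(2) rs] g3[OF *(3) rs] by blast
    then have "plane_conjugate (a, b) (models ! 3)"
      using conjugate_2211[OF *(1) _ _ crit[OF *(4)] crit[OF *(5)]] by blast
    then show ?thesis by (intro that[of 3]) simp_all
  next
    fix r s t w assume *: "distinct [r, s, t, w]" "count R r \<ge> 3" "count R s \<ge> 1"
      "count R t \<ge> 1" "count R w \<ge> 1"
    then have rs: "r \<noteq> s" by auto
    obtain \<alpha> l m n where "\<forall>x y. r * quartic a x y + quartic b x y = \<alpha> * (x - r * y) ^ 4" "\<alpha> \<noteq> 0"
      "\<forall>x y. s * quartic a x y + quartic b x y =
        (x - s * y) ^ 2 * (l * (x - r * y) ^ 2 + m * (x - r * y) * (x - s * y) + n * (x - s * y) ^ 2)"
      using g4[OF *(2)] g2[OF *(3) rs] by blast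
    then have "plane_conjugate (a, b) (models ! 4)"
      using conjugate_3111[OF *(1) _ _ crit[OF *(4)] crit[OF *(5)]] by blast
    then show ?thesis by (intro that[of 4]) simp_all
  qed
qed

section \<open>The foliations of the models\<close>

lemma eval3_pCons_0: "eval3 [:q:] v = poly (map_poly (\<lambda>r. poly r (v $ 1)) q) (v $ 2)"
  by (simp add: eval3_def subst3_def map_poly_pCons id_def)

lemma degree_binary_form: "degree (binary_form m a) = 0"
proof -
  have "degree (const3 (a i) * vars3 $ 1 ^ i * vars3 $ 2 ^ (m - i)) \<le> 0" for i
  proof -
    have "degree (const3 (a i) * vars3 $ 1 ^ i * vars3 $ 2 ^ (m - i)) \<le>
        degree (const3 (a i)) + degree (vars3 $ 1 :: poly3) * i + degree (vars3 $ 2 :: poly3) * (m - i)"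
      by (intro order_trans[OF degree_mult_le] add_mono degree_power_le) simp
    then show ?thesis by (simp add: const3_def vars3_nth)
  qed
  then have "degree (binary_form m a) \<le> 0" unfolding binary_form_def by (intro degree_sum_le) auto
  then show ?thesis by simp
qed

lemma homogeneous_poly_binary_form: "homogeneous_poly m (binary_form m a)"
  unfolding binary_form_def
proof (rule homogeneous_poly_sum)
  fix i assume "i \<in> {..m}"
  have "homogeneous_poly (0 + i * 1 + (m - i) * 1) (const3 (a i) * vars3 $ 1 ^ i * vars3 $ 2 ^ (m - i))"
    by (intro homogeneous_poly_mult homogeneous_poly_const3 homogeneous_poly_power homogeneous_poly_vars3)
  then show "homogeneous_poly m (const3 (a i) * vars3 $ 1 ^ i * vars3 $ 2 ^ (m - i))"
    using \<open>i \<in> {..m}\<close> by simp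
qed

lemma no_root_imp_const:
  fixes p :: "complex poly"
  assumes "\<And>z. poly p z \<noteq> 0"
  shows "degree p = 0"
  using fundamental_theorem_of_algebra[of p] assms constant_degree by blast

text \<open>
  For fixed \<open>x \<noteq> 0\<close> the polynomial has no zero in \<open>y\<close>, so it does not depend on \<open>y\<close> by the
  fundamental theorem of algebra; the same theorem for \<open>y = 1\<close> shows that it does not depend on \<open>x\<close>.
\<close>

lemma is_unit_if_zeros_at_origin:
  assumes "degree q = 0" and nz: "\<And>v. eval3 q v = 0 \<Longrightarrow> v $ 1 = 0 \<and> v $ 2 = 0"
  shows "is_unit q"
proof -
  obtain q0 where q: "q = [:q0:]" using assms(1) by (rule degree_eq_zeroE)
  have nz: "poly (map_poly (\<lambda>r. poly r x) q0) y \<noteq> 0" if "x \<noteq> 0 \<or> y \<noteq> 0" for x y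
    using nz[of "vector [x, y, 0]"] that by (auto simp: q eval3_pCons_0)
  have "coeff q0 j = 0" if "j > 0" for j
  proof -
    have "poly (coeff q0 j) x = 0" if "x \<noteq> 0" for x
    proof -
      have "degree (map_poly (\<lambda>r. poly r x) q0) = 0" using nz that by (intro no_root_imp_const) blast
      then have "coeff (map_poly (\<lambda>r. poly r x) q0) j = 0" using \<open>j > 0\<close> by (intro coeff_eq_0) simp
      then show ?thesis by (simp add: coeff_map_poly)
    qed
    then have "poly ([:0, 1:] * coeff q0 j) x = 0" for x by (cases "x = 0") simp_all
    then have "[:0, 1:] * coeff q0 j = 0" using poly_all_0_iff_0 by blast
    then show ?thesis by simp
  qed
  then have "degree q0 = 0" using leading_coeff_neq_0[of q0] by (metis degree_0 neq0_conv)
  then obtain q1 where q1: "q0 = [:q1:]" by (rule degree_eq_zeroE)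
  have "poly q1 x \<noteq> 0" for x using nz[of x 1] by (simp add: q1 map_poly_pCons)
  then have "degree q1 = 0" by (rule no_root_imp_const)
  then obtain c where "q1 = [:c:]" by (rule degree_eq_zeroE)
  moreover have "c \<noteq> 0" using \<open>\<And>x. poly q1 x \<noteq> 0\<close> calculation by auto
  ultimately show ?thesis by (auto simp: q q1 is_unit_const_poly_iff dvd_field_iff)
qed

text \<open>
  A common factor divides \<open>x A + y B\<close> and hence does not involve \<open>z\<close>; at \<open>z = 1\<close> its zeros are common
  zeros of \<open>A\<close> and \<open>B\<close>.
\<close>

lemma foliation_form_homogeneous_form:
  assumes no_zero: "\<And>x y. quartic a x y = 0 \<Longrightarrow> quartic b x y = 0 \<Longrightarrow> x = 0 \<and> y = 0"
    and "x * quartic a x y + y * quartic b x y \<noteq> 0"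
  shows "foliation_form 4 (homogeneous_form a b)"
proof -
  let ?A = "binary_form 4 (coeff a)" and ?B = "binary_form 4 (coeff b)" and ?\<omega> = "homogeneous_form a b"
  have hom: "homogeneous_poly 5 (vars3 $ i * binary_form 4 c)" for i c
    using homogeneous_poly_mult[OF homogeneous_poly_vars3 homogeneous_poly_binary_form[of 4 c]] by simp
  have "homogeneous_poly 5 (?\<omega> $ i)" for i
    using exhaust_3[of i] hom
    by (auto simp: homogeneous_form_def Let_def intro!: homogeneous_poly_minus homogeneous_poly_add
        simp del: minus_add_distrib)
  moreover have "is_unit q" if q: "\<forall>i. q dvd ?\<omega> $ i" for q
  proof (rule is_unit_if_zeros_at_origin)
    have "?\<omega> $ 3 \<noteq> 0"
    proof
      assume "?\<omega> $ 3 = 0"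
      then have "eval3 (?\<omega> $ 3) (vector [x, y, 0]) = 0" by simp
      then have "- (x * quartic a x y + y * quartic b x y) = 0" by simp
      then show False using assms(2) unfolding neg_equal_0_iff_equal by contradiction
    qed
    moreover have "degree (?\<omega> $ 3) = 0"
    proof -
      have "degree (vars3 $ i * binary_form 4 c) \<le> 0" if "i \<noteq> 3" for i c
      proof -
        have "degree (vars3 $ i :: poly3) = 0" using that exhaust_3[of i] by (auto simp: vars3_nth)
        then show ?thesis using degree_mult_le[of "vars3 $ i :: poly3" "binary_form 4 c"]
          by (simp add: degree_binary_form)
      qed
      then have "degree (vars3 $ 1 * ?A + vars3 $ 2 * ?B) \<le> 0" by (intro degree_add_le) simp_all
      then show ?thesis by (simp add: homogeneous_form_def Let_def del: minus_add_distrib)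
    qed
    ultimately show "degree q = 0" using dvd_imp_degree_le[OF q[rule_format, of 3]] by simp
    fix v assume v: "eval3 q v = 0"
    obtain q0 where "q = [:q0:]" using \<open>degree q = 0\<close> by (rule degree_eq_zeroE)
    then have "eval3 q (vector [v $ 1, v $ 2, 1]) = 0" using v by (simp add: eval3_pCons_0)
    moreover have "eval3 q w = 0 \<Longrightarrow> eval3 (?\<omega> $ i) w = 0" for w i
      using q[rule_format, of i] by (elim dvdE) simp
    ultimately have "eval3 (?\<omega> $ i) (vector [v $ 1, v $ 2, 1]) = 0" for i by blast
    from this[of 1] this[of 2] have "quartic a (v $ 1) (v $ 2) = 0" "quartic b (v $ 1) (v $ 2) = 0"
      by simp_all
    then show "v $ 1 = 0 \<and> v $ 2 = 0" by (rule no_zero)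
  qed
  moreover have "form_at ?\<omega> v v = 0" for v
    by (simp add: form_at_homogeneous_form)
  ultimately show ?thesis by (simp add: foliation_form_def form_euler_iff)
qed

definition foliation_of :: "form \<Rightarrow> foliation" where
  "foliation_of \<omega> = {const3 c *s \<omega> | c. c \<noteq> 0}"

lemma homogeneous_poly_scale:
  assumes "homogeneous_poly n p"
  shows "eval3 p (t *s v) = t ^ n * eval3 p v"
proof -
  obtain c where p: "p = (\<Sum>k\<le>n. vars3 $ 3 ^ k * binary_form (n - k) (c k))"
    using homogeneous_poly_expansion[OF assms] .
  have "eval3 (binary_form m f) (t *s v) = t ^ m * eval3 (binary_form m f) v" for m f
    by (simp only: eval3_binary_form vector_smult_component eval3_binary_form_scale)
  then have "eval3 p (t *s v) =
      (\<Sum>k\<le>n. (t * v $ 3) ^ k * (t ^ (n - k) * eval3 (binary_form (n - k) (c k)) v))"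
    by (simp add: p)
  also have "\<dots> = (\<Sum>k\<le>n. t ^ n * (v $ 3 ^ k * eval3 (binary_form (n - k) (c k)) v))"
  proof (rule sum.cong)
    fix k assume "k \<in> {..n}"
    then have "t ^ n = t ^ k * t ^ (n - k)" by (simp flip: power_add)
    then show "(t * v $ 3) ^ k * (t ^ (n - k) * eval3 (binary_form (n - k) (c k)) v) =
        t ^ n * (v $ 3 ^ k * eval3 (binary_form (n - k) (c k)) v)"
      by (simp add: power_mult_distrib)
  qed simp
  also have "\<dots> = t ^ n * eval3 p v" by (simp add: p sum_distrib_left)
  finally show ?thesis .
qed

text \<open>
  Two homogeneous polynomials that agree on the chart agree up to powers of \<open>z\<close>. Euler's relation
  extends this from the first two coefficients to the third.
\<close>

lemma foliation_form_eq_chart_aux: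
  assumes \<omega>: "foliation_form m \<omega>" and \<eta>: "foliation_form n \<eta>"
    and chart: "chart_restriction \<omega> = chart_restriction \<eta>"
  shows "vars3 $ 3 ^ Suc n * \<omega> $ i = vars3 $ 3 ^ Suc m * \<eta> $ i"
proof -
  have eq1: "eval3 p w = eval3 q w" if "poly p 1 = poly q 1" "w $ 3 = 1" for p q w
  proof -
    have "poly (p - q) 1 = 0" using that by simp
    then obtain r where "p - q = [:-1, 1:] * r" unfolding poly_eq_0_iff_dvd by (rule dvdE)
    also have "[:-1, 1:] = vars3 $ 3 - 1" by (simp add: vars3_nth one_pCons)
    finally have "eval3 (p - q) w = 0" using that by simp
    then show ?thesis by simp
  qed
  have 12: "vars3 $ 3 ^ Suc n * \<omega> $ i = vars3 $ 3 ^ Suc m * \<eta> $ i" if i: "i \<noteq> 3" for i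
  proof (rule eval3_eqI)
    fix v :: "complex ^ 3"
    show "eval3 (vars3 $ 3 ^ Suc n * \<omega> $ i) v = eval3 (vars3 $ 3 ^ Suc m * \<eta> $ i) v"
    proof (cases "v $ 3 = 0")
      case False
      define w where "w = (1 / v $ 3) *s v"
      have v: "v = v $ 3 *s w" and w: "w $ 3 = 1" using False by (simp_all add: w_def vec_eq_iff)
      have "poly (\<omega> $ i) 1 = poly (\<eta> $ i) 1"
        using chart exhaust_3[of i] i by (auto simp: chart_restriction_def)
      then have "eval3 (\<omega> $ i) w = eval3 (\<eta> $ i) w" using w by (rule eq1)
      moreover have "eval3 (\<omega> $ i) v = v $ 3 ^ Suc m * eval3 (\<omega> $ i) w"
        using \<omega> homogeneous_poly_scale[of "Suc m" "\<omega> $ i" "v $ 3" w] v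
        by (simp add: foliation_form_def)
      moreover have "eval3 (\<eta> $ i) v = v $ 3 ^ Suc n * eval3 (\<eta> $ i) w"
        using \<eta> homogeneous_poly_scale[of "Suc n" "\<eta> $ i" "v $ 3" w] v
        by (simp add: foliation_form_def)
      ultimately show ?thesis by simp
    qed simp
  qed
  show ?thesis
  proof (cases "i = 3")
    case True
    have "vars3 $ 1 * \<omega> $ 1 + vars3 $ 2 * \<omega> $ 2 + vars3 $ 3 * \<omega> $ 3 = 0"
      "vars3 $ 1 * \<eta> $ 1 + vars3 $ 2 * \<eta> $ 2 + vars3 $ 3 * \<eta> $ 3 = 0"
      using \<omega> \<eta> by (simp_all add: foliation_form_def sum_3)
    moreover define P Q :: poly3 where "P = vars3 $ 3 ^ Suc n" and "Q = vars3 $ 3 ^ Suc m"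
    have "P * \<omega> $ 1 = Q * \<eta> $ 1" "P * \<omega> $ 2 = Q * \<eta> $ 2"
      unfolding P_def Q_def using 12[of 1] 12[of 2] by auto
    ultimately have "vars3 $ 3 * (P * \<omega> $ 3 - Q * \<eta> $ 3) = 0" by algebra
    moreover have "vars3 $ 3 \<noteq> 0" by (simp add: vars3_nth)
    ultimately show ?thesis unfolding True P_def Q_def by (metis mult_eq_0_iff eq_iff_diff_eq_0)
  qed (rule 12)
qed

text \<open>
  Otherwise \<open>z\<close> would divide all coefficients of \<open>\<eta>\<close>.
\<close>

lemma foliation_form_eq_chart_le:
  assumes \<omega>: "foliation_form m \<omega>" and \<eta>: "foliation_form n \<eta>"
    and chart: "chart_restriction \<omega> = chart_restriction \<eta>" and "m \<le> n"
  shows "\<omega> = \<eta>"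
proof -
  have z: "vars3 $ 3 \<noteq> 0" by (simp add: vars3_nth)
  have eq: "vars3 $ 3 ^ (n - m) * \<omega> $ i = \<eta> $ i" for i
  proof -
    have "vars3 $ 3 ^ Suc n = vars3 $ 3 ^ Suc m * vars3 $ 3 ^ (n - m)"
      using \<open>m \<le> n\<close> by (simp flip: power_add)
    then have "vars3 $ 3 ^ Suc m * (vars3 $ 3 ^ (n - m) * \<omega> $ i) = vars3 $ 3 ^ Suc m * \<eta> $ i"
      using foliation_form_eq_chart_aux[OF \<omega> \<eta> chart, of i] by (simp only: mult.assoc)
    moreover have "vars3 $ 3 ^ Suc m \<noteq> 0" using z by (rule power_not_zero)
    ultimately show ?thesis by (metis mult_left_cancel)
  qed
  have "n = m"
  proof (rule ccontr)
    assume "n \<noteq> m"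
    then have "n - m \<noteq> 0" using \<open>m \<le> n\<close> by simp
    then have "vars3 $ 3 dvd vars3 $ 3 ^ (n - m)" by (simp add: dvd_power)
    then have "\<forall>i. vars3 $ 3 dvd \<eta> $ i" using eq by (metis dvd_mult2)
    then show False using \<eta> not_is_unit_vars3 unfolding foliation_form_def by blast
  qed
  then show ?thesis using eq by (simp add: vec_eq_iff)
qed

lemma foliation_form_eq_chart:
  assumes "foliation_form m \<omega>" "foliation_form n \<eta>" "chart_restriction \<omega> = chart_restriction \<eta>"
  shows "\<omega> = \<eta>"
  using foliation_form_eq_chart_le[OF assms] foliation_form_eq_chart_le[OF assms(2,1) assms(3)[symmetric]]
  by (metis linear)

lemma chart_restriction_scale:
  "chart_restriction (const3 c *s \<omega>) =
    ([:[:c:]:] * fst (chart_restriction \<omega>), [:[:c:]:] * snd (chart_restriction \<omega>))"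
  by (simp add: chart_restriction_def const3_def)

text \<open>
  By \<open>foliation_form_eq_chart\<close> the restriction to the chart determines the form and its degree.
\<close>

lemma affine_foliation_eq:
  assumes "foliation_form 4 \<omega>"
  shows "affine_foliation (chart_restriction \<omega>) = foliation_of \<omega>"
proof (intro subset_antisym subsetI)
  fix \<eta> assume "\<eta> \<in> affine_foliation (chart_restriction \<omega>)"
  then obtain d c where "foliation_form d \<eta>" "c \<noteq> 0"
    "chart_restriction \<eta> = chart_restriction (const3 c *s \<omega>)"
    unfolding affine_foliation_def chart_restriction_scale by blast
  then have "\<eta> = const3 c *s \<omega>"
    using foliation_form_eq_chart[OF _ foliation_form_scale[OF assms]] by blast
  then show "\<eta> \<in> foliation_of \<omega>" using \<open>c \<noteq> 0\<close> by (auto simp: foliation_of_def)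
next
  fix \<eta> assume "\<eta> \<in> foliation_of \<omega>"
  then obtain c where "\<eta> = const3 c *s \<omega>" "c \<noteq> 0" by (auto simp: foliation_of_def)
  then show "\<eta> \<in> affine_foliation (chart_restriction \<omega>)"
    using foliation_form_scale[OF assms] unfolding affine_foliation_def
    by (auto simp: chart_restriction_scale)
qed

lemma chart_restriction_homogeneous_form:
  "chart_restriction (homogeneous_form a b) =
    (\<Sum>i\<le>4. [:[:coeff a i:]:] * X ^ i * Y ^ (4 - i), \<Sum>i\<le>4. [:[:coeff b i:]:] * X ^ i * Y ^ (4 - i))"
  by (simp add: chart_restriction_def homogeneous_form_def Let_def binary_form_def poly_sum
      const3_def vars3_nth X_def Y_def)

definition model_foliation :: "complex poly \<times> complex poly \<Rightarrow> foliation" where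
  "model_foliation ab = foliation_of (homogeneous_form (fst ab) (snd ab))"

lemma quartic_models:
  "quartic (fst (models ! 0)) x y = y ^ 4" "quartic (snd (models ! 0)) x y = - (x ^ 4)"
  "quartic (fst (models ! 1)) x y = y ^ 3 * (2 * x - y)"
  "quartic (snd (models ! 1)) x y = x ^ 3 * (x - 2 * y)"
  "quartic (fst (models ! 2)) x y = y ^ 2 * (6 * x ^ 2 + 4 * x * y + y ^ 2)"
  "quartic (snd (models ! 2)) x y = - (x ^ 3 * (x + 4 * y))"
  "quartic (fst (models ! 3)) x y = y ^ 3 * (4 * x + y)"
  "quartic (snd (models ! 3)) x y = x ^ 3 * (x + 4 * y)"
  "quartic (fst (models ! 4)) x y = y ^ 2 * (6 * x ^ 2 + 4 * x * y + y ^ 2)"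
  "quartic (snd (models ! 4)) x y = 3 * x ^ 4"
  by (simp_all add: models_def) (simp_all add: algebra_simps eval_nat_numeral)

lemma quartic_models_no_zero:
  assumes "i < 5" "quartic (fst (models ! i)) x y = 0" "quartic (snd (models ! i)) x y = 0"
  shows "x = 0 \<and> y = 0"
proof -
  have Q: "x = 0 \<and> y = 0" if "y = 0 \<or> 6 * x ^ 2 + 4 * x * y + y ^ 2 = 0" "x = 0 \<or> x + 4 * y = 0"
  proof (cases "x = 0")
    case True
    then show ?thesis using that(1) by simp
  next
    case False
    then have x: "x = - 4 * y" using that(2) by (simp add: eq_neg_iff_add_eq_0)
    have "6 * x ^ 2 + 4 * x * y + y ^ 2 = 81 * y ^ 2" unfolding x by (simp add: power2_eq_square)
    then show ?thesis using that(1) x by auto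
  qed
  have L: "x = 0 \<and> y = 0" if "y = 0 \<or> y = p * x" "x = 0 \<or> x = q * y" "p * q \<noteq> 1" for p q :: complex
  proof (cases "x = 0 \<or> y = 0")
    case False
    then have x: "x = q * y" and y: "y = p * x" using that(1,2) by simp_all
    have "(p * q - 1) * x = 0" using x y by algebra
    then show ?thesis using that(3) False by simp
  qed (use that in auto)
  consider "i = 0" | "i = 1" | "i = 2" | "i = 3" | "i = 4" using assms by linarith
  then show ?thesis
  proof cases
    case 1
    show ?thesis using assms(2,3) unfolding 1 quartic_models by simp
  next
    case 2
    have "y = 0 \<or> y = 2 * x" "x = 0 \<or> x = 2 * y"
      using assms(2,3) unfolding 2 quartic_models by auto
    then show ?thesis by (rule L) simp
  next
    case 3
    have "y = 0 \<or> 6 * x ^ 2 + 4 * x * y + y ^ 2 = 0" "x = 0 \<or> x + 4 * y = 0"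
      using assms(2,3) unfolding 3 quartic_models by simp_all
    then show ?thesis by (rule Q)
  next
    case 4
    have "y = 0 \<or> y = - 4 * x" "x = 0 \<or> x = - 4 * y"
      using assms(2,3) unfolding 4 quartic_models by (auto simp: eq_neg_iff_add_eq_0 add.commute)
    then show ?thesis by (rule L) simp
  next
    case 5
    have "y = 0 \<or> 6 * x ^ 2 + 4 * x * y + y ^ 2 = 0" "x = 0"
      using assms(2,3) unfolding 5 quartic_models by simp_all
    then show ?thesis by (intro Q) simp_all
  qed
qed

lemma foliation_form_model:
  assumes "i < 5"
  shows "foliation_form 4 (homogeneous_form (fst (models ! i)) (snd (models ! i)))"
proof (rule foliation_form_homogeneous_form[where x = 1 and y = 2])
  have "i = 0 \<or> i = 1 \<or> i = 2 \<or> i = 3 \<or> i = 4" using assms by linarith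
  then show "1 * quartic (fst (models ! i)) 1 2 + 2 * quartic (snd (models ! i)) 1 2 \<noteq> 0"
    by (elim disjE; simp only: quartic_models; simp)
qed (use quartic_models_no_zero[OF assms] in blast)

lemma chart_restriction_models:
  "chart_restriction (homogeneous_form (fst (models ! 0)) (snd (models ! 0))) = (Y ^ 4, - (X ^ 4))"
  "chart_restriction (homogeneous_form (fst (models ! 1)) (snd (models ! 1))) =
    (Y ^ 3 * (2 * X - Y), X ^ 3 * (X - 2 * Y))"
  "chart_restriction (homogeneous_form (fst (models ! 2)) (snd (models ! 2))) =
    (Y ^ 2 * (6 * X ^ 2 + 4 * X * Y + Y ^ 2), - (X ^ 3 * (X + 4 * Y)))"
  "chart_restriction (homogeneous_form (fst (models ! 3)) (snd (models ! 3))) =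
    (Y ^ 3 * (4 * X + Y), X ^ 3 * (X + 4 * Y))"
  "chart_restriction (homogeneous_form (fst (models ! 4)) (snd (models ! 4))) =
    (Y ^ 2 * (6 * X ^ 2 + 4 * X * Y + Y ^ 2), 3 * X ^ 4)"
proof -
  define K :: "complex \<Rightarrow> poly2" where "K = (\<lambda>c. [:[:c:]:])"
  have K: "K 0 = 0" "K 1 = 1" "K (numeral n) = numeral n" "K (- c) = - K c" for n c
    by (simp_all add: K_def numeral_poly one_pCons)
  have *: "chart_restriction (homogeneous_form a b) =
    (K (coeff a 0) * Y ^ 4 + K (coeff a 1) * X * Y ^ 3 + K (coeff a 2) * X ^ 2 * Y ^ 2
       + K (coeff a 3) * X ^ 3 * Y + K (coeff a 4) * X ^ 4,
     K (coeff b 0) * Y ^ 4 + K (coeff b 1) * X * Y ^ 3 + K (coeff b 2) * X ^ 2 * Y ^ 2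
       + K (coeff b 3) * X ^ 3 * Y + K (coeff b 4) * X ^ 4)" for a b
  proof -
    have "(\<Sum>i\<le>4. f i) = f 0 + f 1 + f 2 + f 3 + f (4 :: nat)" for f :: "nat \<Rightarrow> poly2"
      by (simp add: eval_nat_numeral)
    then show ?thesis unfolding chart_restriction_homogeneous_form K_def by simp
  qed
  have c: "coeff [:e0, e1:] 2 = 0" "coeff [:e0, e1:] 3 = 0" "coeff [:e0, e1:] 4 = 0"
    "coeff [:e0, e1, e2:] 2 = e2" "coeff [:e0, e1, e2:] 3 = 0" "coeff [:e0, e1, e2:] 4 = 0"
    "coeff [:e0, e1, e2, e3, e4:] 2 = e2" "coeff [:e0, e1, e2, e3, e4:] 3 = e3"
    "coeff [:e0, e1, e2, e3, e4:] 4 = e4" "coeff [:e0:] 2 = 0" "coeff [:e0:] 3 = 0" "coeff [:e0:] 4 = 0"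
    for e0 e1 e2 e3 e4 :: complex
    by (simp_all add: eval_nat_numeral)
  note m = models_nth
  show "chart_restriction (homogeneous_form (fst (models ! 0)) (snd (models ! 0))) = (Y ^ 4, - (X ^ 4))"
    unfolding * m fst_conv snd_conv c by (simp add: K)
  show "chart_restriction (homogeneous_form (fst (models ! 1)) (snd (models ! 1))) =
    (Y ^ 3 * (2 * X - Y), X ^ 3 * (X - 2 * Y))"
    unfolding * m fst_conv snd_conv c by (simp add: K) algebra
  show "chart_restriction (homogeneous_form (fst (models ! 2)) (snd (models ! 2))) =
    (Y ^ 2 * (6 * X ^ 2 + 4 * X * Y + Y ^ 2), - (X ^ 3 * (X + 4 * Y)))"
    unfolding * m fst_conv snd_conv c by (simp add: K) algebra
  show "chart_restriction (homogeneous_form (fst (models ! 3)) (snd (models ! 3))) =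
    (Y ^ 3 * (4 * X + Y), X ^ 3 * (X + 4 * Y))"
    unfolding * m fst_conv snd_conv c by (simp add: K) algebra
  show "chart_restriction (homogeneous_form (fst (models ! 4)) (snd (models ! 4))) =
    (Y ^ 2 * (6 * X ^ 2 + 4 * X * Y + Y ^ 2), 3 * X ^ 4)"
    unfolding * m fst_conv snd_conv c by (simp add: K) algebra
qed

lemma model_foliation_eq:
  "model_foliation (models ! 0) = \<H>1" "model_foliation (models ! 1) = \<H>2"
  "model_foliation (models ! 2) = \<H>3" "model_foliation (models ! 3) = \<H>4"
  "model_foliation (models ! 4) = \<H>5"
  unfolding \<H>1_def \<H>2_def \<H>3_def \<H>4_def \<H>5_def chart_restriction_models[symmetric] model_foliation_def
  by (rule affine_foliation_eq[OF foliation_form_model, symmetric], simp)+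

lemma homogeneous_foliation_model:
  assumes "foliation_form 4 (homogeneous_form a b)"
  shows "homogeneous_foliation 4 (foliation_of (homogeneous_form a b))"
  unfolding homogeneous_foliation_def
proof (intro conjI exI[of _ "mat 1"] allI impI)
  show "is_foliation 4 (foliation_of (homogeneous_form a b))"
    using assms by (auto simp: is_foliation_def foliation_of_def)
  show "invertible (mat 1 :: complex ^ 3 ^ 3)" by (simp add: invertible_def exI[of _ "mat 1"])
  fix t :: complex assume t: "t \<noteq> 0"
  let ?\<omega> = "homogeneous_form a b"
  have "pullback (homothety t) ` foliation_of ?\<omega> = foliation_of ?\<omega>"
  proof (intro subset_antisym subsetI)
    fix \<eta> assume "\<eta> \<in> pullback (homothety t) ` foliation_of ?\<omega>"
    then obtain c where "c \<noteq> 0" "\<eta> = const3 c *s (const3 (t ^ 5) *s ?\<omega>)"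
      by (auto simp: foliation_of_def pullback_scale pullback_homothety_homogeneous_form)
    then have "\<eta> = const3 (c * t ^ 5) *s ?\<omega>" "c * t ^ 5 \<noteq> 0" using t by (simp_all add: const3_mult)
    then show "\<eta> \<in> foliation_of ?\<omega>" unfolding foliation_of_def by blast
  next
    fix \<eta> assume "\<eta> \<in> foliation_of ?\<omega>"
    then obtain c where c: "c \<noteq> 0" "\<eta> = const3 c *s ?\<omega>" by (auto simp: foliation_of_def)
    then have "\<eta> = pullback (homothety t) (const3 (c / t ^ 5) *s ?\<omega>)"
      using t by (simp add: pullback_scale pullback_homothety_homogeneous_form const3_mult)
    moreover have "const3 (c / t ^ 5) *s ?\<omega> \<in> foliation_of ?\<omega>"
      using c t unfolding foliation_of_def by force
    ultimately show "\<eta> \<in> pullback (homothety t) ` foliation_of ?\<omega>" by blast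
  qed
  moreover have "pullback (mat 1) ` S = S" for S by (simp add: image_def)
  ultimately show "pullback (homothety t) ` pullback (mat 1) ` foliation_of ?\<omega> =
      pullback (mat 1) ` foliation_of ?\<omega>" by simp
qed

section \<open>Convexity of the models\<close>

text \<open>
  Two vectors on the line have proportional components \<open>x, y\<close>, so the form is a multiple of
  \<open>p A(p, q) + q B(p, q)\<close> on them.
\<close>

lemma invariant_line_homogeneous_form:
  assumes "p \<noteq> 0 \<or> q \<noteq> 0" "p * quartic a p q + q * quartic b p q = 0"
  shows "invariant_line (homogeneous_form a b) (vector [q, - p, 0])"
  unfolding invariant_line_def
proof (intro conjI allI impI)
  show "vector [q, - p, 0] \<noteq> (0 :: complex ^ 3)"
    using assms(1) by (auto simp: vec_eq_iff forall_3)
  have mult: "\<exists>s. v $ 1 = s * p \<and> v $ 2 = s * q"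
    if "(\<Sum>i\<in>UNIV. (vector [q, - p, 0] :: complex ^ 3) $ i * v $ i) = 0" for v
  proof -
    have eq: "q * v $ 1 = p * v $ 2" using that by (simp add: sum_3)
    show ?thesis
    proof (cases "p = 0")
      case True
      then show ?thesis using assms(1) eq by (intro exI[of _ "v $ 2 / q"]) simp
    next
      case False
      then show ?thesis using eq by (intro exI[of _ "v $ 1 / p"]) (simp add: field_simps)
    qed
  qed
  fix v w :: "complex ^ 3"
  assume "(\<Sum>i\<in>UNIV. (vector [q, - p, 0] :: complex ^ 3) $ i * v $ i) = 0"
    "(\<Sum>i\<in>UNIV. (vector [q, - p, 0] :: complex ^ 3) $ i * w $ i) = 0"
  then obtain s t where v: "v $ 1 = s * p" "v $ 2 = s * q" and w: "w $ 1 = t * p" "w $ 2 = t * q"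
    using mult by metis
  show "form_at (homogeneous_form a b) v w = 0"
    unfolding form_at_homogeneous_form v w quartic_scale using assms(2) by algebra
qed

lemma invariant_line_at_infinity: "invariant_line (homogeneous_form a b) (vector [0, 0, 1])"
  by (auto simp: invariant_line_def form_at_homogeneous_form sum_3 vec_eq_iff forall_3)

text \<open>
  The list \<open>ps\<close> enumerates the zeros of \<open>x A + y B\<close> and of the Jacobian with multiplicity; the
  remaining factor \<open>z\<close> of the inflection polynomial is the line at infinity.
\<close>

lemma convex_foliation_model:
  assumes fol: "foliation_form 4 (homogeneous_form a b)" and "c \<noteq> 0"
    and ps: "\<forall>(p, q)\<in>set ps. (p \<noteq> 0 \<or> q \<noteq> 0) \<and> p * quartic a p q + q * quartic b p q = 0"
    and prod: "\<And>x y. (x * quartic a x y + y * quartic b x y) * jacobian a b x y =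
      c * (\<Prod>(p, q)\<leftarrow>ps. q * x - p * y)"
  shows "convex_foliation 4 (foliation_of (homogeneous_form a b))"
  unfolding convex_foliation_def
proof (intro conjI bexI exI)
  let ?ls = "vector [0, 0, 1] # map (\<lambda>(p, q). vector [q, - p, 0]) ps"
  show "is_foliation 4 (foliation_of (homogeneous_form a b))"
    using fol by (auto simp: is_foliation_def foliation_of_def)
  show "homogeneous_form a b \<in> foliation_of (homogeneous_form a b)"
    unfolding foliation_of_def by (rule CollectI, rule exI[of _ 1]) (simp add: const3_1)
  show "homogeneous_form a b = contract_radial (homogeneous_field a b)"
    by (rule contract_radial_homogeneous_field[symmetric])
  show "\<forall>i. homogeneous_poly 4 (homogeneous_field a b $ i)"
    by (simp add: forall_3 homogeneous_poly_minus homogeneous_poly_binary_form)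
  show "c / 4 \<noteq> 0" using \<open>c \<noteq> 0\<close> by simp
  show "\<forall>l\<in>set ?ls. invariant_line (homogeneous_form a b) l"
    using ps invariant_line_at_infinity by (auto intro!: invariant_line_homogeneous_form)
  show "inflection_poly (homogeneous_field a b) = const3 (c / 4) * prod_list (map linear_poly ?ls)"
  proof (rule eval3_eqI)
    fix v
    have "eval3 (prod_list (map linear_poly ?ls)) v = v $ 3 * (\<Prod>(p, q)\<leftarrow>ps. q * v $ 1 - p * v $ 2)"
      by (simp add: sum_3 comp_def case_prod_unfold)
    then have "4 * eval3 (const3 (c / 4) * prod_list (map linear_poly ?ls)) v =
        v $ 3 * (c * (\<Prod>(p, q)\<leftarrow>ps. q * v $ 1 - p * v $ 2))" by simp
    also have "\<dots> = 4 * eval3 (inflection_poly (homogeneous_field a b)) v"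
      unfolding prod[symmetric] inflection_homogeneous_field by (simp add: mult.assoc)
    finally show "eval3 (inflection_poly (homogeneous_field a b)) v =
        eval3 (const3 (c / 4) * prod_list (map linear_poly ?ls)) v" by simp
  qed
qed

lemma quadratic_root: "\<exists>z :: complex. z ^ 2 + b * z + c = 0"
proof
  define h where "h = b / 2"
  have "csqrt (h ^ 2 - c) ^ 2 = h ^ 2 - c" by simp
  then have "(csqrt (h ^ 2 - c) - h) ^ 2 + (2 * h) * (csqrt (h ^ 2 - c) - h) + c = 0" by algebra
  then show "(csqrt (h ^ 2 - c) - h) ^ 2 + b * (csqrt (h ^ 2 - c) - h) + c = 0" by (simp add: h_def)
qed

lemma jacobian_models:
  "jacobian (fst (models ! 0)) (snd (models ! 0)) x y = 16 * x ^ 3 * y ^ 3"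
  "jacobian (fst (models ! 1)) (snd (models ! 1)) x y = - 24 * x ^ 2 * y ^ 2 * (x - y) ^ 2"
  "jacobian (fst (models ! 2)) (snd (models ! 2)) x y = 48 * x ^ 2 * y * (x + y) ^ 3"
  "jacobian (fst (models ! 3)) (snd (models ! 3)) x y = - 48 * x ^ 2 * y ^ 2 * (x ^ 2 + 3 * x * y + y ^ 2)"
  "jacobian (fst (models ! 4)) (snd (models ! 4)) x y = - 48 * x ^ 3 * y * (3 * x ^ 2 + 3 * x * y + y ^ 2)"
  unfolding models_def jacobian_def by (simp_all add: algebra_simps eval_nat_numeral)

text \<open>
  In each case \<open>z\<close> is a root of a quadratic whose two roots are the fixed points other than \<open>[0 : 1]\<close>,
  \<open>[1 : 0]\<close> and \<open>[1 : 1]\<close> or \<open>[- 1 : 1]\<close>. The entries of the list count a fixed point once for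
  \<open>x A + y B\<close>, and then as often as its multiplicity as a zero of the Jacobian.
\<close>

lemma convex_foliation_models:
  assumes "i < 5"
  shows "convex_foliation 4 (model_foliation (models ! i))"
proof -
  note convex = convex_foliation_model[OF foliation_form_model, folded model_foliation_def]
  consider "i = 0" | "i = 1" | "i = 2" | "i = 3" | "i = 4" using assms by linarith
  then show ?thesis
  proof cases
    case 1
    obtain z :: complex where z: "z ^ 2 + 1 * z + 1 = 0" using quadratic_root by blast
    let ?ps = "[(0, 1), (0, 1), (0, 1), (0, 1), (1, 0), (1, 0), (1, 0), (1, 0), (1, 1), (z, 1), (- 1 - z, 1)]"
    show ?thesis unfolding 1
    proof (rule convex[where c = "(- 16)" and ps = ?ps])
      fix x y
      have roots: "(1 * x - z * y) * (1 * x - (- 1 - z) * y) = x ^ 2 + x * y + y ^ 2" using z by algebra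
      have tail: "(1 * x - z * y) * ((1 * x - (- 1 - z) * y) * 1) = x ^ 2 + x * y + y ^ 2"
        unfolding roots[symmetric] by (simp only: mult_1_right mult.assoc)
      show "(x * quartic (fst (models ! 0)) x y + y * quartic (snd (models ! 0)) x y) *
          jacobian (fst (models ! 0)) (snd (models ! 0)) x y =
          (- 16) * (\<Prod>(p, q)\<leftarrow>?ps. q * x - p * y)"
        unfolding quartic_models jacobian_models list.map prod_list.Cons case_prod_conv prod_list.Nil tail
        by algebra
    next
      have 1: "z * (1 ^ 4) + 1 * (- (z ^ 4)) = 0"
        using z by (simp only: power_one mult_1_left mult_1_right) algebra
      have 2: "(- 1 - z) * (1 ^ 4) + 1 * (- ((- 1 - z) ^ 4)) = 0"
        using z by (simp only: power_one mult_1_left mult_1_right) algebra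
      show "\<forall>(p, q)\<in>set ?ps. (p \<noteq> 0 \<or> q \<noteq> 0) \<and>
          p * quartic (fst (models ! 0)) p q + q * quartic (snd (models ! 0)) p q = 0"
        unfolding quartic_models using 1 2 by simp
    qed simp_all
  next
    case 2
    obtain z :: complex where z: "z ^ 2 + (- 1) * z + 1 = 0" using quadratic_root by blast
    let ?ps = "[(0, 1), (0, 1), (0, 1), (1, 0), (1, 0), (1, 0), (1, 1), (1, 1), (1, 1), (z, 1), (1 - z, 1)]"
    show ?thesis unfolding 2
    proof (rule convex[where c = "24" and ps = ?ps])
      fix x y
      have roots: "(1 * x - z * y) * (1 * x - (1 - z) * y) = x ^ 2 - x * y + y ^ 2" using z by algebra
      have tail: "(1 * x - z * y) * ((1 * x - (1 - z) * y) * 1) = x ^ 2 - x * y + y ^ 2"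
        unfolding roots[symmetric] by (simp only: mult_1_right mult.assoc)
      show "(x * quartic (fst (models ! 1)) x y + y * quartic (snd (models ! 1)) x y) *
          jacobian (fst (models ! 1)) (snd (models ! 1)) x y =
          24 * (\<Prod>(p, q)\<leftarrow>?ps. q * x - p * y)"
        unfolding quartic_models jacobian_models list.map prod_list.Cons case_prod_conv prod_list.Nil tail
        by algebra
    next
      have 1: "z * (1 ^ 3 * (2 * z - 1)) + 1 * (z ^ 3 * (z - 2 * 1)) = 0"
        using z by (simp only: power_one mult_1_left mult_1_right) algebra
      have 2: "(1 - z) * (1 ^ 3 * (2 * (1 - z) - 1)) + 1 * ((1 - z) ^ 3 * ((1 - z) - 2 * 1)) = 0"
        using z by (simp only: power_one mult_1_left mult_1_right) algebra
      show "\<forall>(p, q)\<in>set ?ps. (p \<noteq> 0 \<or> q \<noteq> 0) \<and>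
          p * quartic (fst (models ! 1)) p q + q * quartic (snd (models ! 1)) p q = 0"
        unfolding quartic_models using 1 2 by simp
    qed simp_all
  next
    case 3
    obtain z :: complex where z: "z ^ 2 + (- 3) * z + (- 1) = 0" using quadratic_root by blast
    let ?ps = "[(0, 1), (0, 1), (0, 1), (1, 0), (1, 0), (- 1, 1), (- 1, 1), (- 1, 1), (- 1, 1), (z, 1), (3 - z, 1)]"
    show ?thesis unfolding 3
    proof (rule convex[where c = "(- 48)" and ps = ?ps])
      fix x y
      have roots: "(1 * x - z * y) * (1 * x - (3 - z) * y) = x ^ 2 - 3 * x * y - y ^ 2" using z by algebra
      have tail: "(1 * x - z * y) * ((1 * x - (3 - z) * y) * 1) = x ^ 2 - 3 * x * y - y ^ 2"
        unfolding roots[symmetric] by (simp only: mult_1_right mult.assoc)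
      show "(x * quartic (fst (models ! 2)) x y + y * quartic (snd (models ! 2)) x y) *
          jacobian (fst (models ! 2)) (snd (models ! 2)) x y =
          (- 48) * (\<Prod>(p, q)\<leftarrow>?ps. q * x - p * y)"
        unfolding quartic_models jacobian_models list.map prod_list.Cons case_prod_conv prod_list.Nil tail
        by algebra
    next
      have 1: "z * (1 ^ 2 * (6 * z ^ 2 + 4 * z * 1 + 1 ^ 2)) + 1 * (- (z ^ 3 * (z + 4 * 1))) = 0"
        using z by (simp only: power_one mult_1_left mult_1_right) algebra
      have 2: "(3 - z) * (1 ^ 2 * (6 * (3 - z) ^ 2 + 4 * (3 - z) * 1 + 1 ^ 2)) + 1 * (- ((3 - z) ^ 3 * ((3 - z) + 4 * 1))) = 0"
        using z by (simp only: power_one mult_1_left mult_1_right) algebra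
      show "\<forall>(p, q)\<in>set ?ps. (p \<noteq> 0 \<or> q \<noteq> 0) \<and>
          p * quartic (fst (models ! 2)) p q + q * quartic (snd (models ! 2)) p q = 0"
        unfolding quartic_models using 1 2 by simp
    qed simp_all
  next
    case 4
    obtain z :: complex where z: "z ^ 2 + 3 * z + 1 = 0" using quadratic_root by blast
    let ?ps = "[(0, 1), (0, 1), (0, 1), (1, 0), (1, 0), (1, 0), (- 1, 1), (z, 1), (- 3 - z, 1), (z, 1), (- 3 - z, 1)]"
    show ?thesis unfolding 4
    proof (rule convex[where c = "48" and ps = ?ps])
      fix x y
      have roots: "(1 * x - z * y) * (1 * x - (- 3 - z) * y) = x ^ 2 + 3 * x * y + y ^ 2" using z by algebra
      have tail: "(1 * x - z * y) * ((1 * x - (- 3 - z) * y) * ((1 * x - z * y) * ((1 * x - (- 3 - z) * y) * 1))) = (x ^ 2 + 3 * x * y + y ^ 2) * (x ^ 2 + 3 * x * y + y ^ 2)"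
        unfolding roots[symmetric] by (simp only: mult_1_right mult.assoc)
      show "(x * quartic (fst (models ! 3)) x y + y * quartic (snd (models ! 3)) x y) *
          jacobian (fst (models ! 3)) (snd (models ! 3)) x y =
          48 * (\<Prod>(p, q)\<leftarrow>?ps. q * x - p * y)"
        unfolding quartic_models jacobian_models list.map prod_list.Cons case_prod_conv prod_list.Nil tail
        by algebra
    next
      have 1: "z * (1 ^ 3 * (4 * z + 1)) + 1 * (z ^ 3 * (z + 4 * 1)) = 0"
        using z by (simp only: power_one mult_1_left mult_1_right) algebra
      have 2: "(- 3 - z) * (1 ^ 3 * (4 * (- 3 - z) + 1)) + 1 * ((- 3 - z) ^ 3 * ((- 3 - z) + 4 * 1)) = 0"
        using z by (simp only: power_one mult_1_left mult_1_right) algebra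
      show "\<forall>(p, q)\<in>set ?ps. (p \<noteq> 0 \<or> q \<noteq> 0) \<and>
          p * quartic (fst (models ! 3)) p q + q * quartic (snd (models ! 3)) p q = 0"
        unfolding quartic_models using 1 2 by simp
    qed simp_all
  next
    case 5
    obtain z :: complex where "z ^ 2 + 1 * z + 1 / 3 = 0" using quadratic_root by blast
    then have z: "3 * z ^ 2 + 3 * z + 1 = 0" by algebra
    let ?ps = "[(0, 1), (0, 1), (0, 1), (0, 1), (1, 0), (1, 0), (- 1, 1), (z, 1), (- 1 - z, 1), (z, 1), (- 1 - z, 1)]"
    show ?thesis unfolding 5
    proof (rule convex[where c = "(- 432)" and ps = ?ps])
      fix x y :: complex
      define w where "w = x ^ 2 + x * y + y ^ 2 / 3"
      have w: "3 * x ^ 2 + 3 * x * y + y ^ 2 = 3 * w" by (simp add: w_def algebra_simps)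
      have f: "x * (y ^ 2 * (6 * x ^ 2 + 4 * x * y + y ^ 2)) + y * (3 * x ^ 4) = x * y * (x + y) * (3 * w)"
        unfolding w[symmetric] by algebra
      have roots: "(1 * x - z * y) * (1 * x - (- 1 - z) * y) = w" using z w by algebra
      have tail: "(1 * x - z * y) * ((1 * x - (- 1 - z) * y) * ((1 * x - z * y) * ((1 * x - (- 1 - z) * y) * 1))) = w * w"
        unfolding roots[symmetric] by (simp only: mult_1_right mult.assoc)
      show "(x * quartic (fst (models ! 4)) x y + y * quartic (snd (models ! 4)) x y) *
          jacobian (fst (models ! 4)) (snd (models ! 4)) x y =
          (- 432) * (\<Prod>(p, q)\<leftarrow>?ps. q * x - p * y)"
        unfolding quartic_models jacobian_models list.map prod_list.Cons case_prod_conv prod_list.Nil tail w f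
        by algebra
    next
      have 1: "z * (1 ^ 2 * (6 * z ^ 2 + 4 * z * 1 + 1 ^ 2)) + 1 * (3 * z ^ 4) = 0"
        using z by (simp only: power_one mult_1_left mult_1_right) algebra
      have 2: "(- 1 - z) * (1 ^ 2 * (6 * (- 1 - z) ^ 2 + 4 * (- 1 - z) * 1 + 1 ^ 2)) + 1 * (3 * (- 1 - z) ^ 4) = 0"
        using z by (simp only: power_one mult_1_left mult_1_right) algebra
      show "\<forall>(p, q)\<in>set ?ps. (p \<noteq> 0 \<or> q \<noteq> 0) \<and>
          p * quartic (fst (models ! 4)) p q + q * quartic (snd (models ! 4)) p q = 0"
        unfolding quartic_models using 1 2 by simp
    qed simp_all
  qed
qed

section \<open>Conjugacy and linear equivalence\<close>

text \<open>
  For \<open>\<alpha> \<noteq> 0\<close> the left hand side would have order at most 1 at \<open>s = 0\<close>, while the right hand side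
  has order at least 4.
\<close>

lemma no_fourth_order_contact:
  fixes m \<alpha> :: complex
  assumes "\<And>s. (m + s) * \<alpha> = s ^ 4 * (p + s * q)"
  shows "\<alpha> = 0"
proof -
  have "m * \<alpha> = 0" using assms[of 0] by simp
  then have e: "s * \<alpha> = s ^ 4 * (p + s * q)" for s using assms[of s] by algebra
  have "\<alpha> = p + q" "- \<alpha> = p - q" "2 * \<alpha> = 16 * (p + 2 * q)"
    using e[of 1] e[of "- 1"] e[of 2] by simp_all
  then have "30 * \<alpha> = 0" by algebra
  then show ?thesis by simp
qed

text \<open>
  The form \<open>homogeneous_form a' b'\<close> vanishes to order 4 along every line through \<open>[0 : 0 : 1]\<close>, and
  \<open>M\<close> carries this point to a point with the same property for \<open>homogeneous_form a b\<close>. Along the line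
  through that point in the direction of the \<open>z\<close>-axis the coefficients of \<open>dx\<close> and \<open>dy\<close> are linear in
  the parameter, so they vanish identically, which only happens on the \<open>z\<close>-axis.
\<close>

lemma pullback_fixes_origin:
  assumes inv: "invertible M"
    and eq: "pullback M (homogeneous_form a b) = const3 l *s homogeneous_form a' b'"
    and no_zero: "\<And>x y. quartic a x y = 0 \<Longrightarrow> quartic b x y = 0 \<Longrightarrow> x = 0 \<and> y = 0"
  shows "M $ 1 $ 3 = 0 \<and> M $ 2 $ 3 = 0"
proof -
  obtain N where N: "M ** N = mat 1" using inv by (auto simp: invertible_def)
  define e3 :: "complex ^ 3" where "e3 = vector [0, 0, 1]"
  define u where "u = N *v e3"
  have Mu: "M *v u = e3" by (simp add: u_def matrix_vector_mul_assoc N)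
  have form: "form_at (homogeneous_form a b) (M *v v) (M *v w) = l * form_at (homogeneous_form a' b') v w" for v w
    using arg_cong[OF eq, of "\<lambda>\<omega>. form_at \<omega> v w"]
    by (simp add: form_at_pullback) (simp add: form_at_eval3 sum_3 algebra_simps)
  have line: "form_at (homogeneous_form a b) (vector [M $ 1 $ 3, M $ 2 $ 3, M $ 3 $ 3 + s]) (M *v w) =
      l * form_at (homogeneous_form a' b') (e3 + s *s u) w" for s w
  proof -
    have "M *v (e3 + s *s u) = vector [M $ 1 $ 3, M $ 2 $ 3, M $ 3 $ 3 + s]"
    proof -
      have "M $ i $ 1 * u $ 1 + M $ i $ 2 * u $ 2 + M $ i $ 3 * u $ 3 = e3 $ i" for i
        using arg_cong[OF Mu, of "\<lambda>v. v $ i"] by (simp add: matrix_vector_mult_def sum_3)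
      moreover have "(M *v (e3 + s *s u)) $ i =
          M $ i $ 3 + s * (M $ i $ 1 * u $ 1 + M $ i $ 2 * u $ 2 + M $ i $ 3 * u $ 3)" for i
        by (simp add: matrix_vector_mult_def sum_3 e3_def distrib_left mult.left_commute)
      ultimately have "(M *v (e3 + s *s u)) $ i = M $ i $ 3 + s * e3 $ i" for i by simp
      then show ?thesis by (simp add: vec_eq_iff forall_3 e3_def)
    qed
    then show ?thesis using form[of "e3 + s *s u" w] by simp
  qed
  have "\<exists>p q. \<forall>s. l * form_at (homogeneous_form a' b') (e3 + s *s u) w = s ^ 4 * (p + s * q)" for w
  proof (intro exI allI)
    fix s
    show "l * form_at (homogeneous_form a' b') (e3 + s *s u) w = s ^ 4 *
        (l * (quartic a' (u $ 1) (u $ 2) * w $ 1 + quartic b' (u $ 1) (u $ 2) * w $ 2) + s *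
          (l * (quartic a' (u $ 1) (u $ 2) * (u $ 3 * w $ 1 - u $ 1 * w $ 3) +
            quartic b' (u $ 1) (u $ 2) * (u $ 3 * w $ 2 - u $ 2 * w $ 3))))"
      by (simp add: form_at_homogeneous_form e3_def quartic_scale) algebra
  qed
  then have contact: "\<exists>p q. \<forall>s. form_at (homogeneous_form a b) (vector [M $ 1 $ 3, M $ 2 $ 3, M $ 3 $ 3 + s]) w =
      s ^ 4 * (p + s * q)" for w
  proof -
    have "M *v (N *v w) = w" by (simp add: matrix_vector_mul_assoc N)
    then show ?thesis
      using line[of _ "N *v w"] \<open>\<And>w. \<exists>p q. \<forall>s. l * form_at (homogeneous_form a' b') (e3 + s *s u) w = s ^ 4 * (p + s * q)\<close>[of "N *v w"]
      by simp
  qed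
  obtain p q where "\<forall>s. (M $ 3 $ 3 + s) * quartic a (M $ 1 $ 3) (M $ 2 $ 3) = s ^ 4 * (p + s * q)"
    using contact[of "vector [1, 0, 0]"] by (auto simp: form_at_homogeneous_form mult.commute)
  then have "quartic a (M $ 1 $ 3) (M $ 2 $ 3) = 0" using no_fourth_order_contact by blast
  moreover obtain p q where "\<forall>s. (M $ 3 $ 3 + s) * quartic b (M $ 1 $ 3) (M $ 2 $ 3) = s ^ 4 * (p + s * q)"
    using contact[of "vector [0, 1, 0]"] by (auto simp: form_at_homogeneous_form mult.commute)
  then have "quartic b (M $ 1 $ 3) (M $ 2 $ 3) = 0" using no_fourth_order_contact by blast
  ultimately show ?thesis by (rule no_zero)
qed

text \<open>
  Since \<open>M\<close> fixes \<open>[0 : 0 : 1]\<close>, the upper left block of \<open>M\<close> acts on \<open>x, y\<close>; the terms with the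
  factor \<open>z\<close> in the first two coefficients give the equivalence of the quartics.
\<close>

lemma plane_conjugate_if_pullback:
  assumes inv: "invertible M" and "l \<noteq> 0"
    and eq: "pullback M (homogeneous_form a b) = const3 l *s homogeneous_form a' b'"
    and no_zero: "\<And>x y. quartic a x y = 0 \<Longrightarrow> quartic b x y = 0 \<Longrightarrow> x = 0 \<and> y = 0"
  shows "plane_conjugate (a, b) (a', b')"
proof -
  let ?p = "M $ 1 $ 1" and ?q = "M $ 1 $ 2" and ?r = "M $ 2 $ 1" and ?s = "M $ 2 $ 2" and ?m = "M $ 3 $ 3"
  have 0: "M $ 1 $ 3 = 0" "M $ 2 $ 3 = 0" using pullback_fixes_origin[OF inv eq no_zero] by auto
  have "det M = ?m * (?p * ?s - ?q * ?r)" by (simp add: det_3 0 algebra_simps)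
  then have nz: "?m \<noteq> 0" "?p * ?s - ?q * ?r \<noteq> 0" using inv by (auto simp: invertible_det_nz)
  have comp: "(\<Sum>i\<in>UNIV. eval3 (homogeneous_form a b $ i) (M *v v) * M $ i $ j) =
      l * eval3 (homogeneous_form a' b' $ j) v" for j v
    using arg_cong[OF eq, of "\<lambda>\<omega>. eval3 (\<omega> $ j) v"] by simp
  let ?A = "\<lambda>x y. quartic a (?p * x + ?q * y) (?r * x + ?s * y)" and ?B = "\<lambda>x y. quartic b (?p * x + ?q * y) (?r * x + ?s * y)"
  have "?m * (?p * ?A x y + ?r * ?B x y) = l * quartic a' x y"
    "?m * (?q * ?A x y + ?s * ?B x y) = l * quartic b' x y" for x y
  proof -
    define A B where "A = ?A x y" and "B = ?B x y"
    have Mv: "(M *v vector [x, y, z]) $ 1 = ?p * x + ?q * y" "(M *v vector [x, y, z]) $ 2 = ?r * x + ?s * y"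
      "(M *v vector [x, y, z]) $ 3 = M $ 3 $ 1 * x + M $ 3 $ 2 * y + ?m * z" for z
      by (simp_all add: matrix_vector_mult_def sum_3 0)
    note comp = comp[unfolded sum_3 eval3_homogeneous_form]
    \<comment> \<open>The terms with the factor \<open>z\<close> are the differences of the values at \<open>z = 1\<close> and \<open>z = 0\<close>.\<close>
    note 1 = comp[of "vector [x, y, 1]" 1] comp[of "vector [x, y, 0]" 1]
    note 2 = comp[of "vector [x, y, 1]" 2] comp[of "vector [x, y, 0]" 2]
    from 1 show "?m * (?p * ?A x y + ?r * ?B x y) = l * quartic a' x y"
      unfolding eval3_homogeneous_form Mv vector_3 A_def[symmetric] B_def[symmetric] by algebra
    from 2 show "?m * (?q * ?A x y + ?s * ?B x y) = l * quartic b' x y"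
      unfolding eval3_homogeneous_form Mv vector_3 A_def[symmetric] B_def[symmetric] by algebra
  qed
  then have "plane_transform ?p ?q ?r ?s (l / ?m) a b a' b'"
    using nz \<open>l \<noteq> 0\<close> unfolding plane_transform_def by (simp add: field_simps)
  then show ?thesis by (rule plane_conjugateI)
qed

lemma conjugate_foliation_of_iff:
  "conjugate (foliation_of \<omega>) (foliation_of \<eta>) \<longleftrightarrow>
    (\<exists>M l. invertible M \<and> l \<noteq> 0 \<and> pullback M \<omega> = const3 l *s \<eta>)"
proof
  assume "conjugate (foliation_of \<omega>) (foliation_of \<eta>)"
  then obtain M where M: "invertible M" "pullback M ` foliation_of \<omega> = foliation_of \<eta>"
    by (auto simp: conjugate_def)
  have "\<omega> \<in> foliation_of \<omega>" unfolding foliation_of_def by (rule CollectI, rule exI[of _ 1]) (simp add: const3_1)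
  then have "pullback M \<omega> \<in> foliation_of \<eta>" using M(2) by blast
  then show "\<exists>M l. invertible M \<and> l \<noteq> 0 \<and> pullback M \<omega> = const3 l *s \<eta>"
    using M(1) unfolding foliation_of_def by blast
next
  assume "\<exists>M l. invertible M \<and> l \<noteq> 0 \<and> pullback M \<omega> = const3 l *s \<eta>"
  then obtain M l where M: "invertible M" and l: "l \<noteq> 0" "pullback M \<omega> = const3 l *s \<eta>" by blast
  have "pullback M ` foliation_of \<omega> = foliation_of \<eta>"
  proof (intro subset_antisym subsetI)
    fix \<zeta> assume "\<zeta> \<in> pullback M ` foliation_of \<omega>"
    then obtain c where "c \<noteq> 0" "\<zeta> = const3 c *s (const3 l *s \<eta>)"
      by (auto simp: foliation_of_def pullback_scale l)
    then have "\<zeta> = const3 (c * l) *s \<eta>" "c * l \<noteq> 0" using l by (simp_all add: const3_mult)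
    then show "\<zeta> \<in> foliation_of \<eta>" unfolding foliation_of_def by blast
  next
    fix \<zeta> assume "\<zeta> \<in> foliation_of \<eta>"
    then obtain c where c: "c \<noteq> 0" "\<zeta> = const3 c *s \<eta>" by (auto simp: foliation_of_def)
    then have "\<zeta> = pullback M (const3 (c / l) *s \<omega>)" using l by (simp add: pullback_scale const3_mult)
    moreover have "const3 (c / l) *s \<omega> \<in> foliation_of \<omega>" using c l unfolding foliation_of_def by force
    ultimately show "\<zeta> \<in> pullback M ` foliation_of \<omega>" by blast
  qed
  then show "conjugate (foliation_of \<omega>) (foliation_of \<eta>)" using M unfolding conjugate_def by blast
qed

section \<open>Invariants of linear equivalence\<close>

text \<open>
  A list of fixed critical points with pairwise different images in the projective line.
\<close>

definition fixed_critical_points :: "complex poly \<times> complex poly \<Rightarrow> (complex \<times> complex) list \<Rightarrow> bool" where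
  "fixed_critical_points ab ps \<longleftrightarrow> (\<forall>(x, y)\<in>set ps. fixed_critical_point (fst ab) (snd ab) x y) \<and>
     sorted_wrt (\<lambda>(x, y) (x', y'). x * y' - x' * y \<noteq> 0) ps"

text \<open>
  A combination \<open>p A + q B\<close> is a fourth power exactly when the map \<open>[- B : A]\<close> takes the value
  \<open>[p : q]\<close> with multiplicity 4 at one point.
\<close>

definition totally_ramified :: "complex poly \<times> complex poly \<Rightarrow> bool" where
  "totally_ramified ab \<longleftrightarrow> (\<exists>p q c e f. (p \<noteq> 0 \<or> q \<noteq> 0) \<and>
     (\<forall>x y. p * quartic (fst ab) x y + q * quartic (snd ab) x y = c * (e * x + f * y) ^ 4))"

lemma fixed_critical_points_conjugate:
  assumes "plane_conjugate ab ab'" "fixed_critical_points ab ps"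
  shows "\<exists>ps'. fixed_critical_points ab' ps' \<and> length ps' = length ps"
proof -
  obtain p q r s l where tr: "plane_transform p q r s l (fst ab) (snd ab) (fst ab') (snd ab')"
    using assms(1) by (auto simp: plane_conjugate_def)
  define d where "d = 1 / (p * s - q * r)"
  have d: "d * (p * s - q * r) = 1" using tr by (simp add: d_def plane_transform_def)
  then have "d \<noteq> 0" by auto
  let ?f = "\<lambda>(x, y). (d * (s * x - q * y), d * (p * y - r * x))"
  have crit: "fixed_critical_point (fst ab') (snd ab') (d * (s * x - q * y)) (d * (p * y - r * x))"
    if "fixed_critical_point (fst ab) (snd ab) x y" for x y
  proof (rule fixed_critical_point_transform[OF tr])
    have "p * (d * (s * x - q * y)) + q * (d * (p * y - r * x)) = x"
      "r * (d * (s * x - q * y)) + s * (d * (p * y - r * x)) = y" using d by algebra+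
    then show "fixed_critical_point (fst ab) (snd ab) (p * (d * (s * x - q * y)) + q * (d * (p * y - r * x)))
        (r * (d * (s * x - q * y)) + s * (d * (p * y - r * x)))" using that by simp
  qed
  have det: "d * (s * x - q * y) * (d * (p * y' - r * x')) - d * (s * x' - q * y') * (d * (p * y - r * x)) =
      d * (x * y' - x' * y)" for x y x' y' using d by algebra
  have "sorted_wrt (\<lambda>u v. (\<lambda>(x, y) (x', y'). x * y' - x' * y \<noteq> 0) (?f u) (?f v)) ps"
  proof (rule sorted_wrt_mono_rel)
    show "sorted_wrt (\<lambda>(x, y) (x', y'). x * y' - x' * y \<noteq> 0) ps"
      using assms(2) by (simp add: fixed_critical_points_def)
    fix u v :: "complex \<times> complex"
    assume nz: "(\<lambda>(x, y) (x', y'). x * y' - x' * y \<noteq> 0) u v"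
    obtain x y x' y' where uv: "u = (x, y)" "v = (x', y')" by (metis prod.exhaust)
    show "(\<lambda>(x, y) (x', y'). x * y' - x' * y \<noteq> 0) (?f u) (?f v)"
      using nz \<open>d \<noteq> 0\<close> unfolding uv prod.case det by simp
  qed
  then have "fixed_critical_points ab' (map ?f ps)"
    using assms(2) crit unfolding fixed_critical_points_def sorted_wrt_map by auto
  then show ?thesis by (intro exI[of _ "map ?f ps"]) simp
qed

lemma totally_ramified_conjugate:
  assumes "plane_conjugate ab ab'" "totally_ramified ab"
  shows "totally_ramified ab'"
proof -
  obtain p q r s l where tr: "plane_transform p q r s l (fst ab) (snd ab) (fst ab') (snd ab')"
    using assms(1) by (auto simp: plane_conjugate_def)
  obtain P Q c e f where PQ: "P \<noteq> 0 \<or> Q \<noteq> 0"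
    and pow: "\<And>x y. P * quartic (fst ab) x y + Q * quartic (snd ab) x y = c * (e * x + f * y) ^ 4"
    using assms(2) unfolding totally_ramified_def by blast
  define d where "d = 1 / (p * s - q * r)"
  have d: "d * (p * s - q * r) = 1" using tr by (simp add: d_def plane_transform_def)
  have "l \<noteq> 0" using tr by (simp add: plane_transform_def)
  let ?P = "d * (s * P - q * Q)" and ?Q = "d * (p * Q - r * P)"
  have P: "P = p * ?P + q * ?Q" and Q: "Q = r * ?P + s * ?Q" using d by algebra+
  have "?P \<noteq> 0 \<or> ?Q \<noteq> 0"
  proof (rule ccontr)
    assume "\<not> ?thesis"
    then have "?P = 0" "?Q = 0" by auto
    then have "P = 0" "Q = 0" by (metis P add_0 mult_zero_right, metis Q add_0 mult_zero_right)
    then show False using PQ by simp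
  qed
  moreover have "?P * quartic (fst ab') x y + ?Q * quartic (snd ab') x y =
      c / l * ((e * p + f * r) * x + (e * q + f * s) * y) ^ 4" for x y
  proof -
    define A B where "A = quartic (fst ab) (p * x + q * y) (r * x + s * y)"
      and "B = quartic (snd ab) (p * x + q * y) (r * x + s * y)"
    have 1: "p * A + r * B = l * quartic (fst ab') x y" "q * A + s * B = l * quartic (snd ab') x y"
      using tr by (simp_all add: plane_transform_def A_def B_def)
    have "l * (?P * quartic (fst ab') x y + ?Q * quartic (snd ab') x y) =
        ?P * (p * A + r * B) + ?Q * (q * A + s * B)" unfolding 1 by algebra
    also have "\<dots> = (p * ?P + q * ?Q) * A + (r * ?P + s * ?Q) * B" by algebra
    also have "\<dots> = P * A + Q * B" using P Q by metis
    also have "\<dots> = c * (e * (p * x + q * y) + f * (r * x + s * y)) ^ 4"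
      unfolding A_def B_def by (rule pow)
    also have "e * (p * x + q * y) + f * (r * x + s * y) = (e * p + f * r) * x + (e * q + f * s) * y" by algebra
    finally show ?thesis using \<open>l \<noteq> 0\<close> by (simp add: field_simps)
  qed
  ultimately show ?thesis unfolding totally_ramified_def by blast
qed

text \<open>
  Whether there are at least three, respectively four, fixed critical points, and whether the map is
  totally ramified somewhere.
\<close>

definition invariants :: "complex poly \<times> complex poly \<Rightarrow> bool \<times> bool \<times> bool" where
  "invariants ab = ((\<exists>ps. fixed_critical_points ab ps \<and> length ps = 3),
     (\<exists>ps. fixed_critical_points ab ps \<and> length ps = 4), totally_ramified ab)"

lemma invariants_conjugate:
  assumes "plane_conjugate ab ab'"
  shows "invariants ab = invariants ab'"
  using assms plane_conjugate_sym[OF assms] fixed_critical_points_conjugate totally_ramified_conjugate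
  unfolding invariants_def prod.inject by metis

lemma fixed_critical_point_models:
  "fixed_critical_point (fst (models ! 0)) (snd (models ! 0)) x y \<longleftrightarrow> x = 0 \<or> y = 0"
  "fixed_critical_point (fst (models ! 1)) (snd (models ! 1)) x y \<longleftrightarrow> x = 0 \<or> y = 0 \<or> x = y"
  "fixed_critical_point (fst (models ! 2)) (snd (models ! 2)) x y \<longleftrightarrow> x = 0 \<or> y = 0 \<or> x = - y"
  "fixed_critical_point (fst (models ! 3)) (snd (models ! 3)) x y \<longleftrightarrow> x = 0 \<or> y = 0 \<or> x ^ 2 + 3 * x * y + y ^ 2 = 0"
  "fixed_critical_point (fst (models ! 4)) (snd (models ! 4)) x y \<longleftrightarrow> x = 0 \<or> y = 0 \<or> 3 * x ^ 2 + 3 * x * y + y ^ 2 = 0"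
proof -
  note m = models_nth
  have "x * quartic_dx (fst (models ! 0)) x y + y * quartic_dx (snd (models ! 0)) x y = - 4 * x ^ 3 * y"
    "x * quartic_dy (fst (models ! 0)) x y + y * quartic_dy (snd (models ! 0)) x y = 4 * x * y ^ 3"
    unfolding m fst_conv snd_conv quartic_deriv_pCons by algebra+
  note e0 = this
  have "x * quartic_dx (fst (models ! 1)) x y + y * quartic_dx (snd (models ! 1)) x y = 2 * x * y * ((y - x) * (y - 2 * x))"
    "x * quartic_dy (fst (models ! 1)) x y + y * quartic_dy (snd (models ! 1)) x y = 2 * x * y * ((y - x) * (2 * y - x) * (- 1))"
    unfolding m fst_conv snd_conv quartic_deriv_pCons by algebra+
  note e1 = this
  have "x * quartic_dx (fst (models ! 2)) x y + y * quartic_dx (snd (models ! 2)) x y = 4 * x * y * ((x + y) * (y - x))"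
    "x * quartic_dy (fst (models ! 2)) x y + y * quartic_dy (snd (models ! 2)) x y = 4 * x * y * ((x + y) * (2 * x + y))"
    unfolding m fst_conv snd_conv quartic_deriv_pCons by algebra+
  note e2 = this
  have "x * quartic_dx (fst (models ! 3)) x y + y * quartic_dx (snd (models ! 3)) x y = 4 * x * y * (x ^ 2 + 3 * x * y + y ^ 2)"
    "x * quartic_dy (fst (models ! 3)) x y + y * quartic_dy (snd (models ! 3)) x y = 4 * x * y * (x ^ 2 + 3 * x * y + y ^ 2)"
    unfolding m fst_conv snd_conv quartic_deriv_pCons by algebra+
  note e3 = this
  have "x * quartic_dx (fst (models ! 4)) x y + y * quartic_dx (snd (models ! 4)) x y = 4 * x * y * (3 * x ^ 2 + 3 * x * y + y ^ 2)"
    "x * quartic_dy (fst (models ! 4)) x y + y * quartic_dy (snd (models ! 4)) x y = 4 * x * y * (3 * x ^ 2 + 3 * x * y + y ^ 2)"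
    unfolding m fst_conv snd_conv quartic_deriv_pCons by algebra+
  note e4 = this
  show "fixed_critical_point (fst (models ! 0)) (snd (models ! 0)) x y \<longleftrightarrow> x = 0 \<or> y = 0"
    unfolding fixed_critical_point_def e0 by auto
  show "fixed_critical_point (fst (models ! 1)) (snd (models ! 1)) x y \<longleftrightarrow> x = 0 \<or> y = 0 \<or> x = y"
    unfolding fixed_critical_point_def e1 by auto
  have "fixed_critical_point (fst (models ! 2)) (snd (models ! 2)) x y \<longleftrightarrow> x = 0 \<or> y = 0 \<or> x + y = 0"
    unfolding fixed_critical_point_def e2 by (auto simp: add_eq_0_iff)
  then show "fixed_critical_point (fst (models ! 2)) (snd (models ! 2)) x y \<longleftrightarrow> x = 0 \<or> y = 0 \<or> x = - y"
    by (simp add: eq_neg_iff_add_eq_0)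
  show "fixed_critical_point (fst (models ! 3)) (snd (models ! 3)) x y \<longleftrightarrow>
      x = 0 \<or> y = 0 \<or> x ^ 2 + 3 * x * y + y ^ 2 = 0"
    unfolding fixed_critical_point_def e3 by simp
  show "fixed_critical_point (fst (models ! 4)) (snd (models ! 4)) x y \<longleftrightarrow>
      x = 0 \<or> y = 0 \<or> 3 * x ^ 2 + 3 * x * y + y ^ 2 = 0"
    unfolding fixed_critical_point_def e4 by simp
qed

lemma length_4_cases: "length xs = 4 \<Longrightarrow> \<exists>p q r s. xs = [p, q, r, s]"
  and length_3_cases: "length xs = 3 \<Longrightarrow> \<exists>p q r. xs = [p, q, r]"
  by (simp_all add: numeral_eq_Suc length_Suc_conv) blast+

lemma fixed_critical_points_take: "fixed_critical_points ab ps \<Longrightarrow> fixed_critical_points ab (take n ps)"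
  unfolding fixed_critical_points_def by (auto simp: sorted_wrt_take dest: in_set_takeD)

text \<open>
  The fixed critical points of the models are computed in \<open>fixed_critical_point_models\<close>. The combinations
  of the quartics in the second and the fourth model lack the monomial \<open>x\<^sup>2 y\<^sup>2\<close>, so a
  fourth power among them would be a multiple of \<open>x\<^sup>4\<close> or \<open>y\<^sup>4\<close>, which their other monomials exclude.
\<close>

lemma invariants_models:
  "invariants (models ! 0) = (False, False, True)" "invariants (models ! 1) = (True, False, False)"
  "invariants (models ! 2) = (True, False, True)" "invariants (models ! 3) = (True, True, False)"
  "invariants (models ! 4) = (True, True, True)"
proof -
  \<comment> \<open>Among four points on three lines through the origin two are proportional.\<close>
  have few: "\<not> (fixed_critical_points ab ps \<and> length ps = 4)"
    if "\<And>x y. fixed_critical_point (fst ab) (snd ab) x y \<Longrightarrow> x = 0 \<or> y = 0 \<or> x = m * y" for ab ps m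
  proof
    assume ps: "fixed_critical_points ab ps \<and> length ps = 4"
    then obtain x1 y1 x2 y2 x3 y3 x4 y4 where eq: "ps = [(x1, y1), (x2, y2), (x3, y3), (x4, y4)]"
      using length_4_cases by (metis prod.exhaust)
    have "x1 = 0 \<or> y1 = 0 \<or> x1 = m * y1" "x2 = 0 \<or> y2 = 0 \<or> x2 = m * y2"
      "x3 = 0 \<or> y3 = 0 \<or> x3 = m * y3" "x4 = 0 \<or> y4 = 0 \<or> x4 = m * y4"
      using ps that unfolding fixed_critical_points_def eq by simp_all
    moreover have "x1 * y2 - x2 * y1 \<noteq> 0" "x1 * y3 - x3 * y1 \<noteq> 0" "x1 * y4 - x4 * y1 \<noteq> 0"
      "x2 * y3 - x3 * y2 \<noteq> 0" "x2 * y4 - x4 * y2 \<noteq> 0" "x3 * y4 - x4 * y3 \<noteq> 0"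
      using ps unfolding fixed_critical_points_def eq by simp_all
    ultimately show False by (elim disjE) simp_all
  qed
  have few3: "\<not> (fixed_critical_points (models ! 0) ps \<and> length ps = 3)" for ps
  proof
    assume ps: "fixed_critical_points (models ! 0) ps \<and> length ps = 3"
    then obtain x1 y1 x2 y2 x3 y3 where eq: "ps = [(x1, y1), (x2, y2), (x3, y3)]"
      using length_3_cases by (metis prod.exhaust)
    have "x1 = 0 \<or> y1 = 0" "x2 = 0 \<or> y2 = 0" "x3 = 0 \<or> y3 = 0"
      using ps unfolding fixed_critical_points_def eq by (simp_all add: fixed_critical_point_models)
    moreover have "x1 * y2 - x2 * y1 \<noteq> 0" "x1 * y3 - x3 * y1 \<noteq> 0" "x2 * y3 - x3 * y2 \<noteq> 0"
      using ps unfolding fixed_critical_points_def eq by simp_all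
    ultimately show False by (elim disjE) simp_all
  qed
  have three: "\<exists>ps. fixed_critical_points ab ps \<and> length ps = 3" if "\<exists>ps. fixed_critical_points ab ps \<and> length ps = 4" for ab
    using that fixed_critical_points_take[of ab _ 3] by (metis length_take min_def numeral_le_iff semiring_norm(69,71,72))
  have 1: "fixed_critical_points (models ! 1) [(1, 0), (0, 1), (1, 1)]"
    and 2: "fixed_critical_points (models ! 2) [(1, 0), (0, 1), (- 1, 1)]"
    by (simp_all add: fixed_critical_points_def fixed_critical_point_models
        fixed_critical_point_models(2)[unfolded One_nat_def] eq_neg_iff_add_eq_0)
  obtain z :: complex where z: "z ^ 2 + 3 * z + 1 = 0" using quadratic_root by blast
  have 3: "fixed_critical_points (models ! 3) [(1, 0), (0, 1), (z, 1), (- 3 - z, 1)]"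
  proof -
    have "(- 3 - z) ^ 2 + 3 * (- 3 - z) * 1 + 1 ^ 2 = 0" "z ^ 2 + 3 * z * 1 + 1 ^ 2 = 0"
      using z by (simp_all add: power2_eq_square algebra_simps)
    moreover have "(z - (- 3 - z)) ^ 2 = 5" using z by algebra
    then have "z - (- 3 - z) \<noteq> 0" by auto
    moreover have "z \<noteq> 0" using z by auto
    moreover have "- 3 - z \<noteq> 0" 
    proof
      assume "- 3 - z = 0"
      then have "(1 :: complex) = 0" using z by algebra
      then show False by simp
    qed
    ultimately show ?thesis
      by (simp add: fixed_critical_points_def fixed_critical_point_models eq_neg_iff_add_eq_0)
  qed
  obtain w :: complex where "w ^ 2 + 1 * w + 1 / 3 = 0" using quadratic_root by blast
  then have w: "3 * w ^ 2 + 3 * w + 1 = 0" by algebra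
  have 4: "fixed_critical_points (models ! 4) [(1, 0), (0, 1), (w, 1), (- 1 - w, 1)]"
  proof -
    have "3 * (- 1 - w) ^ 2 + 3 * (- 1 - w) * 1 + 1 ^ 2 = 0" "3 * w ^ 2 + 3 * w * 1 + 1 ^ 2 = 0"
      using w by (simp_all add: power2_eq_square algebra_simps)
    moreover have "3 * (w - (- 1 - w)) ^ 2 = - 1" using w by algebra
    then have "w - (- 1 - w) \<noteq> 0" by auto
    moreover have "w \<noteq> 0" using w by auto
    moreover have "- 1 - w \<noteq> 0" 
    proof
      assume "- 1 - w = 0"
      then have "(1 :: complex) = 0" using w by algebra
      then show False by simp
    qed
    ultimately show ?thesis
      by (simp add: fixed_critical_points_def fixed_critical_point_models eq_neg_iff_add_eq_0)
  qed
  have ramified: "totally_ramified (models ! 0)" "totally_ramified (models ! 2)" "totally_ramified (models ! 4)"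
  proof -
    have "1 * quartic (fst (models ! 0)) x y + 0 * quartic (snd (models ! 0)) x y = 1 * (0 * x + 1 * y) ^ 4"
      "1 * quartic (fst (models ! 2)) x y + (- 1) * quartic (snd (models ! 2)) x y = 1 * (1 * x + 1 * y) ^ 4"
      "0 * quartic (fst (models ! 4)) x y + 1 * quartic (snd (models ! 4)) x y = 3 * (1 * x + 0 * y) ^ 4" for x y
      unfolding quartic_models by algebra+
    moreover have "(1 :: complex) \<noteq> 0" by simp
    ultimately show "totally_ramified (models ! 0)" "totally_ramified (models ! 2)" "totally_ramified (models ! 4)"
      unfolding totally_ramified_def by blast+
  qed
  have unramified: "\<not> totally_ramified ab"
    if ab: "\<And>x y. quartic (fst ab) x y = k * x * y ^ 3 + m * y ^ 4"
      "\<And>x y. quartic (snd ab) x y = k' * x ^ 3 * y + m' * x ^ 4" and k: "k \<noteq> 0" "k' \<noteq> 0" for ab k m k' m'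
  proof
    assume "totally_ramified ab"
    then obtain p q c e f where pq: "p \<noteq> 0 \<or> q \<noteq> 0"
      and eq: "\<And>x y. p * quartic (fst ab) x y + q * quartic (snd ab) x y = c * (e * x + f * y) ^ 4"
      unfolding totally_ramified_def by blast
    have "(q * m' - c * e ^ 4) * x ^ 4 + (q * k' - 4 * c * e ^ 3 * f) * x ^ 3 * y
      + (- (6 * c * e ^ 2 * f ^ 2)) * x ^ 2 * y ^ 2 + (p * k - 4 * c * e * f ^ 3) * x * y ^ 3
      + (p * m - c * f ^ 4) * y ^ 4 = 0" for x y
      using eq[of x y] unfolding ab by algebra
    note coeffs = quartic_zero[OF this]
    from coeffs(3) have "c = 0 \<or> e = 0 \<or> f = 0" by simp
    then have "q * k' = 0" "p * k = 0" using coeffs(2,4) by auto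
    then show False using pq k by simp
  qed
  have "quartic (fst (models ! 1)) x y = 2 * x * y ^ 3 + - 1 * y ^ 4"
    "quartic (snd (models ! 1)) x y = - 2 * x ^ 3 * y + 1 * x ^ 4" for x y
    unfolding quartic_models by algebra+
  then have "\<not> totally_ramified (models ! 1)" by (rule unramified) simp_all
  moreover have "quartic (fst (models ! 3)) x y = 4 * x * y ^ 3 + 1 * y ^ 4"
    "quartic (snd (models ! 3)) x y = 4 * x ^ 3 * y + 1 * x ^ 4" for x y
    unfolding quartic_models by algebra+
  then have "\<not> totally_ramified (models ! 3)" by (rule unramified) simp_all
  moreover have "\<not> (fixed_critical_points (models ! 0) ps \<and> length ps = 4)" for ps
    by (rule few[where m = "0"], simp only: fixed_critical_point_models, auto)
  moreover have "\<not> (fixed_critical_points (models ! 1) ps \<and> length ps = 4)" for ps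
    by (rule few[where m = "1"], simp only: fixed_critical_point_models, auto)
  moreover have "\<not> (fixed_critical_points (models ! 2) ps \<and> length ps = 4)" for ps
    by (rule few[where m = "- 1"], simp only: fixed_critical_point_models, auto)
  moreover have "\<exists>ps. fixed_critical_points (models ! 1) ps \<and> length ps = 3"
    using 1 by (intro exI[of _ "[(1, 0), (0, 1), (1, 1)]"]) simp
  moreover have "\<exists>ps. fixed_critical_points (models ! 2) ps \<and> length ps = 3"
    using 2 by (intro exI[of _ "[(1, 0), (0, 1), (- 1, 1)]"]) simp
  moreover have four: "\<exists>ps. fixed_critical_points (models ! 3) ps \<and> length ps = 4"
    using 3 by (intro exI[of _ "[(1, 0), (0, 1), (z, 1), (- 3 - z, 1)]"]) simp
  moreover have four': "\<exists>ps. fixed_critical_points (models ! 4) ps \<and> length ps = 4"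
    using 4 by (intro exI[of _ "[(1, 0), (0, 1), (w, 1), (- 1 - w, 1)]"]) simp
  moreover note few3 ramified three[OF four] three[OF four']
  ultimately show "invariants (models ! 0) = (False, False, True)" "invariants (models ! 1) = (True, False, False)"
    "invariants (models ! 2) = (True, False, True)" "invariants (models ! 3) = (True, True, False)"
    "invariants (models ! 4) = (True, True, True)"
    unfolding invariants_def prod.inject by blast+
qed

lemma model_foliations_not_conjugate:
  assumes ij: "i < 5" "j < 5" "i \<noteq> j"
  shows "\<not> conjugate (model_foliation (models ! i)) (model_foliation (models ! j))"
proof
  assume "conjugate (model_foliation (models ! i)) (model_foliation (models ! j))"
  then obtain M l where M: "invertible M" "l \<noteq> 0"
    "pullback M (homogeneous_form (fst (models ! i)) (snd (models ! i))) =
      const3 l *s homogeneous_form (fst (models ! j)) (snd (models ! j))"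
    unfolding model_foliation_def conjugate_foliation_of_iff by blast
  have "plane_conjugate (fst (models ! i), snd (models ! i)) (fst (models ! j), snd (models ! j))"
    by (rule plane_conjugate_if_pullback[OF M]) (rule quartic_models_no_zero[OF ij(1)])
  then have "invariants (models ! i) = invariants (models ! j)"
    using invariants_conjugate[of "models ! i" "models ! j"] by simp
  moreover have "i = 0 \<or> i = 1 \<or> i = 2 \<or> i = 3 \<or> i = 4" "j = 0 \<or> j = 1 \<or> j = 2 \<or> j = 3 \<or> j = 4"
    using ij by linarith+
  ultimately show False using \<open>i \<noteq> j\<close> by (elim disjE) (simp_all add: invariants_models invariants_models(2)[unfolded One_nat_def])
qed

lemma conjugate_to_model:
  assumes "homogeneous_foliation 4 \<F>" "convex_foliation 4 \<F>"
  shows "\<exists>i<5. conjugate \<F> (model_foliation (models ! i))"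
proof -
  obtain \<omega> M a b where \<F>: "\<F> = {const3 c *s \<omega> | c. c \<noteq> 0}" and M: "invertible M"
    "pullback M \<omega> = homogeneous_form a b" and ab: "degree a \<le> 4" "degree b \<le> 4"
    "\<And>r. poly a r \<noteq> 0 \<or> poly b r \<noteq> 0"
    "\<And>r. poly (wronskian a b) r = 0 \<Longrightarrow> r * poly a r + poly b r = 0"
    "coeff a 4 * coeff b 3 \<noteq> coeff a 3 * coeff b 4"
    by (rule convex_homogeneous_normal_form[OF assms]) (rule that; assumption)
  obtain i where i: "i < 5" "plane_conjugate (a, b) (models ! i)"
  proof (rule plane_classification)
    show "degree a \<le> 4" "degree b \<le> 4" "coeff a 4 * coeff b 3 \<noteq> coeff a 3 * coeff b 4"
      by (fact ab)+
    show "poly a r \<noteq> 0 \<or> poly b r \<noteq> 0" for r by (rule ab(3))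
    show "r * poly a r + poly b r = 0" if "poly (wronskian a b) r = 0" for r
      using that by (rule ab(4))
  qed (rule that)
  obtain p q r s l where tr: "plane_transform p q r s l a b (fst (models ! i)) (snd (models ! i))"
    using i(2) unfolding plane_conjugate_def fst_conv snd_conv by blast
  note tr = tr[unfolded plane_transform_def]
  have "pullback (plane_matrix p q r s) (homogeneous_form a b) =
      const3 l *s homogeneous_form (fst (models ! i)) (snd (models ! i))"
    by (rule pullback_plane_matrix) (use tr in blast)+
  then have "pullback (M ** plane_matrix p q r s) \<omega> =
      const3 l *s homogeneous_form (fst (models ! i)) (snd (models ! i))"
    unfolding pullback_pullback[symmetric] M(2) .
  moreover have "invertible (M ** plane_matrix p q r s)"
    using tr by (intro invertible_mult M(1) invertible_plane_matrix) blast
  moreover have "l \<noteq> 0" using tr by blast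
  ultimately have "conjugate (foliation_of \<omega>) (model_foliation (models ! i))"
    unfolding model_foliation_def conjugate_foliation_of_iff by blast
  moreover have "\<F> = foliation_of \<omega>" unfolding \<F> foliation_of_def ..
  ultimately show ?thesis using i(1) by blast
qed

section \<open>The classification theorem\<close>

theorem theoremA:
  fixes \<H> :: "foliation list"
  assumes "\<H> = [\<H>1, \<H>2, \<H>3, \<H>4, \<H>5]"
  shows "(\<forall>i<5. homogeneous_foliation 4 (\<H> ! i) \<and> convex_foliation 4 (\<H> ! i)) \<and>
    (\<forall>\<F>. homogeneous_foliation 4 \<F> \<and> convex_foliation 4 \<F> \<longrightarrow>
      (\<exists>i<5. conjugate \<F> (\<H> ! i))) \<and>
    (\<forall>i<5. \<forall>j<5. i \<noteq> j \<longrightarrow> \<not> conjugate (\<H> ! i) (\<H> ! j))"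
proof -
  have \<H>: "\<H> ! i = model_foliation (models ! i)" if "i < 5" for i
  proof -
    have "i = 0 \<or> i = 1 \<or> i = 2 \<or> i = 3 \<or> i = 4" using that by linarith
    then show ?thesis by (elim disjE) (simp_all add: assms model_foliation_eq model_foliation_eq(2)[unfolded One_nat_def])
  qed
  show ?thesis
  proof (intro conjI allI impI)
    fix i :: nat assume i: "i < 5"
    show "homogeneous_foliation 4 (\<H> ! i)"
      unfolding \<H>[OF i] model_foliation_def
      by (rule homogeneous_foliation_model[OF foliation_form_model[OF i]])
    show "convex_foliation 4 (\<H> ! i)"
      unfolding \<H>[OF i] by (rule convex_foliation_models[OF i])
    fix j :: nat assume "j < 5" "i \<noteq> j"
    then show "\<not> conjugate (\<H> ! i) (\<H> ! j)"
      using model_foliations_not_conjugate[OF i] by (simp only: \<H> i not_False_eq_True)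
  next
    fix \<F> assume "homogeneous_foliation 4 \<F> \<and> convex_foliation 4 \<F>"
    then obtain i where "i < 5" "conjugate \<F> (model_foliation (models ! i))"
      using conjugate_to_model by blast
    then show "\<exists>i<5. conjugate \<F> (\<H> ! i)" using \<H> by (intro exI[of _ i]) simp
  qed
qed

end
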